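(* There exists an efficient (polynomial-time in $n$) algorithm that, given a non-negative submodular function $f\colon 2^{\mathcal{N}} \to \mathbb{R}^+$ (accessed via a value oracle) and an integer cardinality parameter $1 \leq k \leq n$, achieves an approximation ratio of $e^{-1} - o(1)$ for the problem $\max\{f(S) : S\subseteq \mathcal{N},\ |S| = k\}$.
   Context: $\mathcal{N}$ is a finite ground set with $n=|\mathcal{N}|$. $f$ is submodular if $f(A)+f(B)\ge f(A\cup B)+f(A\cap B)$ for all $A,B\subseteq\mathcal{N}$. A value oracle returns $f(S)$ for a queried $S$. An approximation ratio $\alpha$ means the (expected) value of the output feasible set is at least $\alpha$ times the optimum. The $o(1)$ term tends to $0$ as $n\to\infty$. *)

theory Defs
  imports "HOL-Probability.Probability" "HOL-Computational_Algebra.Polynomial"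
begin

section \<open>Submodular maximization under an exact cardinality constraint\<close>

definition submodular_on :: "'a set \<Rightarrow> ('a set \<Rightarrow> real) \<Rightarrow> bool" where
  "submodular_on N f \<longleftrightarrow>
     (\<forall>A B. A \<subseteq> N \<longrightarrow> B \<subseteq> N \<longrightarrow> f A + f B \<ge> f (A \<union> B) + f (A \<inter> B))"

definition nonneg_on :: "'a set \<Rightarrow> ('a set \<Rightarrow> real) \<Rightarrow> bool" where
  "nonneg_on N f \<longleftrightarrow> (\<forall>S. S \<subseteq> N \<longrightarrow> 0 \<le> f S)"

definition feasible :: "'a set \<Rightarrow> nat \<Rightarrow> 'a set set" where
  "feasible N k = {S. S \<subseteq> N \<and> card S = k}"

definition opt_value :: "'a set \<Rightarrow> ('a set \<Rightarrow> real) \<Rightarrow> nat \<Rightarrow> real" where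
  "opt_value N f k = Max (f ` feasible N k)"


section \<open>Randomized programs with a value oracle\<close>

text \<open>
  The machine is a random access machine with unit-cost instructions, working on natural
  numbers and, since oracle answers are arbitrary reals, on real numbers.  Scalars and arrays
  are named by numbers fixed in the program text; array cells are addressed by computed indices.

  The instruction set is deliberately weak, so that a polynomial number of steps really is
  polynomial time.  On naturals there are only addition and truncated subtraction: after \<open>t\<close>
  steps every number has \<open>O(t)\<close> more bits than the input.  (Unit-cost multiplication would
  yield numbers of exponential length.)  On reals there are only addition, subtraction and
  comparison, and no conversion back to naturals.
\<close>

datatype nexp =
    NConst nat
  | NVar nat
  | NArr nat nexp
  | NAdd nexp nexp
  | NSub nexp nexp

datatype rexp =
    RZero
  | ROne
  | RVar nat
  | RArr nat nexp
  | RAdd rexp rexp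
  | RSub rexp rexp

datatype bexp =
    NLess nexp nexp
  | RLess rexp rexp
  | BNot bexp
  | BAnd bexp bexp

datatype com =
    Skip
  | NAssign nat nexp
  | NStore nat nexp nexp
  | RAssign nat rexp
  | RStore nat nexp rexp
  | Query nat nat
  | Rand nat nexp
  | Seq com com
  | If bexp com com
  | While bexp com

record state =
  nvar :: "nat \<Rightarrow> nat"
  narr :: "nat \<Rightarrow> nat \<Rightarrow> nat"
  rvar :: "nat \<Rightarrow> real"
  rarr :: "nat \<Rightarrow> nat \<Rightarrow> real"

primrec nval :: "state \<Rightarrow> nexp \<Rightarrow> nat" where
  "nval s (NConst c) = c"
| "nval s (NVar x) = nvar s x"
| "nval s (NArr a i) = narr s a (nval s i)"
| "nval s (NAdd u v) = nval s u + nval s v"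
| "nval s (NSub u v) = nval s u - nval s v"

primrec rval :: "state \<Rightarrow> rexp \<Rightarrow> real" where
  "rval s RZero = 0"
| "rval s ROne = 1"
| "rval s (RVar x) = rvar s x"
| "rval s (RArr a i) = rarr s a (nval s i)"
| "rval s (RAdd u v) = rval s u + rval s v"
| "rval s (RSub u v) = rval s u - rval s v"

primrec bval :: "state \<Rightarrow> bexp \<Rightarrow> bool" where
  "bval s (NLess u v) \<longleftrightarrow> nval s u < nval s v"
| "bval s (RLess u v) \<longleftrightarrow> rval s u < rval s v"
| "bval s (BNot b) \<longleftrightarrow> \<not> bval s b"
| "bval s (BAnd b c) \<longleftrightarrow> bval s b \<and> bval s c"

text \<open>
  The ground set is presented to the machine as the index set \<open>{..<n}\<close>; a subset is passed
  to the oracle, and returned as the output, as a 0/1-array (nonzero meaning membership).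
\<close>

definition array_set :: "nat \<Rightarrow> state \<Rightarrow> nat \<Rightarrow> nat set" where
  "array_set n s a = {i. i < n \<and> narr s a i \<noteq> 0}"

text \<open>
  A configuration consists of the stack of commands still to be executed and the memory;
  it is halted when the stack is empty.  \<open>Query x a\<close> stores the oracle's value of the set held
  in array \<open>a\<close>; \<open>Rand x u\<close> draws uniformly and independently from \<open>{0, \<dots>, u}\<close>.
\<close>

type_synonym config = "com list \<times> state"

fun step :: "nat \<Rightarrow> (nat set \<Rightarrow> real) \<Rightarrow> config \<Rightarrow> config pmf" where
  "step n g ([], s) = return_pmf ([], s)"
| "step n g (Skip # K, s) = return_pmf (K, s)"
| "step n g (NAssign x u # K, s) =
     return_pmf (K, s\<lparr>nvar := (nvar s)(x := nval s u)\<rparr>)"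
| "step n g (NStore a i u # K, s) =
     return_pmf (K, s\<lparr>narr := (narr s)(a := (narr s a)(nval s i := nval s u))\<rparr>)"
| "step n g (RAssign x u # K, s) =
     return_pmf (K, s\<lparr>rvar := (rvar s)(x := rval s u)\<rparr>)"
| "step n g (RStore a i u # K, s) =
     return_pmf (K, s\<lparr>rarr := (rarr s)(a := (rarr s a)(nval s i := rval s u))\<rparr>)"
| "step n g (Query x a # K, s) =
     return_pmf (K, s\<lparr>rvar := (rvar s)(x := g (array_set n s a))\<rparr>)"
| "step n g (Rand x u # K, s) =
     map_pmf (\<lambda>r. (K, s\<lparr>nvar := (nvar s)(x := r)\<rparr>)) (pmf_of_set {0..nval s u})"
| "step n g (Seq c d # K, s) = return_pmf (c # d # K, s)"
| "step n g (If b c d # K, s) = return_pmf ((if bval s b then c else d) # K, s)"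
| "step n g (While b c # K, s) =
     return_pmf (if bval s b then c # While b c # K else K, s)"

primrec steps :: "nat \<Rightarrow> (nat set \<Rightarrow> real) \<Rightarrow> nat \<Rightarrow> config \<Rightarrow> config pmf" where
  "steps n g 0 c = return_pmf c"
| "steps n g (Suc t) c = bind_pmf (step n g c) (steps n g t)"

definition init_state :: "nat \<Rightarrow> nat \<Rightarrow> state" where
  "init_state n k = \<lparr>nvar = (\<lambda>_. 0)(0 := n, 1 := k), narr = (\<lambda>_ _. 0),
                     rvar = (\<lambda>_. 0), rarr = (\<lambda>_ _. 0)\<rparr>"

definition halted :: "config \<Rightarrow> bool" where
  "halted c \<longleftrightarrow> fst c = []"

text \<open>
  For an instance \<open>(N, f, k)\<close> whose ground set is numbered by \<open>e\<close>, the distribution of the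
  configuration after \<open>t\<close> steps, and the subset of \<open>N\<close> that a configuration holds as its
  output (in array 0).  The function \<open>f\<close> is accessible to the program through \<open>Query\<close> only.
\<close>

definition run :: "com \<Rightarrow> 'a set \<Rightarrow> (nat \<Rightarrow> 'a) \<Rightarrow> ('a set \<Rightarrow> real) \<Rightarrow> nat \<Rightarrow> nat \<Rightarrow> config pmf" where
  "run P N e f k t = steps (card N) (\<lambda>I. f (e ` I)) t ([P], init_state (card N) k)"

definition output_set :: "'a set \<Rightarrow> (nat \<Rightarrow> 'a) \<Rightarrow> config \<Rightarrow> 'a set" where
  "output_set N e c = e ` array_set (card N) (snd c) 0"

end

theory Submission
  imports Defs
begin

text \<open>
  Three regimes of \<open>k / n\<close> are treated separately, each with a potential function whose expectation
  does not decrease.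

  If \<open>10 k \<le> n\<close>, random greedy adds in each of \<open>k\<close> rounds a uniformly random one of the \<open>k\<close> best
  elements.  This alone reaches \<open>1 / e\<close> up to a loss of order \<open>k / n\<close>, which vanishes
  for bounded \<open>k\<close>.  For larger \<open>k\<close> an approximate local optimum \<open>Z\<close> with respect to swaps is computed first, and random greedy
  avoids \<open>Z\<close> during its first \<open>2 k / 5\<close> rounds.  Local optimality gives
  \<open>f (OPT \<union> Z) + f (OPT \<inter> Z) \<le> 2 f Z\<close> up to a negligible error, so either \<open>Z\<close> is good enough itself or avoiding it keeps
  \<open>f (OPT \<union> S)\<close> large; in the latter case the ratio exceeds
  \<open>1 / e\<close> by a constant margin, which pays for the loss.
  If \<open>10 (n - k) \<le> n\<close>, the same algorithm is run on the complement function.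

  Otherwise double greedy is used.  A state is a pair \<open>X \<subseteq> Y\<close>; a uniformly random undecided element
  \<open>u\<close> is added to \<open>X\<close> with probability \<open>p u\<close> and removed from \<open>Y\<close> otherwise, where \<open>\<Sum>u. p u\<close> is the
  number of elements still to be picked.  The \<open>p u\<close> are the usual double greedy probabilities for the
  marginals shifted by a common Lagrange multiplier \<open>\<theta>\<close>.  Splitting each element into \<open>4096\<close> tokens, the
  multiplier is found without division, by sorting the tokens.  The gain of the mixture
  \<open>(1 - \<rho>) f X + \<rho> f Y\<close>, with \<open>\<rho>\<close> the fraction of the undecided elements to be picked, pays \<open>1 / 1.69\<close>
  of the loss of \<open>f (X \<union> (OPT \<inter> Y))\<close>, apart from
  \<open>\<theta>\<close> times the deviation of \<open>|OPT \<inter> (Y - X)|\<close> from the number still to be picked, which a quadratic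
  term of the potential absorbs.  This gives the ratio \<open>1 / 2.7 > 1 / e\<close>, up to lower order terms.
\<close>

section \<open>Submodular functions\<close>

text \<open>The cut-off 10 comes from double greedy. For marginals of sum \<open>s\<close> and
  probability \<open>p\<close> the mixture gains
  \<open>((1 - \<rho>) * p^2 + \<rho> * (1 - p)^2) * s\<close> against a loss of
  \<open>p * (1 - p) * s\<close>, and the quotient of the two is at least
  \<open>2 * sqrt (\<rho> * (1 - \<rho>))\<close>. The ratio is thus about
  \<open>1 / (1 + 1 / (2 * sqrt (\<rho> * (1 - \<rho>))))\<close>, which is 3/8 at
  \<open>\<rho> = 1 / 10\<close> and falls below \<open>1 / e\<close> near
  \<open>\<rho> = 0.093\<close>. The obstacle for random greedy is that exactly \<open>k\<close>
  elements are wanted: the usual dummy elements of zero marginal do not exist. The best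
  \<open>k\<close> candidates are compared with the optimum plus a thin layer of all other elements,
  of density at most \<open>k / (n - 3 k)\<close>; the damage done by this layer is the loss of
  order \<open>k / n\<close>. The machine can neither divide nor turn reals into naturals.
  Probabilities are therefore ratios of counts obtained by comparing reals, and local search cannot
  test for a relative improvement; it performs a fixed number of best swaps and keeps the set whose
  best swap gained least.\<close>

locale nonneg_submodular =
  fixes U :: "'a set" and f :: "'a set \<Rightarrow> real"
  assumes finite_ground: "finite U"
    and submodular: "submodular_on U f"
    and nonneg_fun: "nonneg_on U f"
begin

lemma submod: "A \<subseteq> U \<Longrightarrow> B \<subseteq> U \<Longrightarrow> f (A \<union> B) + f (A \<inter> B) \<le> f A + f B"
  using submodular by (auto simp: submodular_on_def)

lemma nonneg: "A \<subseteq> U \<Longrightarrow> 0 \<le> f A"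
  using nonneg_fun by (auto simp: nonneg_on_def)

lemma finite_sub: "A \<subseteq> U \<Longrightarrow> finite A"
  using finite_ground by (rule finite_subset[rotated])

lemma diminishing:
  assumes "A \<subseteq> B" "B \<subseteq> U" "u \<in> U" "u \<notin> B"
  shows "f (insert u B) - f B \<le> f (insert u A) - f A"
proof -
  have "insert u A \<union> B = insert u B" "insert u A \<inter> B = A"
    using assms by auto
  then show ?thesis
    using submod[of "insert u A" B] subset_trans[OF assms(1,2)] assms(2,3) by simp
qed

lemma sum_marginals_add:
  assumes "A \<subseteq> U" "B \<subseteq> U"
  shows "f (A \<union> B) - f A \<le> (\<Sum>u\<in>B. f (insert u A) - f A)"
  using finite_sub[OF assms(2)] assms
proof (induction B rule: finite_induct)
  case (insert v B)
  have "f (insert v (A \<union> B)) - f (A \<union> B) \<le> f (insert v A) - f A"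
  proof (cases "v \<in> A \<union> B")
    case True
    then have "v \<in> A" using insert by auto
    then show ?thesis by (simp add: insert_absorb)
  next
    case False
    then show ?thesis using insert.prems by (intro diminishing) auto
  qed
  then show ?case using insert by simp
qed simp

lemma sum_marginals_remove:
  assumes "A \<subseteq> U" "B \<subseteq> U"
  shows "f (A - B) - f A \<le> (\<Sum>u\<in>B. f (A - {u}) - f A)"
  using finite_sub[OF assms(2)] assms
proof (induction B rule: finite_induct)
  case (insert v B)
  have *: "(A - B) \<union> (A - {v}) = A" "(A - B) \<inter> (A - {v}) = A - insert v B"
    using insert.hyps by auto
  have "f A + f (A - insert v B) \<le> f (A - B) + f (A - {v})"
    using submod[of "A - B" "A - {v}"] insert.prems unfolding * by auto
  then show ?case using insert by simp
qed simp

lemma complement: "nonneg_submodular U (\<lambda>S. f (U - S))"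
proof
  show "submodular_on U (\<lambda>S. f (U - S))"
    unfolding submodular_on_def
  proof (intro allI impI)
    fix A B assume "A \<subseteq> U" "B \<subseteq> U"
    then show "f (U - (A \<union> B)) + f (U - (A \<inter> B)) \<le> f (U - A) + f (U - B)"
      using submod[of "U - A" "U - B"] by (simp add: Diff_Un Diff_Int)
  qed
qed (auto simp: nonneg_on_def finite_ground intro: nonneg)

text \<open>The sum is smallest when weight 1 sits on exactly the elements of negative marginal.
  Adding all of these lowers \<open>f\<close> by at most \<open>f X\<close>, because
  \<open>f\<close> is nonnegative.\<close>

lemma weighted_add_ge:
  assumes "X \<subseteq> U" "D \<subseteq> U" "\<And>u. u \<in> D \<Longrightarrow> 0 \<le> w u \<and> w u \<le> (1::real)"
  shows "- f X \<le> (\<Sum>u\<in>D. w u * (f (insert u X) - f X))"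
proof -
  let ?N = "{u\<in>D. f (insert u X) - f X < 0}"
  have fD: "finite D" using assms finite_sub by auto
  have "- f X \<le> f (X \<union> ?N) - f X" using nonneg[of "X \<union> ?N"] assms by auto
  also have "\<dots> \<le> (\<Sum>u\<in>?N. f (insert u X) - f X)" using assms by (intro sum_marginals_add) auto
  also have "\<dots> = (\<Sum>u\<in>D. if f (insert u X) - f X < 0 then f (insert u X) - f X else 0)"
    using fD by (simp add: sum.inter_filter)
  also have "\<dots> \<le> (\<Sum>u\<in>D. w u * (f (insert u X) - f X))"
  proof (rule sum_mono)
    fix u assume "u \<in> D"
    then have w: "0 \<le> w u" "w u \<le> 1" using assms by auto
    show "(if f (insert u X) - f X < 0 then f (insert u X) - f X else 0) \<le> w u * (f (insert u X) - f X)"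
      using w mult_right_mono_neg[of "w u" 1 "f (insert u X) - f X"] by auto
  qed
  finally show ?thesis .
qed

lemma weighted_remove_ge:
  assumes "Y \<subseteq> U" "D \<subseteq> U" "\<And>u. u \<in> D \<Longrightarrow> 0 \<le> w u \<and> w u \<le> (1::real)"
  shows "- f Y \<le> (\<Sum>u\<in>D. w u * (f (Y - {u}) - f Y))"
proof -
  let ?N = "{u\<in>D. f (Y - {u}) - f Y < 0}"
  have fD: "finite D" using assms finite_sub by auto
  have "- f Y \<le> f (Y - ?N) - f Y" using nonneg[of "Y - ?N"] assms by auto
  also have "\<dots> \<le> (\<Sum>u\<in>?N. f (Y - {u}) - f Y)" using assms by (intro sum_marginals_remove) auto
  also have "\<dots> = (\<Sum>u\<in>D. if f (Y - {u}) - f Y < 0 then f (Y - {u}) - f Y else 0)"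
    using fD by (simp add: sum.inter_filter)
  also have "\<dots> \<le> (\<Sum>u\<in>D. w u * (f (Y - {u}) - f Y))"
  proof (rule sum_mono)
    fix u assume "u \<in> D"
    then have w: "0 \<le> w u" "w u \<le> 1" using assms by auto
    show "(if f (Y - {u}) - f Y < 0 then f (Y - {u}) - f Y else 0) \<le> w u * (f (Y - {u}) - f Y)"
      using w mult_right_mono_neg[of "w u" 1 "f (Y - {u}) - f Y"] by auto
  qed
  finally show ?thesis .
qed

text \<open>A random \<open>q\<close>-subset of \<open>R\<close> reaches this interpolation in
  expectation. The greedy version adds, each time, an element whose marginal is at least an equal
  share of what is missing up to \<open>f (S \<union> R)\<close>.\<close>

lemma padding:
  assumes "S \<subseteq> U" "R \<subseteq> U" "S \<inter> R = {}" "q \<le> card R"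
  shows "\<exists>Q\<subseteq>R. card Q = q \<and>
    real (card R) * f (S \<union> Q) \<ge> real (card R - q) * f S + real q * f (S \<union> R)"
  using assms(4)
proof (induction q)
  case 0
  show ?case by (rule exI[of _ "{}"]) auto
next
  case (Suc q)
  then obtain Q where Q: "Q \<subseteq> R" "card Q = q"
    "real (card R) * f (S \<union> Q) \<ge> real (card R - q) * f S + real q * f (S \<union> R)"
    by auto
  have fR: "finite R" using assms finite_sub by auto
  have fQ: "finite Q" using Q fR finite_subset by blast
  have cRQ: "card (R - Q) = card R - q" using Q fQ by (simp add: card_Diff_subset)
  let ?d = "real (card R - q)"
  have dpos: "?d > 0" using Suc by auto
  have "f (S \<union> Q \<union> (R - Q)) - f (S \<union> Q) \<le> (\<Sum>u\<in>R - Q. f (insert u (S \<union> Q)) - f (S \<union> Q))"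
    using assms Q by (intro sum_marginals_add) auto
  moreover have "S \<union> Q \<union> (R - Q) = S \<union> R" using Q by auto
  ultimately have sm: "f (S \<union> R) - f (S \<union> Q) \<le> (\<Sum>u\<in>R - Q. f (insert u (S \<union> Q)) - f (S \<union> Q))" by simp
  have "\<exists>u\<in>R - Q. (f (S \<union> R) - f (S \<union> Q)) / ?d \<le> f (insert u (S \<union> Q)) - f (S \<union> Q)"
  proof (rule ccontr)
    assume "\<not> ?thesis"
    then have lt: "\<And>u. u \<in> R - Q \<Longrightarrow> f (insert u (S \<union> Q)) - f (S \<union> Q) < (f (S \<union> R) - f (S \<union> Q)) / ?d" by force
    have "(\<Sum>u\<in>R - Q. f (insert u (S \<union> Q)) - f (S \<union> Q)) < (\<Sum>u\<in>R - Q. (f (S \<union> R) - f (S \<union> Q)) / ?d)"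
      using lt fR cRQ dpos by (intro sum_strict_mono) (fastforce, force, blast)
    then show False using sm cRQ dpos by simp
  qed
  then obtain u where u: "u \<in> R - Q" "f (S \<union> R) - f (S \<union> Q) \<le> ?d * (f (insert u (S \<union> Q)) - f (S \<union> Q))"
    using dpos by (auto simp: field_simps)
  have "real (card R) * (?d * f (insert u (S \<union> Q))) \<ge> real (card R) * ((?d - 1) * f (S \<union> Q) + f (S \<union> R))"
    using u(2) by (intro mult_left_mono) (auto simp: algebra_simps)
  moreover have "(?d - 1) * (real (card R) * f (S \<union> Q)) \<ge> (?d - 1) * (?d * f S + real q * f (S \<union> R))"
    using Q(3) Suc by (intro mult_left_mono) auto
  ultimately have "?d * (real (card R) * f (insert u (S \<union> Q))) \<ge> (?d - 1) * (?d * f S + real q * f (S \<union> R)) + real (card R) * f (S \<union> R)"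
    by (simp add: algebra_simps)
  also have "(?d - 1) * (?d * f S + real q * f (S \<union> R)) + real (card R) * f (S \<union> R)
     = ?d * ((?d - 1) * f S + real (Suc q) * f (S \<union> R))"
  proof -
    have c: "real (card R) = ?d + real q" using Suc by auto
    show ?thesis unfolding c by (simp add: algebra_simps)
  qed
  finally have "real (card R) * f (insert u (S \<union> Q)) \<ge> (?d - 1) * f S + real (Suc q) * f (S \<union> R)"
    using dpos by (simp add: mult_le_cancel_left_pos)
  moreover have "?d - 1 = real (card R - Suc q)" using Suc by auto
  ultimately have "real (card R - Suc q) * f S + real (Suc q) * f (S \<union> R) \<le> real (card R) * f (S \<union> insert u Q)"
    by (metis Un_insert_right)
  moreover have "insert u Q \<subseteq> R" "card (insert u Q) = Suc q" using u Q fQ by auto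
  ultimately show ?case by blast
qed

end

section \<open>Double greedy with a cardinality budget\<close>

text \<open>\<open>a\<close> and \<open>s - a\<close> are the two shifted marginals, and
  \<open>a\<close> is within \<open>\<delta> * s\<close> of \<open>p * s\<close>, so gain and loss
  are close to \<open>Q * s\<close> and \<open>p * (1 - p) * s\<close>. The factor 169/100 is the
  inverse of \<open>2 * sqrt (\<rho> * (1 - \<rho>))\<close> at \<open>\<rho> = 99 / 1000\<close>,
  about 1.675, with some room for \<open>\<delta>\<close>. If \<open>p\<close> is clipped to 0 or 1,
  \<open>a\<close> is bounded on one side only; the term that would use the other side has factor
  0.\<close>

lemma double_greedy_element:
  fixes p s a \<rho> \<delta> :: real
  assumes p: "0 \<le> p" "p \<le> 1" and s: "0 \<le> s"
    and lo: "0 < p \<Longrightarrow> (p - \<delta>) * s \<le> a" and hi: "p < 1 \<Longrightarrow> a \<le> (p + \<delta>) * s"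
    and \<rho>: "99 / 1000 \<le> \<rho>" "\<rho> \<le> 901 / 1000" and \<delta>: "0 \<le> \<delta>" "\<delta> \<le> 1 / 8192"
  defines "\<gamma> \<equiv> (1 - \<rho>) * p * a + \<rho> * (1 - p) * (s - a)"
  shows "8 / 100 * s \<le> \<gamma>" "p * (s - a) \<le> 169 / 100 * \<gamma>" "(1 - p) * a \<le> 169 / 100 * \<gamma>"
proof -
  define Q where "Q = (1 - \<rho>) * p\<^sup>2 + \<rho> * (1 - p)\<^sup>2"
  have l1: "p * ((p - \<delta>) * s) \<le> p * a"
    using lo p by (cases "p = 0") (auto intro: mult_left_mono)
  have l2: "(1 - p) * ((1 - p - \<delta>) * s) \<le> (1 - p) * (s - a)"
  proof (cases "p = 1")
    case False
    then have "a \<le> (p + \<delta>) * s" using hi p by auto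
    then show ?thesis using p by (intro mult_left_mono) (auto simp: algebra_simps)
  qed auto
  have u1: "p * (s - a) \<le> p * ((1 - p + \<delta>) * s)"
  proof (cases "p = 0")
    case False
    then have "(p - \<delta>) * s \<le> a" using lo p by auto
    then show ?thesis using p by (intro mult_left_mono) (auto simp: algebra_simps)
  qed auto
  have u2: "(1 - p) * a \<le> (1 - p) * ((p + \<delta>) * s)"
    using hi p by (cases "p = 1") (auto intro: mult_left_mono)
  have c1: "(1 - \<rho>) * (p * ((p - \<delta>) * s)) \<le> (1 - \<rho>) * (p * a)"
    using \<rho> by (intro mult_left_mono[OF l1]) auto
  have c2: "\<rho> * ((1 - p) * ((1 - p - \<delta>) * s)) \<le> \<rho> * ((1 - p) * (s - a))"
    using \<rho> by (intro mult_left_mono[OF l2]) auto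
  have eq: "(1 - \<rho>) * (p * ((p - \<delta>) * s)) + \<rho> * ((1 - p) * ((1 - p - \<delta>) * s))
     = s * (Q - \<delta> * ((1 - \<rho>) * p + \<rho> * (1 - p)))"
    unfolding Q_def by (simp add: algebra_simps power2_eq_square)
  have "(1 - \<rho>) * p + \<rho> * (1 - p) \<le> (1 - \<rho>) * 1 + \<rho> * 1"
    using p \<rho> by (intro add_mono mult_left_mono) auto
  then have "\<delta> * ((1 - \<rho>) * p + \<rho> * (1 - p)) \<le> \<delta> * 1"
    using \<delta> by (intro mult_left_mono) auto
  then have "s * (Q - \<delta>) \<le> s * (Q - \<delta> * ((1 - \<rho>) * p + \<rho> * (1 - p)))"
    using s by (intro mult_left_mono) auto
  then have \<gamma>: "s * (Q - \<delta>) \<le> \<gamma>"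
    using c1 c2 eq unfolding \<gamma>_def by (simp add: mult.assoc)
  have "0 \<le> (\<rho> - 99 / 1000) * (901 / 1000 - \<rho>)" using \<rho> by auto
  moreover have "(\<rho> - 99 / 1000) * (901 / 1000 - \<rho>) = \<rho> * (1 - \<rho>) - 89199 / 1000000"
    by (simp add: field_simps)
  ultimately have \<rho>q: "(891 / 10000) \<le> \<rho> * (1 - \<rho>)" by linarith
  have "Q = \<rho> * (1 - \<rho>) + (p - \<rho>)\<^sup>2"
    unfolding Q_def by (simp add: algebra_simps power2_eq_square)
  then have Q1: "891 / 10000 \<le> Q" using \<rho>q by (smt (verit) zero_le_power2)
  \<comment> \<open>Completing the square in \<open>p\<close>: the discriminant of
    \<open>Q - c * p * (1 - p)\<close> is \<open>c^2 - 4 * \<rho> * (1 - \<rho>)\<close>. The value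
    \<open>c = 597 / 1000\<close> makes it vanish, up to rounding, at the ends of the range of
    \<open>\<rho>\<close>.\<close>
  have "4 * (1597 / 1000) * (Q - 597 / 1000 * (p * (1 - p)))
      = (2 * (1597 / 1000) * p - (2 * \<rho> + 597 / 1000))\<^sup>2 + 4 * (\<rho> * (1 - \<rho>)) - (597 / 1000)\<^sup>2"
    unfolding Q_def by (simp add: field_simps power2_eq_square)
  also have "\<dots> \<ge> 4 * (891 / 10000) - (597 / 1000)\<^sup>2"
    using \<rho>q by (smt (verit) zero_le_power2)
  also have "4 * (891 / 10000) - (597 / 1000)\<^sup>2 \<ge> (- (1 / 10000) :: real)"
    by (simp add: power2_eq_square)
  finally have Q2': "- (1 / 10000) \<le> 4 * (1597 / 1000) * (Q - 597 / 1000 * (p * (1 - p)))" .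
  define q where "q = p * (1 - p)"
  have Q2: "597 / 1000 * q \<le> Q + 1 / 10000" using Q2' unfolding q_def[symmetric] by (simp add: field_simps)
  have main: "p * (1 - p) + \<delta> \<le> 169 / 100 * (Q - \<delta>)" "8 / 100 \<le> Q - \<delta>"
    unfolding q_def[symmetric] using Q1 Q2 \<delta> by argo+
  have "s * (8 / 100) \<le> s * (Q - \<delta>)" using main s by (intro mult_left_mono) auto
  then show "8 / 100 * s \<le> \<gamma>" using \<gamma> by linarith
  have m2: "s * (p * (1 - p) + \<delta>) \<le> 169 / 100 * \<gamma>"
    using mult_left_mono[OF main(1) s] \<gamma> by (simp add: algebra_simps)
  have "p * \<delta> \<le> 1 * \<delta>" "(1 - p) * \<delta> \<le> 1 * \<delta>" using p \<delta> by (intro mult_right_mono; simp)+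
  then have "s * (p * (1 - p) + p * \<delta>) \<le> s * (p * (1 - p) + \<delta>)" "s * (p * (1 - p) + (1 - p) * \<delta>) \<le> s * (p * (1 - p) + \<delta>)"
    using s by (intro mult_left_mono; simp)+
  moreover have "p * ((1 - p + \<delta>) * s) = s * (p * (1 - p) + p * \<delta>)" "(1 - p) * ((p + \<delta>) * s) = s * (p * (1 - p) + (1 - p) * \<delta>)"
    by (simp_all add: algebra_simps)
  ultimately show "p * (s - a) \<le> 169 / 100 * \<gamma>" "(1 - p) * a \<le> 169 / 100 * \<gamma>"
    using u1 u2 m2 by linarith+
qed

section \<open>Probabilities as fractions of tokens\<close>

definition token_fraction :: "(nat \<Rightarrow> 'a \<times> nat) \<Rightarrow> nat \<Rightarrow> nat \<Rightarrow> 'a \<Rightarrow> real" where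
  "token_fraction \<sigma> L J u = real (card {j. j < L \<and> (u, j) \<in> \<sigma> ` {..<J}}) / real L"

lemma token_fraction_bounds:
  assumes "0 < L"
  shows "0 \<le> token_fraction \<sigma> L J u" "token_fraction \<sigma> L J u \<le> 1"
proof -
  have "card {j. j < L \<and> (u, j) \<in> \<sigma> ` {..<J}} \<le> card {..<L}"
    by (intro card_mono) auto
  then show "token_fraction \<sigma> L J u \<le> 1" "0 \<le> token_fraction \<sigma> L J u"
    using assms by (auto simp: token_fraction_def)
qed

lemma token_fraction_gap:
  assumes "0 < L"
  shows "0 < token_fraction \<sigma> L J u \<Longrightarrow> 1 / real L \<le> token_fraction \<sigma> L J u"
    "token_fraction \<sigma> L J u < 1 \<Longrightarrow> token_fraction \<sigma> L J u \<le> 1 - 1 / real L"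
  using assms by (auto simp: token_fraction_def field_simps)

lemma sum_tokens:
  fixes W :: "'a \<Rightarrow> real"
  assumes L: "0 < L" and D: "finite D" and \<sigma>: "bij_betw \<sigma> {..<N} (D \<times> {..<L})" and J: "J \<le> N"
  shows "(\<Sum>i<J. W (fst (\<sigma> i))) = real L * (\<Sum>u\<in>D. token_fraction \<sigma> L J u * W u)"
proof -
  have inj: "inj_on \<sigma> {..<J}" using \<sigma> J by (auto simp: bij_betw_def inj_on_def)
  have "\<sigma> ` {..<J} \<subseteq> \<sigma> ` {..<N}" using J by (intro image_mono) auto
  then have sub: "\<sigma> ` {..<J} \<subseteq> D \<times> {..<L}" using \<sigma> by (auto simp: bij_betw_def)
  have eq: "\<sigma> ` {..<J} = (SIGMA u:D. {j. j < L \<and> (u, j) \<in> \<sigma> ` {..<J}})" using sub by auto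
  have "(\<Sum>i<J. W (fst (\<sigma> i))) = (\<Sum>x\<in>\<sigma> ` {..<J}. W (fst x))"
    using inj by (simp add: sum.reindex)
  also have "\<dots> = (\<Sum>u\<in>D. \<Sum>j\<in>{j. j < L \<and> (u, j) \<in> \<sigma> ` {..<J}}. W u)"
    by (subst eq, subst sum.Sigma) (auto simp: D case_prod_beta)
  also have "\<dots> = real L * (\<Sum>u\<in>D. token_fraction \<sigma> L J u * W u)"
    using L by (simp add: token_fraction_def sum_distrib_left)
  finally show ?thesis .
qed

text \<open>A uniformly random position below \<open>N\<close> yields a uniformly random
  \<open>u\<close>, and given \<open>u\<close> it lies below \<open>J\<close> with probability
  \<open>token_fraction \<sigma> L J u\<close>. One draw thus realises both random choices of a
  step.\<close>

lemma sum_tokens_split: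
  fixes V W :: "'a \<Rightarrow> real"
  assumes L: "0 < L" and D: "finite D" and \<sigma>: "bij_betw \<sigma> {..<N} (D \<times> {..<L})" and J: "J \<le> N"
  shows "(\<Sum>i<N. if i < J then V (fst (\<sigma> i)) else W (fst (\<sigma> i))) =
    real L * (\<Sum>u\<in>D. token_fraction \<sigma> L J u * V u + (1 - token_fraction \<sigma> L J u) * W u)"
proof -
  have full: "token_fraction \<sigma> L N u = 1" if "u \<in> D" for u
  proof -
    have "{j. j < L \<and> (u, j) \<in> \<sigma> ` {..<N}} = {..<L}" using \<sigma> that by (auto simp: bij_betw_def)
    then show ?thesis using L by (simp add: token_fraction_def)
  qed
  have all: "(\<Sum>i<N. W (fst (\<sigma> i))) = real L * (\<Sum>u\<in>D. W u)"
    using sum_tokens[OF L D \<sigma> order_refl, of W] full by simp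
  have "(\<Sum>i<N. if i < J then V (fst (\<sigma> i)) else W (fst (\<sigma> i))) =
     (\<Sum>i<N. W (fst (\<sigma> i)) + (if i < J then V (fst (\<sigma> i)) - W (fst (\<sigma> i)) else 0))"
    by (intro sum.cong) auto
  also have "\<dots> = (\<Sum>i<N. W (fst (\<sigma> i))) + (\<Sum>i<J. V (fst (\<sigma> i)) - W (fst (\<sigma> i)))"
  proof -
    have "{..<N} \<inter> {i. i < J} = {..<J}" using J by auto
    then show ?thesis by (simp add: sum.distrib sum.If_cases)
  qed
  also have "\<dots> = real L * (\<Sum>u\<in>D. W u) + real L * (\<Sum>u\<in>D. token_fraction \<sigma> L J u * (V u - W u))"
    using all sum_tokens[OF L D \<sigma> J, of "\<lambda>u. V u - W u"] by simp
  also have "\<dots> = real L * (\<Sum>u\<in>D. token_fraction \<sigma> L J u * V u + (1 - token_fraction \<sigma> L J u) * W u)"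
    by (simp add: sum.distrib sum_subtractf algebra_simps)
  finally show ?thesis .
qed

text \<open>
  Token \<open>j\<close> of \<open>u\<close> precedes a threshold \<open>2 L \<theta>\<close> iff \<open>(2 j + 1) / (2 L) * s u \<le> a u + \<theta>\<close>, so the fraction of
  selected tokens of \<open>u\<close> approximates \<open>(a u + \<theta>) / s u\<close>, clipped to the unit interval.
\<close>

lemma token_threshold:
  fixes a s :: "'a \<Rightarrow> real"
  assumes L: "0 < L" and \<sigma>: "bij_betw \<sigma> {..<N} (D \<times> {..<L})" and J: "J \<le> N" and N: "0 < N"
    and key: "key = (\<lambda>(u, j). (2 * real j + 1) * s u - 2 * real L * a u)"
    and mono: "\<And>i i'. i < i' \<Longrightarrow> i' < N \<Longrightarrow> key (\<sigma> i) \<le> key (\<sigma> i')"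
    and s: "\<And>u. u \<in> D \<Longrightarrow> 0 \<le> s u"
  shows "\<exists>\<theta>. \<forall>u\<in>D.
    (0 < token_fraction \<sigma> L J u \<longrightarrow> (token_fraction \<sigma> L J u - 1 / (2 * real L)) * s u \<le> a u + \<theta>) \<and>
    (token_fraction \<sigma> L J u < 1 \<longrightarrow> a u + \<theta> \<le> (token_fraction \<sigma> L J u + 1 / (2 * real L)) * s u)"
proof -
  \<comment> \<open>The threshold is the first key that is not selected. If all are selected, every
    fraction is 1, the upper estimates are void, and the last key serves.\<close>
  define t where "t = (if J < N then key (\<sigma> J) else key (\<sigma> (J - 1)))"
  have le: "key (\<sigma> i) \<le> key (\<sigma> i')" if "i \<le> i'" "i' < N" for i i'
    using mono[of i i'] that by (cases "i = i'") auto
  have sel: "key (\<sigma> i) \<le> t" if "i < J" for i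
    using that J N unfolding t_def by (auto intro!: le)
  have unsel: "t \<le> key (\<sigma> i)" if "J \<le> i" "i < N" for i
    using that unfolding t_def by (auto intro!: le)
  have main: "(0 < token_fraction \<sigma> L J u \<longrightarrow> (token_fraction \<sigma> L J u - 1 / (2 * real L)) * s u \<le> a u + t / (2 * real L)) \<and>
    (token_fraction \<sigma> L J u < 1 \<longrightarrow> a u + t / (2 * real L) \<le> (token_fraction \<sigma> L J u + 1 / (2 * real L)) * s u)"
    if u: "u \<in> D" for u
  proof -
    define A where "A = {j. j < L \<and> (u, j) \<in> \<sigma> ` {..<J}}"
    define c where "c = card A"
    have pc: "token_fraction \<sigma> L J u = real c / real L" by (simp add: token_fraction_def A_def c_def)
    have fA: "finite A" "A \<subseteq> {..<L}" unfolding A_def by auto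
    have "(2 * real c - 1) * s u - 2 * real L * a u \<le> t" if "0 < c"
    proof -
      \<comment> \<open>Tokens of equal key (\<open>s u = 0\<close>) may be selected in any order,
        so the selected tokens of \<open>u\<close> need not be the first \<open>c\<close>. By
        counting, one of them has number at least \<open>c - 1\<close>, and one of the first
        \<open>c + 1\<close> tokens is not selected.\<close>
      have "\<not> A \<subseteq> {..<c - 1}"
      proof
        assume "A \<subseteq> {..<c - 1}"
        then have "c \<le> c - 1" unfolding c_def using card_mono[of "{..<card A - 1}" A] by simp
        then show False using that by simp
      qed
      then obtain j where j: "j \<in> A" "c - 1 \<le> j" by force
      then obtain i where i: "i < J" "\<sigma> i = (u, j)" unfolding A_def by auto
      have "(2 * real j + 1) * s u - 2 * real L * a u \<le> t" using sel[OF i(1)] i(2) key by simp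
      moreover have "(2 * real c - 1) * s u \<le> (2 * real j + 1) * s u"
        using j s[OF u] by (intro mult_right_mono) auto
      ultimately show ?thesis by linarith
    qed
    moreover have "t \<le> (2 * real c + 1) * s u - 2 * real L * a u" if "c < L"
    proof -
      have "\<not> {..c} \<subseteq> A"
      proof
        assume "{..c} \<subseteq> A"
        then have "card {..c} \<le> c" unfolding c_def using fA card_mono by blast
        then show False by simp
      qed
      then obtain j where j: "j \<notin> A" "j \<le> c" by force
      then have "j < L" using that by simp
      then have "(u, j) \<in> \<sigma> ` {..<N}" using \<sigma> u by (auto simp: bij_betw_def)
      then obtain i where i: "i < N" "\<sigma> i = (u, j)" by auto
      have "J \<le> i"
      proof (rule ccontr)
        assume "\<not> J \<le> i"
        then have "(u, j) \<in> \<sigma> ` {..<J}" using i(2) by (metis imageI lessThan_iff not_le)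
        then show False using j(1) \<open>j < L\<close> unfolding A_def by simp
      qed
      have "t \<le> (2 * real j + 1) * s u - 2 * real L * a u" using unsel[OF \<open>J \<le> i\<close> i(1)] i(2) key by simp
      moreover have "(2 * real j + 1) * s u \<le> (2 * real c + 1) * s u"
        using j s[OF u] by (intro mult_right_mono) auto
      ultimately show ?thesis by linarith
    qed
    moreover have e: "real c / real L - 1 / (2 * real L) = (2 * real c - 1) / (2 * real L)"
      "real c / real L + 1 / (2 * real L) = (2 * real c + 1) / (2 * real L)"
      "a u + t / (2 * real L) = (2 * real L * a u + t) / (2 * real L)"
      using L by (auto simp: divide_simps)
    have "(2 * real c - 1) / (2 * real L) * s u \<le> (2 * real L * a u + t) / (2 * real L)"
      if "(2 * real c - 1) * s u - 2 * real L * a u \<le> t"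
      using that L unfolding times_divide_eq_left by (intro divide_right_mono) auto
    moreover have "(2 * real L * a u + t) / (2 * real L) \<le> (2 * real c + 1) / (2 * real L) * s u"
      if "t \<le> (2 * real c + 1) * s u - 2 * real L * a u"
      using that L unfolding times_divide_eq_left by (intro divide_right_mono) auto
    moreover have "0 < real c / real L \<longleftrightarrow> 0 < c" "real c / real L < 1 \<longleftrightarrow> c < L"
      using L by (auto simp: zero_less_divide_iff divide_less_eq)
    ultimately show ?thesis unfolding pc e by blast
  qed
  then show ?thesis by (intro exI[of _ "t / (2 * real L)"]) blast
qed

section \<open>One averaged step of double greedy\<close>

definition (in nonneg_submodular) mix :: "real \<Rightarrow> 'a set \<Rightarrow> 'a set \<Rightarrow> real" where
  "mix \<rho> X Y = (1 - \<rho>) * f X + \<rho> * f Y"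

text \<open>\<open>T\<close> stands for the undecided part of the optimum and \<open>rem\<close> for
  the number of elements still to be picked.\<close>

locale double_greedy_step = nonneg_submodular +
  fixes X Y T :: "'a set" and p :: "'a \<Rightarrow> real" and rem :: nat
  assumes XY: "X \<subseteq> Y" "Y \<subseteq> U" and T: "T \<subseteq> Y - X"
    and p: "\<And>u. u \<in> Y - X \<Longrightarrow> 0 \<le> p u" "\<And>u. u \<in> Y - X \<Longrightarrow> p u \<le> 1"
    and sum_p: "(\<Sum>u\<in>Y - X. p u) = real rem"
begin

abbreviation "D \<equiv> Y - X"
abbreviation "m \<equiv> card (Y - X)"
abbreviation "a u \<equiv> f (insert u X) - f X"
abbreviation "b u \<equiv> f (Y - {u}) - f Y"
definition "\<rho> = real rem / real m"

text \<open>Gain of the mixture and loss of \<open>f (X \<union> T)\<close>, summed rather than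
  averaged over the element decided next.\<close>

definition "gain = (\<Sum>u\<in>D. (1 - \<rho>) * p u * a u + \<rho> * (1 - p u) * b u)"
definition "loss = (\<Sum>u\<in>D - T. p u * b u) + (\<Sum>u\<in>T. (1 - p u) * a u)"

lemma XU: "X \<subseteq> U" using XY by auto

lemma finite_D: "finite D" using XY finite_sub by auto

lemma finite_T: "finite T" using T finite_D finite_subset by auto

lemma rem_le: "rem \<le> m"
proof -
  have "(\<Sum>u\<in>D. p u) \<le> (\<Sum>u\<in>D. 1)" using p by (intro sum_mono) auto
  then show ?thesis using sum_p by simp
qed

lemma sum_1p: "(\<Sum>u\<in>D. 1 - p u) = real m - real rem"
  using sum_p by (simp add: sum_subtractf)

lemma ab_nonneg: "u \<in> D \<Longrightarrow> 0 \<le> a u + b u"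
proof -
  assume u: "u \<in> D"
  then have "insert u X \<union> (Y - {u}) = Y" "insert u X \<inter> (Y - {u}) = X" using XY by auto
  moreover have "insert u X \<subseteq> U" "Y - {u} \<subseteq> U" using u XY XU by auto
  ultimately show ?thesis using submod[of "insert u X" "Y - {u}"] by simp
qed

text \<open>With the values \<open>f X\<close> and \<open>f Y\<close> frozen, the mixture keeps its
  mean, since the \<open>p u\<close> sum to \<open>rem\<close>; this is the part with
  \<open>c1\<close> and \<open>c2\<close>. Only the changes of \<open>f\<close> remain, and the new
  weights in front of them are \<open>m / (m - 1)\<close> times the old ones.\<close>

lemma mix_step:
  assumes m: "2 \<le> m"
  shows "(\<Sum>u\<in>D. p u * mix ((real rem - 1) / (real m - 1)) (insert u X) Y
            + (1 - p u) * mix (real rem / (real m - 1)) X (Y - {u}))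
     = real m * (mix \<rho> X Y + gain / (real m - 1))"
proof -
  define M where "M = real m"
  define R where "R = real rem"
  have M: "M \<ge> 2" using m by (simp add: M_def)
  define c1 where "c1 = ((M - R) * f X + (R - 1) * f Y) / (M - 1)"
  define c2 where "c2 = ((M - 1 - R) * f X + R * f Y) / (M - 1)"
  have tm: "p u * mix ((R - 1) / (M - 1)) (insert u X) Y + (1 - p u) * mix (R / (M - 1)) X (Y - {u})
     = p u * c1 + (1 - p u) * c2 + M / (M - 1) * ((1 - R / M) * p u * a u + R / M * (1 - p u) * b u)" for u
  proof -
    have e1: "mix ((R - 1) / (M - 1)) (insert u X) Y = c1 + (M - R) / (M - 1) * a u"
      using M unfolding mix_def c1_def by (simp add: divide_simps) (simp add: algebra_simps)
    have e2: "mix (R / (M - 1)) X (Y - {u}) = c2 + R / (M - 1) * b u"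
      using M unfolding mix_def c2_def by (simp add: divide_simps) (simp add: algebra_simps)
    have e3: "M / (M - 1) * ((1 - R / M) * p u * a u + R / M * (1 - p u) * b u)
      = p u * ((M - R) / (M - 1) * a u) + (1 - p u) * (R / (M - 1) * b u)"
      using M by (simp add: divide_simps)
    show ?thesis unfolding e1 e2 e3 by (simp only: distrib_left ac_simps)
  qed
  have "(\<Sum>u\<in>D. p u * mix ((R - 1) / (M - 1)) (insert u X) Y + (1 - p u) * mix (R / (M - 1)) X (Y - {u}))
     = (\<Sum>u\<in>D. p u) * c1 + (\<Sum>u\<in>D. 1 - p u) * c2 + M / (M - 1) * gain"
    unfolding tm gain_def \<rho>_def M_def[symmetric] R_def[symmetric]
    unfolding sum.distrib[of "\<lambda>u. p u * c1 + (1 - p u) * c2"] sum.distrib[of "\<lambda>u. p u * c1"]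
    by (simp only: sum_distrib_left sum_distrib_right)
  also have "\<dots> = R * c1 + (M - R) * c2 + M / (M - 1) * gain"
    using sum_p sum_1p by (simp add: R_def M_def)
  also have "R * c1 + (M - R) * c2 = M * mix (R / M) X Y"
    using M unfolding c1_def c2_def mix_def by (simp add: divide_simps) (simp add: algebra_simps)
  finally show ?thesis unfolding M_def R_def \<rho>_def using m by (simp add: algebra_simps)
qed

text \<open>Deciding \<open>u\<close> changes \<open>X \<union> T\<close> only if \<open>u\<close>
  lies in \<open>T\<close> and is rejected or lies outside and is accepted. By submodularity the
  decrease is at most \<open>a u\<close>, compared at \<open>X\<close>, in the first case and at
  most \<open>b u\<close>, compared at \<open>Y\<close>, in the second.\<close>

lemma opt_step:
  "real m * f (X \<union> T) - loss \<le>
   (\<Sum>u\<in>D. p u * f (insert u X \<union> (T - {u})) + (1 - p u) * f (X \<union> (T - {u})))"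
proof -
  have "f (X \<union> T) - (if u \<in> T then (1 - p u) * a u else p u * b u)
     \<le> p u * f (insert u X \<union> (T - {u})) + (1 - p u) * f (X \<union> (T - {u}))" if u: "u \<in> D" for u
  proof (cases "u \<in> T")
    case True
    have eq: "insert u X \<union> (T - {u}) = X \<union> T" "insert u (X \<union> (T - {u})) = X \<union> T" using True by auto
    have "f (insert u (X \<union> (T - {u}))) - f (X \<union> (T - {u})) \<le> a u"
      using u True T XY by (intro diminishing) auto
    then have "(1 - p u) * (f (X \<union> T) - a u) \<le> (1 - p u) * f (X \<union> (T - {u}))"
      using p[OF u] eq by (intro mult_left_mono) auto
    then show ?thesis unfolding eq using True by (simp add: algebra_simps)
  next
    case False
    have eq: "insert u X \<union> (T - {u}) = insert u (X \<union> T)" "T - {u} = T" using False by auto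
    have "insert u (X \<union> T) \<union> (Y - {u}) = Y" "insert u (X \<union> T) \<inter> (Y - {u}) = X \<union> T"
      using u False T XY by auto
    moreover have "insert u (X \<union> T) \<subseteq> U" "Y - {u} \<subseteq> U" using u T XY XU by blast+
    ultimately have "f Y + f (X \<union> T) \<le> f (insert u (X \<union> T)) + f (Y - {u})"
      using submod[of "insert u (X \<union> T)" "Y - {u}"] by simp
    then have "p u * (f (X \<union> T) - b u) \<le> p u * f (insert u (X \<union> T))"
      using p[OF u] by (intro mult_left_mono) auto
    then show ?thesis unfolding eq(1) eq(2) using False by (simp add: algebra_simps)
  qed
  then have "(\<Sum>u\<in>D. f (X \<union> T) - (if u \<in> T then (1 - p u) * a u else p u * b u)) \<le>
     (\<Sum>u\<in>D. p u * f (insert u X \<union> (T - {u})) + (1 - p u) * f (X \<union> (T - {u})))"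
    by (rule sum_mono)
  moreover have "(\<Sum>u\<in>D. if u \<in> T then (1 - p u) * a u else p u * b u) = loss"
  proof -
    have "D \<inter> T = T" "D \<inter> - T = D - T" using T by auto
    then show ?thesis unfolding loss_def using finite_D by (simp add: sum.If_cases)
  qed
  ultimately show ?thesis by (simp add: sum_subtractf)
qed

lemma split_T:
  fixes g :: "'a \<Rightarrow> real"
  shows "(\<Sum>u\<in>D. g u) = (\<Sum>u\<in>D - T. g u) + (\<Sum>u\<in>T. g u)"
  using T finite_D by (simp add: sum.subset_diff)

text \<open>This pays for moving weight from \<open>f (X \<union> T)\<close> to the mixture.
  \<open>X \<union> T\<close> is reached from \<open>X\<close> by additions and from
  \<open>Y\<close> by removals; after splitting each marginal between \<open>gain\<close> and
  \<open>loss\<close>, what is left over is a nonnegative multiple of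
  \<open>a u + b u\<close>.\<close>

lemma gain_loss:
  assumes "0 < m"
  shows "f (X \<union> T) - mix \<rho> X Y \<le> gain + loss"
proof -
  have r: "0 \<le> \<rho>" "\<rho> \<le> 1" using rem_le assms by (auto simp: \<rho>_def)
  have "X \<union> T \<subseteq> U" using T XY by auto
  have *: "Y - (D - T) = X \<union> T" using T XY by auto
  have "f (X \<union> T) - f X \<le> (\<Sum>u\<in>T. a u)" using T XY by (intro sum_marginals_add) auto
  moreover have "f (X \<union> T) - f Y \<le> (\<Sum>u\<in>D - T. b u)"
    using sum_marginals_remove[of Y "D - T"] XY unfolding * by auto
  ultimately have "(1 - \<rho>) * (f (X \<union> T) - f X) + \<rho> * (f (X \<union> T) - f Y)
      \<le> (1 - \<rho>) * (\<Sum>u\<in>T. a u) + \<rho> * (\<Sum>u\<in>D - T. b u)"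
    using r by (intro add_mono mult_left_mono) auto
  also have "\<dots> = (\<Sum>u\<in>T. (1 - \<rho>) * a u) + (\<Sum>u\<in>D - T. \<rho> * b u)" by (simp add: sum_distrib_left)
  also have "\<dots> \<le> (\<Sum>u\<in>T. ((1 - \<rho>) * p u * a u + \<rho> * (1 - p u) * b u) + (1 - p u) * a u)
      + (\<Sum>u\<in>D - T. ((1 - \<rho>) * p u * a u + \<rho> * (1 - p u) * b u) + p u * b u)"
  proof (intro add_mono sum_mono)
    fix u assume "u \<in> T"
    then have u: "u \<in> D" using T by auto
    have "0 \<le> \<rho> * ((1 - p u) * (a u + b u))"
      using r p[OF u] ab_nonneg[OF u] by (intro mult_nonneg_nonneg) auto
    then show "(1 - \<rho>) * a u \<le> ((1 - \<rho>) * p u * a u + \<rho> * (1 - p u) * b u) + (1 - p u) * a u"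
      by (simp add: algebra_simps)
  next
    fix u assume "u \<in> D - T"
    then have u: "u \<in> D" by auto
    have "0 \<le> (1 - \<rho>) * (p u * (a u + b u))"
      using r p[OF u] ab_nonneg[OF u] by (intro mult_nonneg_nonneg) auto
    then show "\<rho> * b u \<le> ((1 - \<rho>) * p u * a u + \<rho> * (1 - p u) * b u) + p u * b u"
      by (simp add: algebra_simps)
  qed
  also have "\<dots> = gain + loss"
    unfolding gain_def loss_def split_T[of "\<lambda>u. (1 - \<rho>) * p u * a u + \<rho> * (1 - p u) * b u"]
      sum.distrib[of "\<lambda>u. (1 - \<rho>) * p u * a u + \<rho> * (1 - p u) * b u"] by simp
  finally show ?thesis unfolding mix_def by (simp add: algebra_simps)
qed

end

text \<open>The multiplier replaces \<open>a u\<close>, \<open>b u\<close> by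
  \<open>a u + \<theta>\<close>, \<open>b u - \<theta>\<close>, which have the same sum.
  \<open>\<delta>\<close> is meant to be half a token, and \<open>gap\<close> then expresses that
  the \<open>p u\<close> are multiples of a whole one.\<close>

locale double_greedy_threshold = double_greedy_step +
  fixes \<theta> \<delta> :: real
  assumes \<theta>: "\<And>u. u \<in> D \<Longrightarrow> 0 < p u \<Longrightarrow> (p u - \<delta>) * (a u + b u) \<le> a u + \<theta>"
      "\<And>u. u \<in> D \<Longrightarrow> p u < 1 \<Longrightarrow> a u + \<theta> \<le> (p u + \<delta>) * (a u + b u)"
    and gap: "\<And>u. u \<in> D \<Longrightarrow> 0 < p u \<Longrightarrow> \<delta> \<le> p u" "\<And>u. u \<in> D \<Longrightarrow> p u < 1 \<Longrightarrow> p u \<le> 1 - \<delta>"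
    and \<delta>: "0 \<le> \<delta>" "\<delta> \<le> 1 / 8192"
    and m: "0 < m"
begin

definition "\<gamma> u = (1 - \<rho>) * p u * (a u + \<theta>) + \<rho> * (1 - p u) * (b u - \<theta>)"

text \<open>The shifts cancel, because \<open>(1 - \<rho>) * rem\<close> and
  \<open>\<rho> * (m - rem)\<close> agree. The true gain is therefore a sum of terms that can be
  estimated element by element.\<close>

lemma sum_gamma: "(\<Sum>u\<in>D. \<gamma> u) = gain"
proof -
  have "(\<Sum>u\<in>D. \<gamma> u) = gain + \<theta> * ((1 - \<rho>) * (\<Sum>u\<in>D. p u) - \<rho> * (\<Sum>u\<in>D. 1 - p u))"
    unfolding \<gamma>_def gain_def sum_distrib_left sum.distrib[symmetric] sum_subtractf[symmetric]
    by (intro sum.cong) (auto simp: algebra_simps)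
  also have "(1 - \<rho>) * (\<Sum>u\<in>D. p u) - \<rho> * (\<Sum>u\<in>D. 1 - p u) = 0"
    unfolding sum_p sum_1p using m by (simp add: \<rho>_def field_simps)
  finally show ?thesis by simp
qed

lemma rho_bounds: "0 \<le> \<rho>" "\<rho> \<le> 1"
  using rem_le m by (auto simp: \<rho>_def)

text \<open>By \<open>gap\<close> the rounding error never exceeds a positive \<open>p u\<close> or
  \<open>1 - p u\<close>, so each \<open>\<gamma> u\<close> has nonnegative summands. This covers
  every \<open>\<rho>\<close> in the unit interval, as the last stage of the algorithm
  demands.\<close>

lemma gain_nonneg: "0 \<le> gain"
proof -
  have "0 \<le> \<gamma> u" if u: "u \<in> D" for u
  proof -
    have s: "0 \<le> a u + b u" using ab_nonneg[OF u] .
    have "0 \<le> p u * (a u + \<theta>)"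
    proof (cases "p u = 0")
      case False
      then have "0 < p u" using p[OF u] by auto
      then have "0 \<le> (p u - \<delta>) * (a u + b u)" "(p u - \<delta>) * (a u + b u) \<le> a u + \<theta>"
        using gap(1)[OF u] \<theta>(1)[OF u] s by auto
      then show ?thesis using p[OF u] by (intro mult_nonneg_nonneg) auto
    qed auto
    moreover have "0 \<le> (1 - p u) * (b u - \<theta>)"
    proof (cases "p u = 1")
      case False
      then have "p u < 1" using p[OF u] by auto
      then have "0 \<le> (1 - p u - \<delta>) * (a u + b u)" "a u + \<theta> \<le> (p u + \<delta>) * (a u + b u)"
        using gap(2)[OF u] \<theta>(2)[OF u] s by auto
      then have "0 \<le> b u - \<theta>" by (simp add: algebra_simps)
      then show ?thesis using p[OF u] by (intro mult_nonneg_nonneg) auto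
    qed auto
    ultimately show ?thesis
      using rho_bounds unfolding \<gamma>_def mult.assoc
      by (intro add_nonneg_nonneg[OF mult_nonneg_nonneg mult_nonneg_nonneg]) auto
  qed
  then show ?thesis unfolding sum_gamma[symmetric] by (rule sum_nonneg)
qed

context
  assumes \<rho>: "99 / 1000 \<le> \<rho>" "\<rho> \<le> 901 / 1000"
begin

lemma element:
  assumes u: "u \<in> D"
  shows "8 / 100 * (a u + b u) \<le> \<gamma> u" "p u * (b u - \<theta>) \<le> 169 / 100 * \<gamma> u"
    "(1 - p u) * (a u + \<theta>) \<le> 169 / 100 * \<gamma> u"
proof -
  have eq: "a u + b u - (a u + \<theta>) = b u - \<theta>" by simp
  note * = double_greedy_element[OF p(1)[OF u] p(2)[OF u] ab_nonneg[OF u] \<theta>(1)[OF u] \<theta>(2)[OF u] \<rho> \<delta>]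
  show "8 / 100 * (a u + b u) \<le> \<gamma> u" unfolding \<gamma>_def by (rule *(1)[unfolded eq])
  show "p u * (b u - \<theta>) \<le> 169 / 100 * \<gamma> u" unfolding \<gamma>_def by (rule *(2)[unfolded eq])
  show "(1 - p u) * (a u + \<theta>) \<le> 169 / 100 * \<gamma> u" unfolding \<gamma>_def by (rule *(3)[unfolded eq])
qed

text \<open>Unlike in the gain, the shifts do not cancel: they add up to \<open>\<theta>\<close>
  times the sum of \<open>p\<close> over \<open>D - T\<close> minus the sum of \<open>1 - p\<close>
  over \<open>T\<close>, which is \<open>rem - card T\<close>.\<close>

lemma loss_le: "loss \<le> 169 / 100 * gain + \<bar>\<theta>\<bar> * \<bar>real rem - real (card T)\<bar>"
proof -
  have "(\<Sum>u\<in>D - T. p u * b u) = (\<Sum>u\<in>D - T. p u * (b u - \<theta>)) + \<theta> * (\<Sum>u\<in>D - T. p u)"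
    unfolding sum_distrib_left sum.distrib[symmetric] by (intro sum.cong) (auto simp: algebra_simps)
  moreover have "(\<Sum>u\<in>T. (1 - p u) * a u) =
      (\<Sum>u\<in>T. (1 - p u) * (a u + \<theta>)) + (\<theta> * (\<Sum>u\<in>T. p u) - \<theta> * (\<Sum>u\<in>T. 1))"
    unfolding sum_distrib_left sum_subtractf[symmetric] sum.distrib[symmetric]
    by (intro sum.cong) (auto simp: algebra_simps)
  moreover have "(\<Sum>u\<in>D - T. p u) = real rem - (\<Sum>u\<in>T. p u)" using sum_p split_T[of p] by simp
  ultimately have eq: "loss = (\<Sum>u\<in>D - T. p u * (b u - \<theta>)) + (\<Sum>u\<in>T. (1 - p u) * (a u + \<theta>))
     + \<theta> * (real rem - real (card T))"
    unfolding loss_def by (simp add: right_diff_distrib)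
  have "(\<Sum>u\<in>D - T. p u * (b u - \<theta>)) + (\<Sum>u\<in>T. (1 - p u) * (a u + \<theta>))
     \<le> (\<Sum>u\<in>D - T. 169 / 100 * \<gamma> u) + (\<Sum>u\<in>T. 169 / 100 * \<gamma> u)"
    using T by (intro add_mono sum_mono element) auto
  moreover have "(\<Sum>u\<in>D - T. 169 / 100 * \<gamma> u) + (\<Sum>u\<in>T. 169 / 100 * \<gamma> u) = 169 / 100 * gain"
    unfolding sum_gamma[symmetric] split_T[of \<gamma>] distrib_left sum_distrib_left ..
  moreover have "\<theta> * (real rem - real (card T)) \<le> \<bar>\<theta>\<bar> * \<bar>real rem - real (card T)\<bar>"
    by (metis abs_ge_self abs_mult)
  ultimately show ?thesis unfolding eq by linarith
qed

text \<open>A large multiplier must be balanced by large marginals. For positive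
  \<open>\<theta>\<close> the upper thresholds bound \<open>(1 - p u) * (a u + \<theta>)\<close> by
  multiples of \<open>a u + b u\<close>, while the sum of \<open>(1 - p u) * a u\<close> is at least
  \<open>- f X\<close>; negative \<open>\<theta>\<close> is dual, with \<open>Y\<close>. The sum of
  \<open>a u + b u\<close> is at most \<open>100 / 8\<close> of the gain, and \<open>\<rho>\<close>
  leaves at least \<open>99 / 1000\<close> of \<open>m\<close> on either side.\<close>

lemma shift_le:
  assumes G: "f X \<le> G" "f Y \<le> G"
  shows "\<bar>\<theta>\<bar> * real m \<le> 300 * gain + 11 * G"
proof -
  have "(\<Sum>u\<in>D. 8 / 100 * (a u + b u)) \<le> (\<Sum>u\<in>D. \<gamma> u)" by (intro sum_mono element)
  then have S: "8 / 100 * (\<Sum>u\<in>D. a u + b u) \<le> gain"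
    unfolding sum_gamma by (simp only: sum_distrib_left)
  define S where "S = (\<Sum>u\<in>D. a u + b u)"
  have G0: "0 \<le> G" using nonneg[of Y] XY G by auto
  have g0: "0 \<le> gain" by (rule gain_nonneg)
  have S0: "0 \<le> S" unfolding S_def by (intro sum_nonneg ab_nonneg)
  have pos: "\<theta> * (real m - real rem) \<le> 2 * S + G"
  proof -
    have "\<theta> * (real m - real rem) = (\<Sum>u\<in>D. (1 - p u) * \<theta>)"
      unfolding sum_1p[symmetric] by (simp add: sum_distrib_left mult.commute)
    also have "\<dots> \<le> (\<Sum>u\<in>D. 2 * (a u + b u) - (1 - p u) * a u)"
    proof (rule sum_mono)
      fix u assume u: "u \<in> D"
      show "(1 - p u) * \<theta> \<le> 2 * (a u + b u) - (1 - p u) * a u"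
      proof (cases "p u = 1")
        case False
        then have p1: "p u < 1" "0 \<le> 1 - p u" "1 - p u \<le> 1" using p[OF u] by auto
        have "(1 - p u) * (a u + \<theta>) \<le> (1 - p u) * ((p u + \<delta>) * (a u + b u))"
          using \<theta>(2)[OF u p1(1)] p1 by (intro mult_left_mono) auto
        also have "\<dots> \<le> 1 * (2 * (a u + b u))"
          using p1 p[OF u] ab_nonneg[OF u] \<delta> by (intro mult_mono) auto
        finally show ?thesis by (simp add: algebra_simps)
      qed (use ab_nonneg[OF u] in auto)
    qed
    also have "\<dots> = 2 * S - (\<Sum>u\<in>D. (1 - p u) * a u)"
      unfolding S_def by (simp only: sum_subtractf sum_distrib_left)
    also have "\<dots> \<le> 2 * S + G"
    proof -
      have "D \<subseteq> U" using XY by auto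
      then have "- f X \<le> (\<Sum>u\<in>D. (1 - p u) * a u)"
        using p by (intro weighted_add_ge[OF XU]) simp_all
      then show ?thesis using G by linarith
    qed
    finally show ?thesis .
  qed
  have neg: "- \<theta> * real rem \<le> 2 * S + G"
  proof -
    have "- \<theta> * real rem = (\<Sum>u\<in>D. p u * (- \<theta>))"
      unfolding sum_p[symmetric] by (simp add: sum_distrib_left sum_negf mult.commute)
    also have "\<dots> \<le> (\<Sum>u\<in>D. 2 * (a u + b u) - p u * b u)"
    proof (rule sum_mono)
      fix u assume u: "u \<in> D"
      show "p u * (- \<theta>) \<le> 2 * (a u + b u) - p u * b u"
      proof (cases "p u = 0")
        case False
        then have p1: "0 < p u" "p u \<le> 1" using p[OF u] by auto
        have "p u * (b u - \<theta>) \<le> p u * ((1 - p u + \<delta>) * (a u + b u))"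
          using \<theta>(1)[OF u p1(1)] p1 by (intro mult_left_mono) (auto simp: algebra_simps)
        also have "\<dots> \<le> 1 * (2 * (a u + b u))"
          using p1 p[OF u] ab_nonneg[OF u] \<delta> by (intro mult_mono) auto
        finally show ?thesis by (simp add: algebra_simps)
      qed (use ab_nonneg[OF u] in auto)
    qed
    also have "\<dots> = 2 * S - (\<Sum>u\<in>D. p u * b u)"
      unfolding S_def by (simp only: sum_subtractf sum_distrib_left)
    also have "\<dots> \<le> 2 * S + G"
    proof -
      have "D \<subseteq> U" using XY by auto
      then have "- f Y \<le> (\<Sum>u\<in>D. p u * b u)"
        using p by (intro weighted_remove_ge[OF XY(2)]) simp_all
      then show ?thesis using G by linarith
    qed
    finally show ?thesis .
  qed
  have rm: "99 / 1000 * real m \<le> real rem" "99 / 1000 * real m \<le> real m - real rem"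
    using \<rho> m by (auto simp: \<rho>_def field_simps)
  have "\<bar>\<theta>\<bar> * (99 / 1000 * real m) \<le> 2 * S + G"
  proof (cases "0 \<le> \<theta>")
    case True
    then have "\<theta> * (99 / 1000 * real m) \<le> \<theta> * (real m - real rem)"
      using rm by (intro mult_left_mono) auto
    then show ?thesis using True pos by auto
  next
    case False
    then have "- \<theta> * (99 / 1000 * real m) \<le> - \<theta> * real rem"
      using rm by (intro mult_left_mono) auto
    moreover have "\<bar>\<theta>\<bar> = - \<theta>" using False by simp
    ultimately show ?thesis using neg by (metis order_trans)
  qed
  moreover define w where "w = \<bar>\<theta>\<bar> * real m"
  ultimately have "99 / 1000 * w \<le> 2 * S + G" by (simp add: mult.left_commute)
  then have "99 * w \<le> 2000 * S + 1000 * G" by simp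
  moreover have "8 * S \<le> 100 * gain" using S unfolding S_def[symmetric] by simp
  ultimately have "w \<le> 300 * gain + 11 * G" using G0 g0 by linarith
  then show ?thesis unfolding w_def .
qed

end
end

section \<open>The potential of double greedy\<close>

context nonneg_submodular
begin

text \<open>The two values of \<open>f\<close> carry total weight 27/10, of which
  \<open>M / m\<close> moves from the optimum to the mixture as \<open>m\<close> falls to
  \<open>M\<close>. \<open>e\<close> is the error granted per step. \<open>B\<close> penalises the
  imbalance between \<open>rem\<close> and the optimum's share, and the drift of
  \<open>\<rho>\<close> from its initial value \<open>r\<close>.\<close>

definition dg_raw :: "'a set \<Rightarrow> nat \<Rightarrow> real \<Rightarrow> real \<Rightarrow> real \<Rightarrow> real \<Rightarrow> 'a set \<Rightarrow> 'a set \<Rightarrow> real" where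
  "dg_raw OPT k r M e B X Y = (let m = real (card (Y - X)); rem = real k - real (card X);
      T = OPT \<inter> (Y - X) in
    (17 / 10 + M / m) * mix (rem / m) X Y + (1 - M / m) * f (X \<union> T) - (m - M) * e
      - B * (((rem - real (card T)) / m)\<^sup>2 + (rem / m - r)\<^sup>2))"

text \<open>
  Once at most \<open>M\<close> elements are undecided, random fluctuations of the cardinalities are no longer
  controlled, and only the monotonicity of the mixture is used.
\<close>

definition dg_pot :: "'a set \<Rightarrow> nat \<Rightarrow> real \<Rightarrow> nat \<Rightarrow> real \<Rightarrow> real \<Rightarrow> 'a set \<Rightarrow> 'a set \<Rightarrow> real" where
  "dg_pot OPT k r M e B X Y = max 0 (if card (Y - X) \<le> M
     then 27 / 10 * mix ((real k - real (card X)) / real (card (Y - X))) X Y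
     else dg_raw OPT k r (real M) e B X Y)"

text \<open>At \<open>m = M\<close> the two formulas differ only by the penalty, so the change of
  regime never lowers the potential.\<close>

lemma dg_pot_ge_raw:
  assumes "M \<le> card (Y - X)" "1 \<le> M" "0 \<le> B"
  shows "dg_raw OPT k r (real M) e B X Y \<le> dg_pot OPT k r M e B X Y"
proof (cases "card (Y - X) = M")
  case True
  have "0 \<le> B * (((real k - real (card X) - real (card (OPT \<inter> (Y - X)))) / real M)\<^sup>2
     + ((real k - real (card X)) / real M - r)\<^sup>2)"
    using assms by (intro mult_nonneg_nonneg) auto
  then show ?thesis using True assms unfolding dg_pot_def dg_raw_def Let_def
    by (simp add: le_max_iff_disj)
qed (use assms in \<open>simp add: dg_pot_def\<close>)

end

text \<open>The cross terms vanish because the increments have mean zero. This bounds the growth of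
  the variance of the two normalised deviations.\<close>

lemma sum_square_shift:
  fixes z c :: real and p d1 d2 :: "'a \<Rightarrow> real"
  assumes "finite D" "\<And>u. u \<in> D \<Longrightarrow> 0 \<le> p u" "\<And>u. u \<in> D \<Longrightarrow> p u \<le> 1"
    and zero: "(\<Sum>u\<in>D. p u * d1 u + (1 - p u) * d2 u) = 0"
    and bd: "\<And>u. u \<in> D \<Longrightarrow> \<bar>d1 u\<bar> \<le> K" "\<And>u. u \<in> D \<Longrightarrow> \<bar>d2 u\<bar> \<le> K"
  shows "(\<Sum>u\<in>D. p u * (z + d1 u / c)\<^sup>2 + (1 - p u) * (z + d2 u / c)\<^sup>2)
     \<le> real (card D) * (z\<^sup>2 + (K / c)\<^sup>2)"
proof -
  have "(\<Sum>u\<in>D. p u * (z + d1 u / c)\<^sup>2 + (1 - p u) * (z + d2 u / c)\<^sup>2)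
    = (\<Sum>u\<in>D. z\<^sup>2 + 2 * z / c * (p u * d1 u + (1 - p u) * d2 u) + (p u * (d1 u / c)\<^sup>2 + (1 - p u) * (d2 u / c)\<^sup>2))"
    by (intro sum.cong refl) (simp add: power2_eq_square divide_inverse algebra_simps)
  also have "\<dots> = (\<Sum>u\<in>D. z\<^sup>2) + 2 * z / c * (\<Sum>u\<in>D. p u * d1 u + (1 - p u) * d2 u)
      + (\<Sum>u\<in>D. p u * (d1 u / c)\<^sup>2 + (1 - p u) * (d2 u / c)\<^sup>2)"
    by (simp only: sum.distrib[of "\<lambda>u. z\<^sup>2 + _ u"] sum.distrib[of "\<lambda>u. z\<^sup>2"] sum_distrib_left[symmetric])
  also have "\<dots> \<le> (\<Sum>u\<in>D. z\<^sup>2) + (\<Sum>u\<in>D. (K / c)\<^sup>2)"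
  proof -
    have "p u * (d1 u / c)\<^sup>2 + (1 - p u) * (d2 u / c)\<^sup>2 \<le> (K / c)\<^sup>2" if u: "u \<in> D" for u
    proof -
      have "(d1 u / c)\<^sup>2 \<le> (K / c)\<^sup>2" "(d2 u / c)\<^sup>2 \<le> (K / c)\<^sup>2"
        using bd[OF u] unfolding power_divide
        by (intro divide_right_mono; simp add: abs_le_square_iff[symmetric])+
      then have "p u * (d1 u / c)\<^sup>2 + (1 - p u) * (d2 u / c)\<^sup>2 \<le> p u * (K / c)\<^sup>2 + (1 - p u) * (K / c)\<^sup>2"
        using assms(2,3)[OF u] by (intro add_mono mult_left_mono) auto
      then show ?thesis by (simp add: algebra_simps)
    qed
    then have "(\<Sum>u\<in>D. p u * (d1 u / c)\<^sup>2 + (1 - p u) * (d2 u / c)\<^sup>2) \<le> (\<Sum>u\<in>D. (K / c)\<^sup>2)"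
      by (rule sum_mono)
    then show ?thesis unfolding zero by simp
  qed
  finally show ?thesis by (simp add: distrib_left)
qed

context double_greedy_threshold
begin

context
  fixes OPT :: "'a set" and k :: nat and r G \<epsilon> e B :: real and M :: nat
  assumes T_def: "T = OPT \<inter> (Y - X)" and k: "k = card X + rem" and r: "1 / 10 \<le> r" "r \<le> 9 / 10"
    and G: "\<And>A. A \<subseteq> U \<Longrightarrow> f A \<le> G"
    and \<epsilon>: "0 < \<epsilon>" "\<epsilon> \<le> 1 / 30000" and M: "1 \<le> M"
    and B: "B = 27 / 10 * G / \<epsilon>\<^sup>2" and e: "e = 11 * G * \<epsilon> / real M + 5 * B / (real M)\<^sup>2"
begin

lemma G_nonneg: "0 \<le> G" using G[of X] nonneg[of X] XU by auto

lemma B_nonneg: "0 \<le> B" using G_nonneg \<epsilon> by (simp add: B)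

lemma next_add:
  assumes u: "u \<in> D"
  shows "card (Y - insert u X) = m - 1" "card (insert u X) = card X + 1"
    "OPT \<inter> (Y - insert u X) = T - {u}"
proof -
  have "Y - insert u X = D - {u}" by auto
  then show "card (Y - insert u X) = m - 1" using u by simp
  show "card (insert u X) = card X + 1" using u finite_sub[OF XU] by simp
  show "OPT \<inter> (Y - insert u X) = T - {u}" unfolding T_def by auto
qed

lemma next_remove:
  assumes u: "u \<in> D"
  shows "card (Y - {u} - X) = m - 1" "OPT \<inter> (Y - {u} - X) = T - {u}"
proof -
  have "Y - {u} - X = D - {u}" by auto
  then show "card (Y - {u} - X) = m - 1" using u by simp
  show "OPT \<inter> (Y - {u} - X) = T - {u}" unfolding T_def by auto
qed

abbreviation "pot \<equiv> dg_pot OPT k r M e B"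

text \<open>The mixture does not decrease because \<open>gain\<close> is nonnegative. A single
  undecided element is treated separately, as \<open>mix_step\<close> divides by
  \<open>m - 1\<close>.\<close>

lemma pot_step_late:
  assumes mM: "m \<le> M"
  shows "real m * pot X Y \<le> (\<Sum>u\<in>D. p u * pot (insert u X) Y + (1 - p u) * pot X (Y - {u}))"
proof -
  have pot0: "0 \<le> pot A C" for A C by (simp add: dg_pot_def)
  have sum0: "0 \<le> (\<Sum>u\<in>D. p u * pot (insert u X) Y + (1 - p u) * pot X (Y - {u}))"
    using p pot0 by (intro sum_nonneg add_nonneg_nonneg mult_nonneg_nonneg) auto
  have "real m * (27 / 10 * mix (real rem / real m) X Y)
      \<le> (\<Sum>u\<in>D. p u * pot (insert u X) Y + (1 - p u) * pot X (Y - {u}))"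
  proof (cases "m = 1")
    case True
    then obtain u where u: "D = {u}" by (auto simp: card_1_singleton_iff)
    have "Y - insert u X = {}" "Y - {u} - X = {}" using u by auto
    moreover have "Y = insert u X" "Y - {u} = X" using u XY by auto
    ultimately have eq: "pot (insert u X) Y = 27 / 10 * f Y" "pot X (Y - {u}) = 27 / 10 * f X"
      using nonneg[OF XU] nonneg[OF XY(2)] unfolding dg_pot_def mix_def by (auto simp: algebra_simps)
    have "p u = real rem" using sum_p u by simp
    then show ?thesis using u True by (simp add: eq mix_def)
  next
    case False
    then have m2: "2 \<le> m" using m by linarith
    have "real m * mix \<rho> X Y \<le> real m * (mix \<rho> X Y + gain / (real m - 1))"
      using gain_nonneg m2 by (intro mult_left_mono) auto
    then have "27 / 10 * (real m * mix \<rho> X Y) \<le> 27 / 10 * (\<Sum>u\<in>D. p u * mix ((real rem - 1) / (real m - 1)) (insert u X) Y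
            + (1 - p u) * mix (real rem / (real m - 1)) X (Y - {u}))"
      unfolding mix_step[OF m2] by simp
    also have "\<dots> = (\<Sum>u\<in>D. p u * (27 / 10 * mix ((real rem - 1) / (real m - 1)) (insert u X) Y)
            + (1 - p u) * (27 / 10 * mix (real rem / (real m - 1)) X (Y - {u})))"
      unfolding sum_distrib_left by (intro sum.cong) (auto simp: field_simps)
    also have "\<dots> \<le> (\<Sum>u\<in>D. p u * pot (insert u X) Y + (1 - p u) * pot X (Y - {u}))"
    proof (intro sum_mono add_mono mult_left_mono)
      fix u assume u: "u \<in> D"
      show "27 / 10 * mix ((real rem - 1) / (real m - 1)) (insert u X) Y \<le> pot (insert u X) Y"
      proof -
        have c: "card (Y - insert u X) \<le> M" using next_add[OF u] mM by simp
        have "(real k - real (card (insert u X))) / real (card (Y - insert u X)) = (real rem - 1) / (real m - 1)"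
          unfolding next_add[OF u] k using m2 by (simp add: of_nat_diff)
        then show ?thesis unfolding dg_pot_def if_P[OF c] by (metis max.cobounded2)
      qed
      show "27 / 10 * mix (real rem / (real m - 1)) X (Y - {u}) \<le> pot X (Y - {u})"
      proof -
        have c: "card (Y - {u} - X) \<le> M" using next_remove[OF u] mM by simp
        have "(real k - real (card X)) / real (card (Y - {u} - X)) = real rem / (real m - 1)"
          unfolding next_remove[OF u] k using m2 by (simp add: of_nat_diff)
        then show ?thesis unfolding dg_pot_def if_P[OF c] by (metis max.cobounded2)
      qed
    qed (use p in auto)
    finally show ?thesis by (simp add: \<rho>_def)
  qed
  moreover have "pot X Y = max 0 (27 / 10 * mix (real rem / real m) X Y)"
    unfolding dg_pot_def[of OPT k r M e B X Y] if_P[OF mM] by (simp add: k)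
  ultimately show ?thesis using sum0 by (simp only: max_def split: if_split) simp
qed

text \<open>A positive value forces the penalty below \<open>27 / 10 * G\<close>, hence by the
  choice of \<open>B\<close> both deviations below \<open>\<epsilon>\<close>. Then
  \<open>\<rho>\<close> lies in the range of the elementwise bounds, and the term with
  \<open>\<theta>\<close> costs at most \<open>gain / 100 + 11 * G * \<epsilon>\<close>, as
  \<open>300 * \<epsilon> \<le> 1 / 100\<close>; this turns 169/100 into 17/10. The constant part
  and the growing variance are what \<open>e\<close> pays for, since \<open>m - 1\<close> is at
  least \<open>M\<close>.\<close>

lemma pot_step_early:
  assumes mM: "M < m" and rawpos: "0 < dg_raw OPT k r (real M) e B X Y"
  shows "real m * dg_raw OPT k r (real M) e B X Y
    \<le> (\<Sum>u\<in>D. p u * pot (insert u X) Y + (1 - p u) * pot X (Y - {u}))"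
proof -
  define mm where "mm = real m"
  define MM where "MM = real M"
  define z where "z = (real rem - real (card T)) / mm"
  define y where "y = real rem / mm - r"
  define \<theta>1 where "\<theta>1 = MM / (mm - 1)"
  define S where "S = f (X \<union> T)"
  define \<Phi> where "\<Phi> = mix \<rho> X Y"
  have mm: "MM + 1 \<le> mm" "1 \<le> MM" "2 \<le> mm" using mM M by (auto simp: mm_def MM_def)
  have m2: "2 \<le> m" using mM M by auto
  have raw: "dg_raw OPT k r MM e B X Y = (17 / 10 + MM / mm) * \<Phi> + (1 - MM / mm) * S - (mm - MM) * e - B * (z\<^sup>2 + y\<^sup>2)"
    unfolding dg_raw_def Let_def T_def[symmetric] k S_def \<Phi>_def \<rho>_def z_def y_def mm_def by simp
  have e0: "0 \<le> e" unfolding e using G_nonneg B_nonneg \<epsilon> by simp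
  have S: "0 \<le> S" "S \<le> G" unfolding S_def using XU T XY by (auto intro!: nonneg G)
  have \<rho>01: "0 \<le> \<rho>" "\<rho> \<le> 1" using rho_bounds .
  have \<Phi>: "\<Phi> \<le> G"
  proof -
    have "(1 - \<rho>) * f X + \<rho> * f Y \<le> (1 - \<rho>) * G + \<rho> * G"
      using \<rho>01 XU XY by (intro add_mono mult_left_mono G) auto
    then show ?thesis by (simp add: \<Phi>_def mix_def algebra_simps)
  qed
  have small: "z\<^sup>2 + y\<^sup>2 \<le> \<epsilon>\<^sup>2"
  proof -
    have "(17 / 10 + MM / mm) * \<Phi> \<le> (17 / 10 + MM / mm) * G"
      using \<Phi> mm by (intro mult_left_mono) auto
    moreover have "(1 - MM / mm) * S \<le> (1 - MM / mm) * G"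
      using S mm by (intro mult_left_mono) (auto simp: field_simps)
    moreover have "0 \<le> (mm - MM) * e" using mm e0 by simp
    ultimately have "B * (z\<^sup>2 + y\<^sup>2) < (17 / 10 + MM / mm) * G + (1 - MM / mm) * G"
      using rawpos raw unfolding MM_def by linarith
    also have "\<dots> = 27 / 10 * G" by (simp add: algebra_simps)
    finally have lt: "B * (z\<^sup>2 + y\<^sup>2) < 27 / 10 * G" .
    have "0 \<le> B * (z\<^sup>2 + y\<^sup>2)" using B_nonneg by simp
    then have Gpos: "0 < G" using lt by simp
    have "27 / 10 * G * (z\<^sup>2 + y\<^sup>2) < 27 / 10 * G * \<epsilon>\<^sup>2"
      using lt \<epsilon> unfolding B by (simp add: field_simps)
    then show ?thesis using Gpos by simp
  qed
  have z: "\<bar>z\<bar> \<le> \<epsilon>"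
  proof -
    have "z\<^sup>2 \<le> \<epsilon>\<^sup>2" using small by (smt (verit) zero_le_power2)
    then show ?thesis using \<epsilon> by (simp add: abs_le_square_iff[symmetric])
  qed
  have y: "\<bar>y\<bar> \<le> \<epsilon>"
  proof -
    have "y\<^sup>2 \<le> \<epsilon>\<^sup>2" using small by (smt (verit) zero_le_power2)
    then show ?thesis using \<epsilon> by (simp add: abs_le_square_iff[symmetric])
  qed
  have \<rho>y: "\<rho> = r + y" by (simp add: \<rho>_def y_def mm_def)
  have "\<bar>y\<bar> \<le> 1 / 30000" using y \<epsilon> by simp
  then have \<rho>r: "99 / 1000 \<le> \<rho>" "\<rho> \<le> 901 / 1000" unfolding \<rho>y using r by (simp_all add: abs_le_iff)
  have gain0: "0 \<le> gain" using gain_nonneg .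
  have lossb: "loss \<le> 17 / 10 * gain + 11 * G * \<epsilon>"
  proof -
    have "\<bar>\<theta>\<bar> * \<bar>real rem - real (card T)\<bar> = \<bar>\<theta>\<bar> * real m * \<bar>z\<bar>"
      unfolding z_def mm_def using m by (simp add: abs_divide)
    also have "\<dots> \<le> (300 * gain + 11 * G) * \<epsilon>"
      using shift_le[OF \<rho>r G[OF XU] G[OF XY(2)]] z \<epsilon> gain0 G_nonneg by (intro mult_mono) auto
    also have "\<dots> = 300 * \<epsilon> * gain + 11 * G * \<epsilon>" by (simp add: algebra_simps)
    also have "\<dots> \<le> 1 / 100 * gain + 11 * G * \<epsilon>"
      using \<epsilon> gain0 by (intro add_right_mono mult_right_mono) auto
    finally have "\<bar>\<theta>\<bar> * \<bar>real rem - real (card T)\<bar> \<le> 1 / 100 * gain + 11 * G * \<epsilon>" .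
    moreover have "169 / 100 * gain + 1 / 100 * gain = 17 / 10 * gain" by simp
    ultimately show ?thesis using loss_le[OF \<rho>r] by linarith
  qed
  define t where "t u = (if u \<in> T then 1 else 0 :: real)" for u
  have sum_t: "(\<Sum>u\<in>D. t u) = real (card T)"
  proof -
    have "D \<inter> {u. u \<in> T} = T" using T by auto
    then show ?thesis unfolding t_def using finite_D by (simp add: sum.If_cases)
  qed
  have cardT: "real (card (T - {u})) = real (card T) - t u" for u
  proof (cases "u \<in> T")
    case True
    then have "0 < card T" using finite_T by (auto simp: card_gt_0_iff)
    then show ?thesis using True by (simp add: t_def of_nat_diff)
  qed (simp add: t_def)
  have z1: "\<bar>z\<bar> \<le> 1" "\<bar>\<rho>\<bar> \<le> 1" using z \<epsilon> \<rho>01 by auto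
  \<comment> \<open>After a move the deviation is \<open>z\<close> plus an increment divided by
    \<open>m - 1\<close>; \<open>t u\<close> records whether the optimum's share loses
    \<open>u\<close>. The increments are at most 2 here and at most 1 for \<open>y\<close>, whence
    the \<open>4 + 1 = 5\<close> in \<open>e\<close>.\<close>
  have sq_z: "(\<Sum>u\<in>D. p u * (z + (z + t u - 1) / (mm - 1))\<^sup>2 + (1 - p u) * (z + (z + t u) / (mm - 1))\<^sup>2)
     \<le> mm * (z\<^sup>2 + (2 / (mm - 1))\<^sup>2)"
    unfolding mm_def
  proof (rule sum_square_shift)
    have "(\<Sum>u\<in>D. p u * (z + t u - 1) + (1 - p u) * (z + t u)) = (\<Sum>u\<in>D. z + t u - p u)"
      by (intro sum.cong) (auto simp: algebra_simps)
    also have "\<dots> = mm * z + real (card T) - real rem"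
      using sum_t sum_p by (simp add: sum.distrib sum_subtractf mm_def)
    also have "\<dots> = 0" using mm by (simp add: z_def)
    finally show "(\<Sum>u\<in>D. p u * (z + t u - 1) + (1 - p u) * (z + t u)) = 0" .
    show "\<bar>z + t u - 1\<bar> \<le> 2" "\<bar>z + t u\<bar> \<le> 2" for u
      using z1 unfolding t_def by (auto simp: abs_le_iff)
  qed (use finite_D p in auto)
  have sq_y: "(\<Sum>u\<in>D. p u * (y + (\<rho> - 1) / (mm - 1))\<^sup>2 + (1 - p u) * (y + \<rho> / (mm - 1))\<^sup>2)
     \<le> mm * (y\<^sup>2 + (1 / (mm - 1))\<^sup>2)"
    unfolding mm_def
  proof (rule sum_square_shift)
    have "(\<Sum>u\<in>D. p u * (\<rho> - 1) + (1 - p u) * \<rho>) = (\<Sum>u\<in>D. \<rho> - p u)"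
      by (intro sum.cong) (auto simp: algebra_simps)
    also have "\<dots> = mm * \<rho> - real rem"
      using sum_p by (simp add: sum_subtractf mm_def)
    also have "\<dots> = 0" using mm by (simp add: \<rho>_def mm_def)
    finally show "(\<Sum>u\<in>D. p u * (\<rho> - 1) + (1 - p u) * \<rho>) = 0" .
    show "\<bar>\<rho> - 1\<bar> \<le> 1" "\<bar>\<rho>\<bar> \<le> 1" using \<rho>01 by auto
  qed (use finite_D p in auto)
  define A1 where "A1 u = mix ((real rem - 1) / (mm - 1)) (insert u X) Y" for u
  define A2 where "A2 u = mix (real rem / (mm - 1)) X (Y - {u})" for u
  define O1 where "O1 u = f (insert u X \<union> (T - {u}))" for u
  define O2 where "O2 u = f (X \<union> (T - {u}))" for u
  define Z1 where "Z1 u = (z + (z + t u - 1) / (mm - 1))\<^sup>2" for u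
  define Z2 where "Z2 u = (z + (z + t u) / (mm - 1))\<^sup>2" for u
  define Y1 where "Y1 = (y + (\<rho> - 1) / (mm - 1))\<^sup>2"
  define Y2 where "Y2 = (y + \<rho> / (mm - 1))\<^sup>2"
  define K where "K = (mm - 1 - MM) * e"
  have raw_add: "dg_raw OPT k r MM e B (insert u X) Y =
      (17 / 10 + \<theta>1) * A1 u + (1 - \<theta>1) * O1 u - K - B * (Z1 u + Y1)" if u: "u \<in> D" for u
  proof -
    have "real (card (Y - insert u X)) = mm - 1" using next_add[OF u] m2 by (simp add: mm_def of_nat_diff)
    moreover have "real k - real (card (insert u X)) = real rem - 1" using next_add[OF u] k by simp
    moreover have "(real rem - 1 - real (card (T - {u}))) / (mm - 1) = z + (z + t u - 1) / (mm - 1)"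
      unfolding cardT z_def using mm by (simp add: divide_simps) (simp add: algebra_simps)
    moreover have "(real rem - 1) / (mm - 1) - r = y + (\<rho> - 1) / (mm - 1)"
      unfolding y_def \<rho>_def mm_def[symmetric] using mm by (simp add: divide_simps) (simp add: algebra_simps)
    ultimately show ?thesis
      unfolding dg_raw_def Let_def next_add(3)[OF u] A1_def O1_def Z1_def Y1_def K_def \<theta>1_def by simp
  qed
  have raw_rem: "dg_raw OPT k r MM e B X (Y - {u}) =
      (17 / 10 + \<theta>1) * A2 u + (1 - \<theta>1) * O2 u - K - B * (Z2 u + Y2)" if u: "u \<in> D" for u
  proof -
    have "real (card (Y - {u} - X)) = mm - 1" using next_remove[OF u] m2 by (simp add: mm_def of_nat_diff)
    moreover have "real k - real (card X) = real rem" using k by simp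
    moreover have "(real rem - real (card (T - {u}))) / (mm - 1) = z + (z + t u) / (mm - 1)"
      unfolding cardT z_def using mm by (simp add: divide_simps) (simp add: algebra_simps)
    moreover have "real rem / (mm - 1) - r = y + \<rho> / (mm - 1)"
      unfolding y_def \<rho>_def mm_def[symmetric] using mm by (simp add: divide_simps) (simp add: algebra_simps)
    ultimately show ?thesis
      unfolding dg_raw_def Let_def next_remove(2)[OF u] A2_def O2_def Z2_def Y2_def K_def \<theta>1_def by simp
  qed
  have \<theta>1: "0 \<le> \<theta>1" "\<theta>1 \<le> 1" unfolding \<theta>1_def using mm by (auto simp: field_simps)
  have sumA: "(\<Sum>u\<in>D. p u * A1 u + (1 - p u) * A2 u) = mm * (\<Phi> + gain / (mm - 1))"
    using mix_step[OF m2] unfolding A1_def A2_def \<Phi>_def mm_def .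
  have sumO: "mm * S - loss \<le> (\<Sum>u\<in>D. p u * O1 u + (1 - p u) * O2 u)"
    using opt_step unfolding O1_def O2_def S_def mm_def .
  have sumZ: "(\<Sum>u\<in>D. p u * Z1 u + (1 - p u) * Z2 u) + (\<Sum>u\<in>D. p u * Y1 + (1 - p u) * Y2)
     \<le> mm * (z\<^sup>2 + y\<^sup>2 + 5 / (mm - 1)\<^sup>2)"
    using add_mono[OF sq_z sq_y] unfolding Z1_def Z2_def Y1_def Y2_def
    by (simp add: power_divide algebra_simps)
  have "(\<Sum>u\<in>D. p u * dg_raw OPT k r MM e B (insert u X) Y + (1 - p u) * dg_raw OPT k r MM e B X (Y - {u}))
    = (\<Sum>u\<in>D. (17 / 10 + \<theta>1) * (p u * A1 u + (1 - p u) * A2 u) + (1 - \<theta>1) * (p u * O1 u + (1 - p u) * O2 u)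
        - K - B * ((p u * Z1 u + (1 - p u) * Z2 u) + (p u * Y1 + (1 - p u) * Y2)))"
  proof (intro sum.cong refl)
    fix u assume u: "u \<in> D"
    show "p u * dg_raw OPT k r MM e B (insert u X) Y + (1 - p u) * dg_raw OPT k r MM e B X (Y - {u})
      = (17 / 10 + \<theta>1) * (p u * A1 u + (1 - p u) * A2 u) + (1 - \<theta>1) * (p u * O1 u + (1 - p u) * O2 u)
        - K - B * ((p u * Z1 u + (1 - p u) * Z2 u) + (p u * Y1 + (1 - p u) * Y2))"
      unfolding raw_add[OF u] raw_rem[OF u] by (simp add: field_simps)
  qed
  also have "\<dots> = (17 / 10 + \<theta>1) * (\<Sum>u\<in>D. p u * A1 u + (1 - p u) * A2 u)
      + (1 - \<theta>1) * (\<Sum>u\<in>D. p u * O1 u + (1 - p u) * O2 u) - mm * K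
      - B * ((\<Sum>u\<in>D. p u * Z1 u + (1 - p u) * Z2 u) + (\<Sum>u\<in>D. p u * Y1 + (1 - p u) * Y2))"
    unfolding sum_subtractf sum.distrib[of "\<lambda>u. (17 / 10 + \<theta>1) * (p u * A1 u + (1 - p u) * A2 u)"]
      sum_distrib_left[symmetric] sum.distrib[of "\<lambda>u. p u * Z1 u + (1 - p u) * Z2 u"]
    by (simp add: mm_def)
  also have "\<dots> \<ge> (17 / 10 + \<theta>1) * (mm * (\<Phi> + gain / (mm - 1))) + (1 - \<theta>1) * (mm * S - loss) - mm * K
      - B * (mm * (z\<^sup>2 + y\<^sup>2 + 5 / (mm - 1)\<^sup>2))"
    unfolding sumA using mult_left_mono[OF sumO, of "1 - \<theta>1"] mult_left_mono[OF sumZ B_nonneg] \<theta>1 by linarith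
  finally have avg: "(17 / 10 + \<theta>1) * (mm * (\<Phi> + gain / (mm - 1))) + (1 - \<theta>1) * (mm * S - loss) - mm * K
      - B * (mm * (z\<^sup>2 + y\<^sup>2 + 5 / (mm - 1)\<^sup>2))
    \<le> (\<Sum>u\<in>D. p u * dg_raw OPT k r MM e B (insert u X) Y + (1 - p u) * dg_raw OPT k r MM e B X (Y - {u}))" .
  have err: "11 * G * \<epsilon> + B * (mm * (5 / (mm - 1)\<^sup>2)) \<le> mm * e"
  proof -
    have "11 * G * \<epsilon> \<le> mm * (11 * G * \<epsilon> / MM)"
    proof -
      have "11 * G * \<epsilon> * MM \<le> 11 * G * \<epsilon> * mm" using G_nonneg \<epsilon> mm by (intro mult_left_mono) auto
      then show ?thesis using mm by (simp add: field_simps)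
    qed
    moreover have "5 / (mm - 1)\<^sup>2 \<le> 5 / MM\<^sup>2"
      using mm by (intro divide_left_mono power_mono) auto
    then have "B * (mm * (5 / (mm - 1)\<^sup>2)) \<le> B * (mm * (5 / MM\<^sup>2))"
      using B_nonneg mm by (intro mult_left_mono) auto
    ultimately show ?thesis unfolding e MM_def[symmetric] by (simp add: algebra_simps)
  qed
  have g1: "mm * (gain / (mm - 1)) \<ge> gain"
    using gain0 mm by (simp add: field_simps)
  have \<theta>rel: "mm * (MM / mm) = MM" "(mm - 1) * \<theta>1 = MM" using mm by (auto simp: \<theta>1_def)
  have gl: "S - \<Phi> \<le> gain + loss" unfolding S_def \<Phi>_def by (rule gain_loss[OF m])
  \<comment> \<open>Summed over the \<open>m\<close> choices of \<open>u\<close>, the weight passing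
    from \<open>S\<close> to \<open>\<Phi>\<close> is
    \<open>mm * \<theta>1 - MM = \<theta>1\<close>; \<open>gain_loss\<close> covers it.\<close>
  have key: "\<theta>1 * (\<Phi> - S + gain + loss) \<ge> 0" using \<theta>1 gl by (intro mult_nonneg_nonneg) auto
  have g2: "(17 / 10 + \<theta>1) * gain \<le> (17 / 10 + \<theta>1) * (mm * (gain / (mm - 1)))"
    using g1 \<theta>1 by (intro mult_left_mono) auto
  have expand: "(17 / 10 + \<theta>1) * (mm * (\<Phi> + gain / (mm - 1))) + (1 - \<theta>1) * (mm * S - loss) - mm * K
      - B * (mm * (z\<^sup>2 + y\<^sup>2 + 5 / (mm - 1)\<^sup>2))
    = mm * dg_raw OPT k r MM e B X Y
      + ((17 / 10 + \<theta>1) * (mm * (gain / (mm - 1))) - loss + \<theta>1 * (\<Phi> - S + loss) + mm * e - B * (mm * (5 / (mm - 1)\<^sup>2)))"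
  proof -
    have t: "mm * \<theta>1 = MM + \<theta>1" using \<theta>rel(2) by (simp add: algebra_simps)
    have l: "mm * ((17 / 10 + MM / mm) * \<Phi> + (1 - MM / mm) * S) = (17 / 10 * mm + MM) * \<Phi> + (mm - MM) * S"
      using mm by (simp add: field_simps)
    have r1: "(17 / 10 + \<theta>1) * (mm * \<Phi>) + (1 - \<theta>1) * (mm * S) = (17 / 10 * mm + mm * \<theta>1) * \<Phi> + (mm - mm * \<theta>1) * S"
      by (simp add: algebra_simps)
    show ?thesis
      unfolding raw K_def using l r1[unfolded t] by (simp add: algebra_simps)
  qed
  have "(17 / 10 + \<theta>1) * (mm * (gain / (mm - 1))) - loss + \<theta>1 * (\<Phi> - S + loss) + mm * e - B * (mm * (5 / (mm - 1)\<^sup>2)) \<ge> 0"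
    using g2 key lossb err by (simp add: distrib_left distrib_right)
  then have fin: "mm * dg_raw OPT k r MM e B X Y
    \<le> (\<Sum>u\<in>D. p u * dg_raw OPT k r MM e B (insert u X) Y + (1 - p u) * dg_raw OPT k r MM e B X (Y - {u}))"
    using avg unfolding expand by linarith
  also have "\<dots> \<le> (\<Sum>u\<in>D. p u * pot (insert u X) Y + (1 - p u) * pot X (Y - {u}))"
    unfolding MM_def
  proof (intro sum_mono add_mono mult_left_mono dg_pot_ge_raw)
    fix u assume u: "u \<in> D"
    show "M \<le> card (Y - insert u X)" "M \<le> card (Y - {u} - X)"
      using next_add[OF u] next_remove[OF u] mM by auto
  qed (use p M B_nonneg in auto)
  finally show ?thesis unfolding mm_def MM_def .
qed

text \<open>The truncation at 0 disposes of the states in which the penalty outweighs everything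
  else, so the deviations are controlled exactly where this matters.\<close>

lemma pot_step:
  "real m * pot X Y \<le> (\<Sum>u\<in>D. p u * pot (insert u X) Y + (1 - p u) * pot X (Y - {u}))"
proof (cases "m \<le> M")
  case True
  then show ?thesis by (rule pot_step_late)
next
  case False
  have pot0: "0 \<le> pot A C" for A C by (simp add: dg_pot_def)
  have sum0: "0 \<le> (\<Sum>u\<in>D. p u * pot (insert u X) Y + (1 - p u) * pot X (Y - {u}))"
    using p pot0 by (intro sum_nonneg add_nonneg_nonneg mult_nonneg_nonneg) auto
  show ?thesis
  proof (cases "0 < dg_raw OPT k r (real M) e B X Y")
    case True
    then show ?thesis using pot_step_early False by (simp add: dg_pot_def)
  next
    case neg: False
    then have "pot X Y = 0" using False by (simp add: dg_pot_def)
    then show ?thesis using sum0 by simp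
  qed
qed

end
end

section \<open>Double greedy with tokens: averaging, scale of the values, starting value\<close>

lemma exp_minus_1_le: "exp (- 1 :: real) \<le> 3682 / 10000"
proof -
  have "(1 + (1 / 16) + (1 / 16)\<^sup>2 / 2 :: real) \<le> exp (1 / 16)"
    by (rule exp_lower_Taylor_quadratic) simp
  then have "(1 + (1 / 16) + (1 / 16)\<^sup>2 / 2 :: real) ^ 16 \<le> exp (1 / 16) ^ 16"
    by (intro power_mono) auto
  also have "exp (1 / 16 :: real) ^ 16 = exp 1" by (simp add: exp_of_nat_mult[symmetric])
  finally have "10000 / 3682 \<le> exp (1 :: real)"
    by (rule order_trans[rotated]) (simp add: power2_eq_square eval_nat_numeral)
  then show ?thesis by (simp add: exp_minus field_simps)
qed

context nonneg_submodular
begin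

text \<open>This is the form that a program can realise: one uniform draw of a position in the
  sorted token list. With at least 4096 tokens per element, half a token is at most
  \<open>1 / 8192\<close>.\<close>

lemma dg_token_step:
  assumes XY: "X \<subseteq> Y" "Y \<subseteq> U" and k: "card X \<le> k" "k \<le> card Y" and ne: "X \<noteq> Y"
    and L: "4096 \<le> L" and r: "1 / 10 \<le> r" "r \<le> 9 / 10"
    and G: "\<And>A. A \<subseteq> U \<Longrightarrow> f A \<le> G"
    and \<epsilon>: "0 < \<epsilon>" "\<epsilon> \<le> 1 / 30000" and M: "1 \<le> M"
    and B: "B = 27 / 10 * G / \<epsilon>\<^sup>2" and e: "e = 11 * G * \<epsilon> / real M + 5 * B / (real M)\<^sup>2"
    and N: "N = card (Y - X) * L"
    and \<sigma>: "bij_betw \<sigma> {..<N} ((Y - X) \<times> {..<L})"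
    and sorted: "\<And>i i'. i < i' \<Longrightarrow> i' < N \<Longrightarrow> key (\<sigma> i) \<le> key (\<sigma> i')"
    and key: "key = (\<lambda>(u, j). (2 * real j + 1) * (f (insert u X) - f X + (f (Y - {u}) - f Y))
       - 2 * real L * (f (insert u X) - f X))"
  shows "real N * dg_pot OPT k r M e B X Y \<le> (\<Sum>i<N. if i < L * (k - card X)
     then dg_pot OPT k r M e B (insert (fst (\<sigma> i)) X) Y else dg_pot OPT k r M e B X (Y - {fst (\<sigma> i)}))"
proof -
  let ?D = "Y - X" and ?J = "L * (k - card X)"
  have fD: "finite ?D" and fX: "finite X" using XY finite_sub by auto
  have cD: "card ?D = card Y - card X" using XY fX by (simp add: card_Diff_subset)
  have L0: "0 < L" using L by simp
  have m: "0 < card ?D" using fD ne XY by (auto simp: card_gt_0_iff)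
  have J: "?J \<le> N" unfolding N cD using k by (simp add: mult.commute diff_le_mono)
  let ?p = "token_fraction \<sigma> L ?J"
  have sum_p: "(\<Sum>u\<in>?D. ?p u) = real (k - card X)"
    using sum_tokens[OF L0 fD \<sigma> J, of "\<lambda>_. 1"] L0 by simp
  interpret step: double_greedy_step U f X Y "OPT \<inter> ?D" ?p "k - card X"
    by unfold_locales (use XY token_fraction_bounds[OF L0] sum_p in auto)
  obtain \<theta> where \<theta>: "\<forall>u\<in>?D.
    (0 < ?p u \<longrightarrow> (?p u - 1 / (2 * real L)) * (f (insert u X) - f X + (f (Y - {u}) - f Y)) \<le> f (insert u X) - f X + \<theta>) \<and>
    (?p u < 1 \<longrightarrow> f (insert u X) - f X + \<theta> \<le> (?p u + 1 / (2 * real L)) * (f (insert u X) - f X + (f (Y - {u}) - f Y)))"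
    using token_threshold[OF L0 \<sigma> J _ key sorted step.ab_nonneg] m L0 N by auto
  have half: "1 / (2 * real L) \<le> 1 / real L" using L0 by (simp add: field_simps)
  interpret thr: double_greedy_threshold U f X Y "OPT \<inter> ?D" ?p "k - card X" \<theta> "1 / (2 * real L)"
  proof unfold_locales
    fix u assume "u \<in> ?D"
    show "0 < ?p u \<Longrightarrow> 1 / (2 * real L) \<le> ?p u"
      using token_fraction_gap(1)[OF L0, of \<sigma> ?J u] half by linarith
    show "?p u < 1 \<Longrightarrow> ?p u \<le> 1 - 1 / (2 * real L)"
      using token_fraction_gap(2)[OF L0, of \<sigma> ?J u] half by linarith
  next
    show "1 / (2 * real L) \<le> 1 / 8192" using L by (simp add: field_simps)
  qed (use \<theta> m in auto)
  have "real (card ?D) * dg_pot OPT k r M e B X Y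
     \<le> (\<Sum>u\<in>?D. ?p u * dg_pot OPT k r M e B (insert u X) Y + (1 - ?p u) * dg_pot OPT k r M e B X (Y - {u}))"
    by (rule thr.pot_step[OF refl _ r G \<epsilon> M B e]) (use k in auto)
  then have "real L * (real (card ?D) * dg_pot OPT k r M e B X Y)
     \<le> real L * (\<Sum>u\<in>?D. ?p u * dg_pot OPT k r M e B (insert u X) Y + (1 - ?p u) * dg_pot OPT k r M e B X (Y - {u}))"
    by (intro mult_left_mono) auto
  also have "\<dots> = (\<Sum>i<N. if i < ?J
     then dg_pot OPT k r M e B (insert (fst (\<sigma> i)) X) Y else dg_pot OPT k r M e B X (Y - {fst (\<sigma> i)}))"
    using sum_tokens_split[OF L0 fD \<sigma> J, of "\<lambda>u. dg_pot OPT k r M e B (insert u X) Y" "\<lambda>u. dg_pot OPT k r M e B X (Y - {u})"]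
    by simp
  finally show ?thesis unfolding N by (simp add: mult_ac)
qed

text \<open>The errors of the potential scale with the largest value of \<open>f\<close> on
  arbitrary sets, so this must be comparable with the optimum over \<open>k\<close>-sets. Enlarging
  or thinning \<open>A\<close> to size \<open>k\<close> by \<open>padding\<close> costs at most a
  factor 10, as \<open>k\<close> and \<open>card U - k\<close> are at least a tenth of
  \<open>card U\<close>.\<close>

lemma bounded_by_opt:
  assumes k: "card U \<le> 10 * k" "card U \<le> 10 * (card U - k)" "k \<le> card U"
    and P: "\<And>S. S \<subseteq> U \<Longrightarrow> card S = k \<Longrightarrow> f S \<le> P" and A: "A \<subseteq> U"
  shows "f A \<le> 10 * P"
proof (cases "card A \<le> k")
  case True
  let ?R = "U - A" and ?q = "k - card A"
  have fA: "finite A" using A finite_sub by auto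
  have cR: "card ?R = card U - card A" using A fA by (simp add: card_Diff_subset)
  obtain Q where Q: "Q \<subseteq> ?R" "card Q = ?q"
    "real (card ?R) * f (A \<union> Q) \<ge> real (card ?R - ?q) * f A + real ?q * f (A \<union> ?R)"
    using padding[of A ?R ?q] A k(3) cR diff_le_mono[OF k(3)] by auto
  have "finite Q" using Q finite_sub finite_subset by (metis Diff_subset)
  then have "card (A \<union> Q) = k" using Q fA True by (subst card_Un_disjoint) auto
  then have fP: "f (A \<union> Q) \<le> P" using Q A by (intro P) auto
  have "card ?R - ?q = card U - k" unfolding cR using True by simp
  moreover have "0 \<le> real ?q * f (A \<union> ?R)" using nonneg[of "A \<union> ?R"] A by auto
  ultimately have "real (card U - k) * f A \<le> real (card ?R) * f (A \<union> Q)" using Q(3) by simp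
  also have "\<dots> \<le> real (10 * (card U - k)) * f (A \<union> Q)"
    using k cR Q A nonneg[of "A \<union> Q"] by (intro mult_right_mono) auto
  finally have le: "real (card U - k) * f A \<le> real (card U - k) * (10 * f (A \<union> Q))" by simp
  show ?thesis
  proof (cases "card U - k = 0")
    case True
    then have "U = {}" using k finite_ground by simp
    then have "A = {}" "k = 0" using A k by auto
    then show ?thesis using P[of "{}"] nonneg[of "{}"] by auto
  next
    case False
    then have "f A \<le> 10 * f (A \<union> Q)" using le by simp
    then show ?thesis using fP by simp
  qed
next
  case False
  have fA: "finite A" using A finite_sub by auto
  obtain Q where Q: "Q \<subseteq> A" "card Q = k"
    "real (card A) * f ({} \<union> Q) \<ge> real (card A - k) * f {} + real k * f ({} \<union> A)"
    using padding[of "{}" A k] A False by auto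
  have fP: "f Q \<le> P" using Q A by (intro P) auto
  have "card A \<le> card U" using A finite_ground card_mono by blast
  have kpos: "0 < k" using k False A \<open>card A \<le> card U\<close> by linarith
  have "0 \<le> real (card A - k) * f {}" using nonneg[of "{}"] by simp
  then have "real k * f A \<le> real (card A) * f Q" using Q(3) by simp
  also have "\<dots> \<le> real (10 * k) * f Q"
    using k \<open>card A \<le> card U\<close> nonneg[of Q] Q A by (intro mult_right_mono) auto
  finally have "real k * f A \<le> real k * (10 * f Q)" by simp
  then show ?thesis using kpos fP by simp
qed

text \<open>Both deviations are 0 at the start, so the value is at least
  \<open>(1 - M / n) * P\<close> minus the accumulated errors. \<open>M\<close> near
  \<open>n / 500\<close> costs about 1/500; over \<open>n\<close> steps the first part of
  \<open>e\<close> costs \<open>55 / 10^5\<close> and the second \<open>3375 * 10^20 / n\<close>.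
  More than 0.997 remains, against \<open>27 / 10 * 0.3682 < 0.995\<close>. The constant
  \<open>10^24\<close> dominates the terms in \<open>1 / n\<close> and makes the claim trivial for
  smaller \<open>n\<close>.\<close>

lemma dg_pot_start:
  fixes n :: nat
  assumes n: "card U = n" "1 \<le> n" and OPT: "OPT \<subseteq> U" "card OPT = k"
    and P: "P = f OPT" and r: "r = real k / real n" and k: "k \<le> n"
    and M: "M = n div 500 + 1"
    and B: "B = 27 / 10 * (10 * P) / (1 / 10 ^ 8)\<^sup>2"
    and e: "e = 11 * (10 * P) * (1 / 10 ^ 8) / real M + 5 * B / (real M)\<^sup>2"
  shows "27 / 10 * ((exp (- 1) - 10 ^ 24 / real n) * P) \<le> dg_pot OPT k r M e B {} U"
proof -
  have P0: "0 \<le> P" using P OPT nonneg by simp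
  have pot0: "0 \<le> dg_pot OPT k r M e B {} U" by (simp add: dg_pot_def)
  note exp_bd = exp_minus_1_le
  show ?thesis
  proof (cases "n \<le> 10 ^ 24")
    case True
    then have "1 \<le> 10 ^ 24 / real n" using n by (simp add: field_simps)
    then have "exp (- 1) - 10 ^ 24 / real n \<le> 0" using exp_bd by simp
    then have "(exp (- 1) - 10 ^ 24 / real n) * P \<le> 0" using P0 by (intro mult_nonpos_nonneg)
    then have "27 / 10 * ((exp (- 1) - 10 ^ 24 / real n) * P) \<le> 0" by (simp add: mult.commute)
    then show ?thesis using pot0 by (rule order_trans)
  next
    case False
    then have nb: "10 ^ 24 < real n" by simp
    have M1: "1 \<le> M" "M \<le> n" using M False by (auto simp: div_le_dividend le_Suc_eq)
    define x where "x = 1 / real n"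
    have x: "0 < x" "x < 1 / 10 ^ 24" using nb n unfolding x_def by (auto simp: field_simps)
    have "n < 500 * M" unfolding M using dividend_less_times_div[of 500 n] by simp
    then have nM: "real n \<le> 500 * real M" by linarith
    have "500 * M \<le> n + 500" unfolding M by simp
    then have "500 * real M \<le> real n + 500" by linarith
    then have Mn: "real M / real n \<le> 1 / 500 + x" using n unfolding x_def by (simp add: field_simps)
    have OU: "OPT \<inter> U = OPT" using OPT by auto
    have raw: "dg_raw OPT k r (real M) e B {} U
       = (17 / 10 + real M / real n) * mix r {} U + (1 - real M / real n) * P - (real n - real M) * e"
      unfolding dg_raw_def Let_def using OU OPT n by (simp add: P r)
    have r01: "0 \<le> r" "r \<le> 1" unfolding r using k n by auto
    have "0 \<le> mix r {} U" unfolding mix_def using r01 nonneg[of "{}"] nonneg[of U] by auto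
    then have t1: "0 \<le> (17 / 10 + real M / real n) * mix r {} U" by simp
    have t2: "(1 - (1 / 500 + x)) * P \<le> (1 - real M / real n) * P"
      using Mn P0 by (intro mult_right_mono) auto
    have B0: "0 \<le> B" unfolding B using P0 by simp
    have e0: "0 \<le> e" unfolding e using P0 B0 by simp
    have t3: "(real n - real M) * e \<le> real n * e" using e0 by (intro mult_right_mono) auto
    have "real n / real M \<le> 500" using nM M1 by (simp add: field_simps)
    have "1 / real M \<le> 500 * x" using nM M1 n unfolding x_def by (simp add: field_simps)
    have "real n * e = 110 * P / 10 ^ 8 * (real n / real M) + 5 * B * ((real n / real M) * (1 / real M))"
      unfolding e by (simp add: power2_eq_square field_simps)
    also have "\<dots> \<le> 110 * P / 10 ^ 8 * 500 + 5 * B * (500 * (500 * x))"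
      using P0 B0 \<open>real n / real M \<le> 500\<close> \<open>1 / real M \<le> 500 * x\<close>
      by (intro add_mono mult_left_mono mult_mono) auto
    also have "\<dots> = (55 / 10 ^ 5 + 3375 * 10 ^ 20 * x) * P"
      unfolding B by (simp add: field_simps power2_eq_square)
    finally have t4: "real n * e \<le> (55 / 10 ^ 5 + 3375 * 10 ^ 20 * x) * P" .
    have "27 / 10 * ((exp (- 1) - 10 ^ 24 * x) * P) \<le> 27 / 10 * ((3682 / 10000 - 10 ^ 24 * x) * P)"
      using exp_bd P0 by (intro mult_left_mono mult_right_mono) auto
    also have "\<dots> = (27 / 10 * (3682 / 10000 - 10 ^ 24 * x)) * P" by simp
    also have "\<dots> \<le> ((1 - (1 / 500 + x)) - (55 / 10 ^ 5 + 3375 * 10 ^ 20 * x)) * P"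
      using x P0 by (intro mult_right_mono) (auto simp: field_simps)
    also have "\<dots> \<le> dg_raw OPT k r (real M) e B {} U"
      unfolding raw left_diff_distrib[of "1 - (1 / 500 + x)"] using t1 t2 t3 t4 by linarith
    also have "\<dots> \<le> dg_pot OPT k r M e B {} U"
      using n M1 B0 by (intro dg_pot_ge_raw) auto
    finally show ?thesis unfolding x_def by simp
  qed
qed

end

section \<open>Random greedy\<close>

text \<open>Let \<open>\<theta>\<close> be the \<open>k\<close>-th largest value. Weight missing on
  the first \<open>k\<close> places is worth at least \<open>\<theta>\<close> per unit, weight
  placed behind them at most \<open>\<theta>\<close>, and the two amounts are equal.\<close>

lemma top_sum:
  fixes g w :: "'a \<Rightarrow> real"
  assumes \<sigma>: "bij_betw \<sigma> {..<N} E" and k: "k \<le> N"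
    and sorted: "\<And>i i'. i < i' \<Longrightarrow> i' < N \<Longrightarrow> g (\<sigma> i') \<le> g (\<sigma> i)"
    and w: "\<And>u. u \<in> E \<Longrightarrow> 0 \<le> w u" "\<And>u. u \<in> E \<Longrightarrow> w u \<le> 1"
    and sum_w: "(\<Sum>u\<in>E. w u) = real k"
  shows "(\<Sum>u\<in>E. w u * g u) \<le> (\<Sum>i<k. g (\<sigma> i))"
proof (cases "k = 0")
  case True
  have fE: "finite E" using \<sigma> bij_betw_finite by auto
  have "w u = 0" if "u \<in> E" for u
    using sum_w True w(1) that fE by (simp add: sum_nonneg_eq_0_iff)
  then show ?thesis using True by simp
next
  case False
  define \<theta> where "\<theta> = g (\<sigma> (k - 1))"
  have in_E: "\<sigma> i \<in> E" if "i < N" for i using \<sigma> that by (auto simp: bij_betw_def)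
  have split: "(\<Sum>u\<in>E. h u) = (\<Sum>i<k. h (\<sigma> i)) + (\<Sum>i\<in>{k..<N}. h (\<sigma> i))" for h :: "'a \<Rightarrow> real"
  proof -
    have "(\<Sum>u\<in>E. h u) = (\<Sum>i<N. h (\<sigma> i))" using sum.reindex_bij_betw[OF \<sigma>, of h] by simp
    also have "{..<N} = {..<k} \<union> {k..<N}" using k by auto
    also have "(\<Sum>i\<in>{..<k} \<union> {k..<N}. h (\<sigma> i)) = (\<Sum>i<k. h (\<sigma> i)) + (\<Sum>i\<in>{k..<N}. h (\<sigma> i))"
      by (intro sum.union_disjoint) auto
    finally show ?thesis .
  qed
  have "w (\<sigma> i) * g (\<sigma> i) \<le> g (\<sigma> i) - (1 - w (\<sigma> i)) * \<theta>" if "i < k" for i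
  proof -
    have "\<theta> \<le> g (\<sigma> i)"
      using sorted[of i "k - 1"] that k False unfolding \<theta>_def by (cases "i = k - 1") auto
    then have "(1 - w (\<sigma> i)) * \<theta> \<le> (1 - w (\<sigma> i)) * g (\<sigma> i)"
      using w(2)[OF in_E] that k by (intro mult_left_mono) auto
    then show ?thesis by (simp add: algebra_simps)
  qed
  then have 1: "(\<Sum>i<k. w (\<sigma> i) * g (\<sigma> i)) \<le> (\<Sum>i<k. g (\<sigma> i) - (1 - w (\<sigma> i)) * \<theta>)"
    by (intro sum_mono) auto
  have "w (\<sigma> i) * g (\<sigma> i) \<le> w (\<sigma> i) * \<theta>" if "i \<in> {k..<N}" for i
    using sorted[of "k - 1" i] that False w(1)[OF in_E] unfolding \<theta>_def by (intro mult_left_mono) auto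
  then have 2: "(\<Sum>i\<in>{k..<N}. w (\<sigma> i) * g (\<sigma> i)) \<le> (\<Sum>i\<in>{k..<N}. w (\<sigma> i) * \<theta>)"
    by (rule sum_mono)
  have "(\<Sum>i<k. g (\<sigma> i) - (1 - w (\<sigma> i)) * \<theta>) + (\<Sum>i\<in>{k..<N}. w (\<sigma> i) * \<theta>)
     = (\<Sum>i<k. g (\<sigma> i)) - real k * \<theta> + ((\<Sum>i<k. w (\<sigma> i)) + (\<Sum>i\<in>{k..<N}. w (\<sigma> i))) * \<theta>"
    by (simp add: left_diff_distrib sum_subtractf sum.distrib sum_distrib_right distrib_right)
  also have "\<dots> = (\<Sum>i<k. g (\<sigma> i))" using sum_w split[of w] by simp
  finally show ?thesis using 1 2 split[of "\<lambda>u. w u * g u"] by linarith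
qed

text \<open>This replaces dummy elements: the places that \<open>A\<close> leaves free are spread
  evenly over \<open>R\<close>, as a layer of density \<open>(k - card A) / card R\<close>.\<close>

lemma two_level_top_sum:
  fixes g :: "'a \<Rightarrow> real"
  assumes \<sigma>: "bij_betw \<sigma> {..<N} E" and k: "k \<le> N"
    and sorted: "\<And>i i'. i < i' \<Longrightarrow> i' < N \<Longrightarrow> g (\<sigma> i') \<le> g (\<sigma> i)"
    and A: "A \<subseteq> E" "R \<subseteq> E" "A \<inter> R = {}" "card A \<le> k" "k \<le> card R"
  shows "\<exists>a. 0 \<le> a \<and> a \<le> real k / real (card R) \<and>
     (\<Sum>u\<in>A. g u) + a * (\<Sum>u\<in>R. g u) \<le> (\<Sum>i<k. g (\<sigma> i))"
proof -
  define a where "a = real (k - card A) / real (card R)"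
  define w where "w u = (if u \<in> A then 1 else if u \<in> R then a else 0)" for u
  have fE: "finite E" using \<sigma> bij_betw_finite by auto
  have a: "0 \<le> a" "a \<le> 1" "a \<le> real k / real (card R)"
    using A unfolding a_def by (auto simp: divide_le_eq intro: divide_right_mono)
  have eq: "(\<Sum>u\<in>E. w u * h u) = (\<Sum>u\<in>A. h u) + a * (\<Sum>u\<in>R. h u)" for h :: "'a \<Rightarrow> real"
  proof -
    have "(\<Sum>u\<in>E. w u * h u) = (\<Sum>u\<in>A \<union> R. w u * h u)"
      using fE A by (intro sum.mono_neutral_right) (auto simp: w_def)
    also have "\<dots> = (\<Sum>u\<in>A. w u * h u) + (\<Sum>u\<in>R. w u * h u)"
      using A fE finite_subset by (intro sum.union_disjoint) auto
    also have "(\<Sum>u\<in>A. w u * h u) = (\<Sum>u\<in>A. h u)" by (intro sum.cong) (auto simp: w_def)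
    also have "(\<Sum>u\<in>R. w u * h u) = a * (\<Sum>u\<in>R. h u)"
      unfolding sum_distrib_left using A by (intro sum.cong) (auto simp: w_def)
    finally show ?thesis .
  qed
  have "(\<Sum>u\<in>E. w u * 1) = real (card A) + a * real (card R)" using eq[of "\<lambda>_. 1"] by simp
  also have "\<dots> = real k"
  proof (cases "card R = 0")
    case False
    then show ?thesis using A by (simp add: a_def of_nat_diff)
  qed (use A in auto)
  finally have "(\<Sum>u\<in>E. w u) = real k" by simp
  then have "(\<Sum>u\<in>E. w u * g u) \<le> (\<Sum>i<k. g (\<sigma> i))"
    using a by (intro top_sum[OF \<sigma> k, of g w] sorted) (auto simp: w_def)
  then show ?thesis using eq a by metis
qed

section \<open>Damage done by added elements; local optima under swaps\<close>

context nonneg_submodular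
begin

lemma union_submodular:
  assumes "V \<subseteq> U" shows "nonneg_submodular U (\<lambda>S. f (V \<union> S))"
proof
  show "submodular_on U (\<lambda>S. f (V \<union> S))"
    unfolding submodular_on_def
  proof (intro allI impI)
    fix A B assume AB: "A \<subseteq> U" "B \<subseteq> U"
    have "V \<union> (A \<union> B) = (V \<union> A) \<union> (V \<union> B)" "V \<union> (A \<inter> B) = (V \<union> A) \<inter> (V \<union> B)" by auto
    then show "f (V \<union> (A \<union> B)) + f (V \<union> (A \<inter> B)) \<le> f (V \<union> A) + f (V \<union> B)"
      using submod[of "V \<union> A" "V \<union> B"] assms AB by auto
  qed
qed (use assms in \<open>auto simp: nonneg_on_def finite_ground intro: nonneg\<close>)

text \<open>The worst effect that added elements of \<open>W\<close> can have on the union with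
  \<open>V\<close>. Unlike a value for one particular layer it is again a submodular function of
  \<open>S\<close>, and can be followed through the rounds.\<close>

definition worst_union :: "'a set \<Rightarrow> 'a set \<Rightarrow> 'a set \<Rightarrow> real" where
  "worst_union V W S = Min ((\<lambda>R. f (V \<union> S \<union> R)) ` Pow W)"

lemma worst_union_le:
  assumes "W \<subseteq> U" "R \<subseteq> W"
  shows "worst_union V W S \<le> f (V \<union> S \<union> R)"
  unfolding worst_union_def using assms finite_sub by (intro Min_le) auto

lemma worst_union_attained:
  assumes "W \<subseteq> U"
  obtains R where "R \<subseteq> W" "worst_union V W S = f (V \<union> S \<union> R)"
proof -
  have "worst_union V W S \<in> (\<lambda>R. f (V \<union> S \<union> R)) ` Pow W"
    unfolding worst_union_def using assms finite_sub by (intro Min_in) auto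
  then show ?thesis using that by auto
qed

text \<open>Partial minimisation. The intersection of \<open>V \<union> A \<union> R\<close> and
  \<open>V \<union> B \<union> Q\<close> exceeds \<open>V \<union> (A \<inter> B)\<close> also by
  the mixed parts \<open>A \<inter> Q\<close> and \<open>R \<inter> B\<close>, which lie in
  \<open>W\<close> and so are admissible.\<close>

lemma worst_union_submodular:
  assumes V: "V \<subseteq> U" and W: "W \<subseteq> U"
  shows "nonneg_submodular U (worst_union V W)"
proof
  show "submodular_on U (worst_union V W)"
    unfolding submodular_on_def
  proof (intro allI impI)
    fix A B assume AB: "A \<subseteq> U" "B \<subseteq> U"
    obtain R where R: "R \<subseteq> W" "worst_union V W A = f (V \<union> A \<union> R)" using worst_union_attained[OF W] .
    obtain Q where Q: "Q \<subseteq> W" "worst_union V W B = f (V \<union> B \<union> Q)" using worst_union_attained[OF W] .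
    have e1: "(V \<union> A \<union> R) \<union> (V \<union> B \<union> Q) = V \<union> (A \<union> B) \<union> (R \<union> Q)" by auto
    have e2: "(V \<union> A \<union> R) \<inter> (V \<union> B \<union> Q) = V \<union> (A \<inter> B) \<union> (A \<inter> Q \<union> R \<inter> B \<union> R \<inter> Q)" by auto
    have "worst_union V W (A \<union> B) \<le> f (V \<union> (A \<union> B) \<union> (R \<union> Q))"
      using R Q by (intro worst_union_le[OF W]) auto
    moreover have "worst_union V W (A \<inter> B) \<le> f (V \<union> (A \<inter> B) \<union> (A \<inter> Q \<union> R \<inter> B \<union> R \<inter> Q))"
      using R Q by (intro worst_union_le[OF W]) auto
    moreover have "f (V \<union> (A \<union> B) \<union> (R \<union> Q)) + f (V \<union> (A \<inter> B) \<union> (A \<inter> Q \<union> R \<inter> B \<union> R \<inter> Q))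
        \<le> f (V \<union> A \<union> R) + f (V \<union> B \<union> Q)"
      using submod[of "V \<union> A \<union> R" "V \<union> B \<union> Q"] V W AB R Q unfolding e1 e2 by auto
    ultimately show "worst_union V W (A \<union> B) + worst_union V W (A \<inter> B) \<le> worst_union V W A + worst_union V W B"
      using R Q by linarith
  qed
  show "nonneg_on U (worst_union V W)"
    unfolding nonneg_on_def
  proof (intro allI impI)
    fix S assume S: "S \<subseteq> U"
    obtain R where R: "R \<subseteq> W" "worst_union V W S = f (V \<union> S \<union> R)" using worst_union_attained[OF W] .
    show "0 \<le> worst_union V W S" unfolding R(2) using V W R(1) S by (intro nonneg) auto
  qed
qed (rule finite_ground)

lemma sum_insert_ge:
  assumes \<sigma>: "inj_on \<sigma> {..<k}" "\<sigma> ` {..<k} \<subseteq> U" and S: "S \<subseteq> U"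
  shows "(real k - 1) * f S + f (S \<union> \<sigma> ` {..<k}) \<le> (\<Sum>i<k. f (insert (\<sigma> i) S))"
proof -
  have "f (S \<union> \<sigma> ` {..<k}) - f S \<le> (\<Sum>u\<in>\<sigma> ` {..<k}. f (insert u S) - f S)"
    using \<sigma> S by (intro sum_marginals_add) auto
  also have "\<dots> = (\<Sum>i<k. f (insert (\<sigma> i) S)) - real k * f S"
    using \<sigma> by (simp add: sum.reindex sum_subtractf card_image)
  finally show ?thesis by (simp add: algebra_simps)
qed

text \<open>Local optimality is summed over all pairs from
  \<open>(Z - OPT) \<times> (OPT - Z)\<close>. Both factors have the same size \<open>d\<close>, so
  every single insertion and removal occurs \<open>d\<close> times, and dividing by \<open>d\<close>
  leaves a sum of marginals of at most \<open>d * \<delta>\<close>.\<close>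

lemma swap_local_optimum:
  assumes Z: "Z \<subseteq> U" "card Z = k" and OPT: "OPT \<subseteq> U" "card OPT = k" and \<delta>: "0 \<le> \<delta>"
    and local: "\<And>u v. u \<in> Z \<Longrightarrow> v \<in> U - Z \<Longrightarrow> f (insert v (Z - {u})) \<le> f Z + \<delta>"
  shows "f (OPT \<union> Z) + f (OPT \<inter> Z) \<le> 2 * f Z + real k * \<delta>"
proof -
  let ?A = "Z - OPT" and ?B = "OPT - Z"
  have fin: "finite Z" "finite OPT" using Z OPT finite_sub by auto
  have "card ?A = card Z - card (OPT \<inter> Z)" "card ?B = card OPT - card (OPT \<inter> Z)"
    using fin by (simp_all add: card_Diff_subset_Int Int_commute)
  then have d: "card ?A = card ?B" using Z OPT by simp
  define d where "d = real (card ?A)"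
  have dk: "d \<le> real k" unfolding d_def using Z fin card_mono[of Z ?A] by auto
  have 1: "f (Z \<union> ?B) - f Z \<le> (\<Sum>v\<in>?B. f (insert v Z) - f Z)"
    using Z OPT by (intro sum_marginals_add) auto
  have 2: "f (Z - ?A) - f Z \<le> (\<Sum>u\<in>?A. f (Z - {u}) - f Z)"
    using Z OPT by (intro sum_marginals_remove) auto
  have eq: "Z \<union> ?B = OPT \<union> Z" "Z - ?A = OPT \<inter> Z" by auto
  have "(f (insert v Z) - f Z) + (f (Z - {u}) - f Z) \<le> \<delta>" if "u \<in> ?A" "v \<in> ?B" for u v
  proof -
    have e: "insert v (Z - {u}) \<union> Z = insert v Z" "insert v (Z - {u}) \<inter> Z = Z - {u}" using that by auto
    have "f (insert v Z) + f (Z - {u}) \<le> f (insert v (Z - {u})) + f Z"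
      using submod[of "insert v (Z - {u})" Z] Z OPT that unfolding e by auto
    moreover have "f (insert v (Z - {u})) \<le> f Z + \<delta>" using that OPT by (intro local) auto
    ultimately show ?thesis by linarith
  qed
  then have "(\<Sum>u\<in>?A. \<Sum>v\<in>?B. (f (insert v Z) - f Z) + (f (Z - {u}) - f Z)) \<le> (\<Sum>u\<in>?A. \<Sum>v\<in>?B. \<delta>)"
    by (intro sum_mono) auto
  then have "d * (\<Sum>v\<in>?B. f (insert v Z) - f Z) + d * (\<Sum>u\<in>?A. f (Z - {u}) - f Z) \<le> d * (d * \<delta>)"
    by (simp only: sum.distrib sum_constant d[symmetric] d_def sum_distrib_left[symmetric])
  then have *: "d * ((\<Sum>v\<in>?B. f (insert v Z) - f Z) + (\<Sum>u\<in>?A. f (Z - {u}) - f Z)) \<le> d * (d * \<delta>)"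
    by (simp only: distrib_left)
  show ?thesis
  proof (cases "d = 0")
    case True
    then have "card ?A = 0" "card ?B = 0" using d unfolding d_def by auto
    then have "?A = {}" "?B = {}" using fin by (simp_all only: card_0_eq finite_Diff)
    then have "OPT = Z" by auto
    then show ?thesis using \<delta> by simp
  next
    case False
    then have "0 < d" unfolding d_def by simp
    then have "(\<Sum>v\<in>?B. f (insert v Z) - f Z) + (\<Sum>u\<in>?A. f (Z - {u}) - f Z) \<le> d * \<delta>"
      using * by simp
    moreover have "d * \<delta> \<le> real k * \<delta>" using dk \<delta> by (intro mult_right_mono)
    ultimately show ?thesis using 1 2 unfolding eq by linarith
  qed
qed

end

section \<open>Random greedy whose first \<open>s\<close> rounds avoid a given set\<close>

locale aided_greedy = nonneg_submodular +
  fixes OPT Z :: "'a set" and k s :: nat and a :: real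
  assumes OPT: "OPT \<subseteq> U" "card OPT = k" and Z: "Z \<subseteq> U" "card Z = k"
    and k: "1 \<le> k" "4 * k \<le> card U"
    and a: "real k / real (card U - 3 * k) \<le> a" "a \<le> 1"
    and s: "s \<le> k"
begin

abbreviation "h S \<equiv> f (OPT \<union> S)"
abbreviation "g \<equiv> worst_union OPT (U - Z)"
text \<open>\<open>f OPT - \<alpha>\<close> is what the union of \<open>OPT\<close> with a set
  avoiding \<open>Z\<close> is guaranteed to be worth; the minimum keeps this nonnegative.\<close>

definition "\<alpha> = min (f (OPT \<union> Z)) (f OPT)"
definition "\<beta> = f (OPT \<inter> Z)"
definition "lam = 1 - 1 / real k"

lemma h_submodular: "nonneg_submodular U h" by (rule union_submodular[OF OPT(1)])

lemma g_submodular: "nonneg_submodular U g" by (intro worst_union_submodular OPT) auto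

lemma g_le_h: "g S \<le> h S" using worst_union_le[of "U - Z" "{}" OPT S] by auto

lemma a_nonneg: "0 \<le> a" using a(1) by (meson divide_nonneg_nonneg of_nat_0_le_iff order_trans)

lemma beta_nonneg: "0 \<le> \<beta>" unfolding \<beta>_def using OPT by (intro nonneg) auto

lemma lam_bounds: "0 \<le> lam" "lam \<le> 1" "real k * lam = real k - 1"
  using k by (auto simp: lam_def field_simps)

text \<open>A set disjoint from \<open>Z\<close> meets \<open>OPT \<union> Z\<close> only inside
  \<open>OPT\<close>. Elements that damage the optimum when added therefore cannot act on both
  \<open>OPT \<union> S\<close> and \<open>OPT \<union> Z\<close> without lowering
  \<open>f OPT\<close>.\<close>

lemma union_ge:
  assumes "S \<subseteq> U" "S \<inter> Z = {}"
  shows "f OPT - \<alpha> \<le> h S"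
proof -
  have e: "(OPT \<union> S) \<inter> (OPT \<union> Z) = OPT" using assms by auto
  have "f (OPT \<union> S \<union> (OPT \<union> Z)) + f OPT \<le> f (OPT \<union> S) + f (OPT \<union> Z)"
    using submod[of "OPT \<union> S" "OPT \<union> Z"] assms OPT Z unfolding e by auto
  moreover have "0 \<le> f (OPT \<union> S \<union> (OPT \<union> Z))" "0 \<le> f (OPT \<union> S)"
    using assms OPT Z by (auto intro!: nonneg)
  ultimately show ?thesis unfolding \<alpha>_def by (auto simp: min_def)
qed

lemma g_ge:
  assumes "S \<subseteq> U" "S \<inter> Z = {}"
  shows "f OPT - \<alpha> \<le> g S"
proof -
  have "U - Z \<subseteq> U" by auto
  then obtain R where R: "R \<subseteq> U - Z" "g S = f (OPT \<union> S \<union> R)" using worst_union_attained by blast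
  have "f OPT - \<alpha> \<le> h (S \<union> R)" using assms R by (intro union_ge) auto
  then show ?thesis using R by (simp add: Un_assoc)
qed

lemma rest_card:
  assumes "S \<subseteq> U" "card S \<le> k"
  shows "card U - 3 * k \<le> card (U - (Z \<union> OPT \<union> S))"
proof -
  have fin: "finite (Z \<union> OPT \<union> S)" using assms OPT Z finite_sub by auto
  have "card (Z \<union> OPT \<union> S) \<le> card Z + card OPT + card S"
    using card_Un_le[of "Z \<union> OPT" S] card_Un_le[of Z OPT] by linarith
  then have "card (Z \<union> OPT \<union> S) \<le> 3 * k" using OPT Z assms by simp
  moreover have "card (U - (Z \<union> OPT \<union> S)) = card U - card (Z \<union> OPT \<union> S)"
    using fin assms OPT Z by (intro card_Diff_subset) auto
  ultimately show ?thesis by simp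
qed

text \<open>The layer covers everything outside \<open>Z\<close>, \<open>OPT\<close> and the current
  set, three sets of at most \<open>k\<close> elements each. This is the origin of
  \<open>card U - 3 * k\<close> and of the density bound \<open>a\<close>.\<close>

lemma fraction_le:
  assumes "S \<subseteq> U" "card S \<le> k" "b \<le> real k / real (card (U - (Z \<union> OPT \<union> S)))"
  shows "b \<le> a"
proof -
  have "0 < card U - 3 * k" using k by linarith
  then have "real k / real (card (U - (Z \<union> OPT \<union> S))) \<le> real k / real (card U - 3 * k)"
    using rest_card[OF assms(1,2)] by (intro divide_left_mono mult_pos_pos) auto
  then show ?thesis using assms(3) a(1) by (meson order_trans)
qed

text \<open>The sum compared with is a convex combination of two increments from \<open>S\<close>:
  to \<open>OPT \<union> S\<close>, and to the union of this with the whole layer. The layer avoids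
  \<open>Z\<close>, so the second target is worth at least \<open>g S\<close>.\<close>

lemma free_step:
  assumes S: "S \<subseteq> U" "card S \<le> k" and \<sigma>: "bij_betw \<sigma> {..<N} (U - S)" and N: "k \<le> N"
    and sorted: "\<And>i i'. i < i' \<Longrightarrow> i' < N \<Longrightarrow> f (insert (\<sigma> i') S) \<le> f (insert (\<sigma> i) S)"
  shows "(real k - 1) * f S + ((1 - a) * h S + a * g S) \<le> (\<Sum>i<k. f (insert (\<sigma> i) S))"
proof -
  let ?R = "U - (Z \<union> OPT \<union> S)" and ?m = "\<lambda>u. f (insert u S) - f S"
  have kR: "k \<le> card ?R" using rest_card[OF S] k by linarith
  have cO: "card (OPT - S) \<le> k" using OPT card_mono[of OPT "OPT - S"] finite_sub[OF OPT(1)] by auto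
  have sorted': "?m (\<sigma> i') \<le> ?m (\<sigma> i)" if "i < i'" "i' < N" for i i' using sorted[OF that] by simp
  have sub: "OPT - S \<subseteq> U - S" "?R \<subseteq> U - S" "(OPT - S) \<inter> ?R = {}" using OPT by auto
  obtain b where b: "0 \<le> b" "b \<le> real k / real (card ?R)"
     "(\<Sum>u\<in>OPT - S. ?m u) + b * (\<Sum>u\<in>?R. ?m u) \<le> (\<Sum>i<k. ?m (\<sigma> i))"
    using two_level_top_sum[where g = ?m, OF \<sigma> N sorted' sub cO kR] by auto
  have ba: "b \<le> a" using fraction_le[OF S b(2)] .
  then have b1: "b \<le> 1" using a by linarith
  have m1: "h S - f S \<le> (\<Sum>u\<in>OPT - S. ?m u)"
    using sum_marginals_add[of S "OPT - S"] S OPT by (auto simp: Un_commute)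
  have m2: "f (OPT \<union> S \<union> ?R) - f S \<le> (\<Sum>u\<in>OPT - S. ?m u) + (\<Sum>u\<in>?R. ?m u)"
  proof -
    have fin: "finite (OPT - S)" "finite ?R" using OPT finite_sub by auto
    have e: "S \<union> ((OPT - S) \<union> ?R) = OPT \<union> S \<union> ?R" by auto
    have "f (S \<union> ((OPT - S) \<union> ?R)) - f S \<le> (\<Sum>u\<in>(OPT - S) \<union> ?R. ?m u)"
      using S OPT by (intro sum_marginals_add) auto
    also have "\<dots> = (\<Sum>u\<in>OPT - S. ?m u) + (\<Sum>u\<in>?R. ?m u)"
      using fin by (intro sum.union_disjoint) auto
    finally show ?thesis unfolding e .
  qed
  have "g S \<le> f (OPT \<union> S \<union> ?R)" by (rule worst_union_le) auto
  then have m3: "g S - f S \<le> (\<Sum>u\<in>OPT - S. ?m u) + (\<Sum>u\<in>?R. ?m u)" using m2 by linarith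
  have "(1 - b) * (h S - f S) + b * (g S - f S)
     \<le> (1 - b) * (\<Sum>u\<in>OPT - S. ?m u) + b * ((\<Sum>u\<in>OPT - S. ?m u) + (\<Sum>u\<in>?R. ?m u))"
    using b b1 by (intro add_mono mult_left_mono m1 m3) auto
  also have "\<dots> = (\<Sum>u\<in>OPT - S. ?m u) + b * (\<Sum>u\<in>?R. ?m u)" by (simp add: distrib_left left_diff_distrib)
  also have "\<dots> \<le> (\<Sum>i<k. ?m (\<sigma> i))" by (rule b(3))
  finally have 1: "h S - b * (h S - g S) - f S \<le> (\<Sum>i<k. f (insert (\<sigma> i) S)) - real k * f S"
    by (simp add: sum_subtractf algebra_simps)
  have "b * (h S - g S) \<le> a * (h S - g S)" using ba g_le_h by (intro mult_right_mono) auto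
  then show ?thesis using 1 by (simp add: algebra_simps)
qed

text \<open>The elements of \<open>OPT \<inter> Z\<close> are forbidden, which costs at most
  \<open>\<beta>\<close> by submodularity. The layer is estimated by nonnegativity of
  \<open>f\<close> alone, giving the \<open>- a\<close> in front of \<open>f S\<close>. In return
  \<open>h\<close> moves towards at least \<open>f OPT - \<alpha>\<close> instead of 0.\<close>

lemma avoiding_step:
  assumes S: "S \<subseteq> U - Z" "card S \<le> k" and \<sigma>: "bij_betw \<sigma> {..<N} (U - Z - S)" and N: "k \<le> N"
    and sorted: "\<And>i i'. i < i' \<Longrightarrow> i' < N \<Longrightarrow> f (insert (\<sigma> i') S) \<le> f (insert (\<sigma> i) S)"
  shows "(real k - 1 - a) * f S + h S - \<beta> \<le> (\<Sum>i<k. f (insert (\<sigma> i) S))"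
    "(real k - 1) * h S + (f OPT - \<alpha>) \<le> (\<Sum>i<k. h (insert (\<sigma> i) S))"
proof -
  let ?R = "U - (Z \<union> OPT \<union> S)" and ?m = "\<lambda>u. f (insert u S) - f S" and ?O = "OPT - Z - S"
  have SU: "S \<subseteq> U" using S by auto
  have kR: "k \<le> card ?R" using rest_card[OF SU S(2)] k by linarith
  have cO: "card ?O \<le> k" using OPT card_mono[of OPT ?O] finite_sub[OF OPT(1)] by auto
  have sorted': "?m (\<sigma> i') \<le> ?m (\<sigma> i)" if "i < i'" "i' < N" for i i' using sorted[OF that] by simp
  have sub: "?O \<subseteq> U - Z - S" "?R \<subseteq> U - Z - S" "?O \<inter> ?R = {}" using OPT by auto
  obtain b where b: "0 \<le> b" "b \<le> real k / real (card ?R)"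
     "(\<Sum>u\<in>?O. ?m u) + b * (\<Sum>u\<in>?R. ?m u) \<le> (\<Sum>i<k. ?m (\<sigma> i))"
    using two_level_top_sum[where g = ?m, OF \<sigma> N sorted' sub cO kR] by auto
  have ba: "b \<le> a" using fraction_le[OF SU S(2) b(2)] .
  have e1: "S \<union> ?O \<union> (OPT \<inter> Z) = OPT \<union> S" "(S \<union> ?O) \<inter> (OPT \<inter> Z) = {}" using S by auto
  have "h S + f {} \<le> f (S \<union> ?O) + \<beta>"
    using submod[of "S \<union> ?O" "OPT \<inter> Z"] SU OPT unfolding e1 \<beta>_def by auto
  moreover have "f (S \<union> ?O) - f S \<le> (\<Sum>u\<in>?O. ?m u)" using SU OPT by (intro sum_marginals_add) auto
  moreover have "0 \<le> f {}" by (rule nonneg) auto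
  ultimately have m1: "h S - \<beta> - f S \<le> (\<Sum>u\<in>?O. ?m u)" by linarith
  have "f (S \<union> ?R) - f S \<le> (\<Sum>u\<in>?R. ?m u)" using SU by (intro sum_marginals_add) auto
  moreover have "0 \<le> f (S \<union> ?R)" using SU by (intro nonneg) auto
  ultimately have m2: "- f S \<le> (\<Sum>u\<in>?R. ?m u)" by linarith
  have "b * (- f S) \<le> b * (\<Sum>u\<in>?R. ?m u)" using b(1) m2 by (rule mult_left_mono[rotated])
  moreover have "b * f S \<le> a * f S" using ba nonneg[OF SU] by (rule mult_right_mono)
  ultimately have "h S - \<beta> - f S - a * f S \<le> (\<Sum>i<k. ?m (\<sigma> i))" using b(3) m1 by simp
  then show "(real k - 1 - a) * f S + h S - \<beta> \<le> (\<Sum>i<k. f (insert (\<sigma> i) S))"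
    by (simp add: sum_subtractf algebra_simps)
  have im: "\<sigma> ` {..<k} \<subseteq> \<sigma> ` {..<N}" using N by (intro image_mono) auto
  then have im': "\<sigma> ` {..<k} \<subseteq> U - Z - S" using \<sigma> by (auto simp: bij_betw_def)
  have inj: "inj_on \<sigma> {..<k}" using \<sigma> N by (auto simp: bij_betw_def inj_on_def)
  have "(real k - 1) * h S + h (S \<union> \<sigma> ` {..<k}) \<le> (\<Sum>i<k. h (insert (\<sigma> i) S))"
    using im' by (intro nonneg_submodular.sum_insert_ge[OF h_submodular inj]) (auto simp: SU)
  moreover have "f OPT - \<alpha> \<le> h (S \<union> \<sigma> ` {..<k})" using im' S by (intro union_ge) auto
  ultimately show "(real k - 1) * h S + (f OPT - \<alpha>) \<le> (\<Sum>i<k. h (insert (\<sigma> i) S))" by linarith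
qed

text \<open>The solution of a linear recursion: per round \<open>f\<close> becomes at least
  \<open>lam\<close> times itself plus \<open>Q / k\<close>, and
  \<open>Q = (1 - a) * h + a * g\<close> shrinks by at most the factor \<open>lam\<close>.\<close>

definition "free_pot i S = lam ^ (k - i) * f S
   + real (k - i) / real k * lam ^ (k - i - 1) * ((1 - a) * h S + a * g S)"

lemma free_pot_step:
  assumes i: "i < k" and S: "S \<subseteq> U" "card S \<le> k" and \<sigma>: "bij_betw \<sigma> {..<N} (U - S)" and N: "k \<le> N"
    and sorted: "\<And>i i'. i < i' \<Longrightarrow> i' < N \<Longrightarrow> f (insert (\<sigma> i') S) \<le> f (insert (\<sigma> i) S)"
  shows "real k * free_pot i S \<le> (\<Sum>j<k. free_pot (Suc i) (insert (\<sigma> j) S))"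
proof -
  define Q where "Q = (1 - a) * h S + a * g S"
  obtain d where d: "k - i = Suc d" using i by (metis Suc_diff_Suc)
  then have d': "k - Suc i = d" by linarith
  have im: "\<sigma> ` {..<k} \<subseteq> \<sigma> ` {..<N}" using N by (intro image_mono) auto
  then have im': "\<sigma> ` {..<k} \<subseteq> U" using \<sigma> by (auto simp: bij_betw_def)
  have inj: "inj_on \<sigma> {..<k}" using \<sigma> N by (auto simp: bij_betw_def inj_on_def)
  have S': "S \<union> \<sigma> ` {..<k} \<subseteq> U" using S im' by auto
  have hs: "(real k - 1) * h S \<le> (\<Sum>j<k. h (insert (\<sigma> j) S))"
    using nonneg_submodular.sum_insert_ge[OF h_submodular inj im' S(1)]
      nonneg_submodular.nonneg[OF h_submodular S'] by linarith
  have gs: "(real k - 1) * g S \<le> (\<Sum>j<k. g (insert (\<sigma> j) S))"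
    using nonneg_submodular.sum_insert_ge[OF g_submodular inj im' S(1)]
      nonneg_submodular.nonneg[OF g_submodular S'] by linarith
  have "(real k - 1) * Q = (1 - a) * ((real k - 1) * h S) + a * ((real k - 1) * g S)"
    unfolding Q_def by (simp add: algebra_simps)
  also have "\<dots> \<le> (1 - a) * (\<Sum>j<k. h (insert (\<sigma> j) S)) + a * (\<Sum>j<k. g (insert (\<sigma> j) S))"
    using a a_nonneg hs gs by (intro add_mono mult_left_mono) auto
  also have "\<dots> = (\<Sum>j<k. (1 - a) * h (insert (\<sigma> j) S) + a * g (insert (\<sigma> j) S))"
    by (simp add: sum.distrib sum_distrib_left)
  finally have Qs: "(real k - 1) * Q \<le> (\<Sum>j<k. (1 - a) * h (insert (\<sigma> j) S) + a * g (insert (\<sigma> j) S))" .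
  have fs: "(real k - 1) * f S + Q \<le> (\<Sum>j<k. f (insert (\<sigma> j) S))"
    unfolding Q_def by (rule free_step[OF S \<sigma> N sorted])
  have "(\<Sum>j<k. free_pot (Suc i) (insert (\<sigma> j) S)) = lam ^ d * (\<Sum>j<k. f (insert (\<sigma> j) S))
     + real d / real k * lam ^ (d - 1) * (\<Sum>j<k. (1 - a) * h (insert (\<sigma> j) S) + a * g (insert (\<sigma> j) S))"
    unfolding free_pot_def d' sum.distrib[of "\<lambda>j. lam ^ d * f (insert (\<sigma> j) S)"] sum_distrib_left ..
  also have "\<dots> \<ge> lam ^ d * ((real k - 1) * f S + Q) + real d / real k * lam ^ (d - 1) * ((real k - 1) * Q)"
    using lam_bounds by (intro add_mono mult_left_mono fs Qs) auto
  also have "lam ^ d * ((real k - 1) * f S + Q) + real d / real k * lam ^ (d - 1) * ((real k - 1) * Q)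
     = real k * free_pot i S"
  proof -
    have "real d / real k * lam ^ (d - 1) * ((real k - 1) * Q) = real d * lam ^ d * Q"
      unfolding lam_bounds(3)[symmetric] using k by (cases d) auto
    moreover have "real k * free_pot i S = real k * lam * lam ^ d * f S + real (Suc d) * lam ^ d * Q"
      unfolding free_pot_def d Q_def[symmetric] using k by (simp add: field_simps)
    ultimately show ?thesis unfolding lam_bounds(3) by (simp add: algebra_simps)
  qed
  finally show ?thesis by simp
qed

text \<open>\<open>j\<close> rounds of avoidance are left, and the coefficients start from those of
  \<open>free_pot\<close> at round \<open>s\<close>. The exact coefficients would involve powers of
  \<open>1 - (1 + a) / k\<close>; these are lower solutions linear in \<open>a\<close>. With
  \<open>\<tau> = j / k\<close>, \<open>cD\<close> is close to \<open>1 - exp (- \<tau>) - \<tau> *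
  exp (- \<tau>) - a * \<tau>^3 / 6\<close>, the integral of the
  \<open>\<tau> * exp (- \<tau>) - a * \<tau>^2 / 2\<close> in \<open>cB\<close>, and its term
  \<open>j / k^2\<close> absorbs the discretisation.\<close>

definition "av_y = lam ^ (k - s)"
definition "av_w = real (k - s) / real k * lam ^ (k - s - 1)"
definition "cA j = av_y * (lam ^ j - a * real j / real k)"
definition "cB j = lam ^ j * (av_w * (1 - a)) + av_y * (real j / real k * lam ^ j - a * (real j)\<^sup>2 / (2 * (real k)\<^sup>2))"
definition "cD j = 1 - lam ^ j - real j / real k * lam ^ j - real j / (real k)\<^sup>2 - a * real j ^ 3 / (6 * real k ^ 3)"
definition "cC j = av_w * a * (f OPT - \<alpha>) + (f OPT - \<alpha>) * (av_w * (1 - a) * (1 - lam ^ j) + av_y * cD j)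
   - \<beta> * av_y * (1 - lam ^ j - a * (real j * (real j - 1)) / (2 * (real k)\<^sup>2))"
definition "avoid_pot i S = cA (s - i) * f S + cB (s - i) * h S + cC (s - i)"

lemma alpha_le: "0 \<le> f OPT - \<alpha>" unfolding \<alpha>_def by auto

lemma av_nonneg: "0 \<le> av_y" "0 \<le> av_w"
  using lam_bounds by (auto simp: av_y_def av_w_def)

lemma coeff_nonneg:
  assumes "7 * a \<le> 1" "5 * j \<le> 2 * k"
  shows "0 \<le> cA j" "0 \<le> cB j"
proof -
  have jk: "real j / real k \<le> 2 / 5" using assms k by (simp add: field_simps)
  have "1 - real j * (1 / real k) \<le> lam ^ j"
    using Bernoulli_inequality[of "- (1 / real k)" j] k by (simp add: lam_def)
  then have l: "3 / 5 \<le> lam ^ j" using jk by simp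
  have "a * (real j / real k) \<le> (1 / 7) * (2 / 5)" using jk assms a_nonneg by (intro mult_mono) auto
  then have aj: "a * real j / real k \<le> 2 / 35" by simp
  have "2 / 35 \<le> lam ^ j" using l by (rule order_trans[rotated]) simp
  then have al: "a * real j / real k \<le> lam ^ j" using aj by (rule order_trans[rotated])
  have "0 \<le> a * real j / real k" using a_nonneg by simp
  have half: "t / 2 \<le> x" if "0 \<le> t" "t \<le> x" for t x :: real using that by simp
  have al2: "a * real j / real k / 2 \<le> lam ^ j" by (rule half) fact+
  show "0 \<le> cA j" unfolding cA_def using av_nonneg al by (intro mult_nonneg_nonneg) auto
  have "0 \<le> real j / real k * (lam ^ j - a * real j / real k / 2)" using al2 by (intro mult_nonneg_nonneg) auto
  also have "\<dots> = real j / real k * lam ^ j - a * (real j)\<^sup>2 / (2 * (real k)\<^sup>2)"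
    by (simp add: power2_eq_square right_diff_distrib mult_ac)
  finally show "0 \<le> cB j"
    unfolding cB_def using av_nonneg lam_bounds a by (intro add_nonneg_nonneg mult_nonneg_nonneg) auto
qed

text \<open>Inequalities in this direction suffice, since a potential may underestimate. Each
  reduces to the nonnegativity of a few discarded products of \<open>a\<close>,
  \<open>1 - lam ^ j\<close> and powers of \<open>1 / k\<close>.\<close>

lemma coeff_step:
  "cA (Suc j) \<le> cA j * (1 - (1 + a) / real k)"
  "cB (Suc j) \<le> lam * cB j + cA j / real k"
  "cC (Suc j) \<le> cC j + cB j * (f OPT - \<alpha>) / real k - cA j * \<beta> / real k"
proof -
  define q where "q = 1 / real k"
  define L where "L = lam ^ j"
  define J where "J = real j"
  have q: "0 < q" "q \<le> 1" "lam = 1 - q" using k by (auto simp: q_def lam_def)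
  have L: "0 \<le> L" "L \<le> 1" using lam_bounds by (auto simp: L_def power_le_one)
  have J: "0 \<le> J" by (simp add: J_def)
  have L': "(1 - q) ^ j = L" unfolding L_def q(3) ..
  have dv: "x / real k = x * q" "x / (real k)\<^sup>2 = x * q\<^sup>2" "x / real k ^ 3 = x * q ^ 3"
    "x / (2 * (real k)\<^sup>2) = x * q\<^sup>2 / 2" "x / (6 * real k ^ 3) = x * q ^ 3 / 6" for x
    by (auto simp: q_def power_divide)
  note A = cA_def[of j, folded L_def J_def, unfolded dv]
  have A1: "cA (Suc j) = av_y * ((1 - q) * L - a * (J + 1) * q)"
    unfolding cA_def dv by (simp add: L_def J_def q(3) algebra_simps)
  have "0 \<le> a * q * (1 - L) + a * J * q * q + a * (a * J * q * q)"
    using a_nonneg q L J by (intro add_nonneg_nonneg mult_nonneg_nonneg) auto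
  then have "(1 - q) * L - a * (J + 1) * q \<le> (L - a * J * q) * (1 - (1 + a) * q)"
    by (simp add: algebra_simps)
  from mult_left_mono[OF this av_nonneg(1)]
  show "cA (Suc j) \<le> cA j * (1 - (1 + a) / real k)"
    unfolding A1 A dv by (simp add: mult_ac)
  note B = cB_def[of j, folded L_def J_def, unfolded dv]
  have B1: "cB (Suc j) = (1 - q) * L * (av_w * (1 - a)) + av_y * ((J + 1) * q * ((1 - q) * L) - a * (J + 1)\<^sup>2 * q\<^sup>2 / 2)"
    unfolding cB_def dv by (simp add: L_def J_def q(3) algebra_simps)
  have "0 \<le> L * q * q + q * q * q * (a * J\<^sup>2 / 2) + a * q\<^sup>2 / 2"
    using a_nonneg q L J by (intro add_nonneg_nonneg mult_nonneg_nonneg) auto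
  then have "(J + 1) * q * ((1 - q) * L) - a * (J + 1)\<^sup>2 * q\<^sup>2 / 2
     \<le> (1 - q) * (J * q * L - a * J\<^sup>2 * q\<^sup>2 / 2) + (L - a * J * q) * q"
    by (simp add: field_simps power2_eq_square)
  from mult_left_mono[OF this av_nonneg(1)]
  show "cB (Suc j) \<le> lam * cB j + cA j / real k"
    unfolding B1 B A dv q(3) by (simp add: algebra_simps)
  have D1: "cD (Suc j) - cD j \<le> q * (J * q * L - a * J\<^sup>2 * q\<^sup>2 / 2)"
  proof -
    have "cD (Suc j) - cD j = (J + 1) * q * q * L - q * q - a * q ^ 3 * ((J + 1) ^ 3 - J ^ 3) / 6"
      unfolding cD_def dv by (simp add: L' J_def q(3) field_simps power2_eq_square)
    also have "\<dots> = q * (J * q * L - a * J\<^sup>2 * q\<^sup>2 / 2) - q * q * (1 - L) - a * q ^ 3 * (3 * J + 1) / 6"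
      by (simp add: field_simps power2_eq_square power3_eq_cube)
    also have "\<dots> \<le> q * (J * q * L - a * J\<^sup>2 * q\<^sup>2 / 2)"
    proof -
      have "0 \<le> q * q * (1 - L)" "0 \<le> a * q ^ 3 * (3 * J + 1) / 6" using q L J a_nonneg by auto
      then show ?thesis by linarith
    qed
    finally show ?thesis .
  qed
  have C1: "cC (Suc j) - cC j = (f OPT - \<alpha>) * (av_w * (1 - a) * (q * L) + av_y * (cD (Suc j) - cD j))
     - \<beta> * av_y * (q * L - a * J * q\<^sup>2)"
    unfolding cC_def dv by (simp add: L' J_def q(3) field_simps power2_eq_square)
  have "(f OPT - \<alpha>) * (av_w * (1 - a) * (q * L) + av_y * (cD (Suc j) - cD j))
     \<le> (f OPT - \<alpha>) * (av_w * (1 - a) * (q * L) + av_y * (q * (J * q * L - a * J\<^sup>2 * q\<^sup>2 / 2)))"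
    using alpha_le av_nonneg D1 by (intro mult_left_mono add_left_mono) auto
  also have "\<dots> = cB j * (f OPT - \<alpha>) / real k"
    unfolding B dv by (simp add: algebra_simps)
  finally have "cC (Suc j) - cC j \<le> cB j * (f OPT - \<alpha>) / real k - \<beta> * av_y * (q * L - a * J * q\<^sup>2)"
    unfolding C1 by linarith
  also have "\<beta> * av_y * (q * L - a * J * q\<^sup>2) = cA j * \<beta> / real k"
    unfolding A dv by (simp add: power2_eq_square algebra_simps)
  finally show "cC (Suc j) \<le> cC j + cB j * (f OPT - \<alpha>) / real k - cA j * \<beta> / real k" by linarith
qed

lemma avoid_pot_step:
  assumes as: "7 * a \<le> 1" "5 * s \<le> 2 * k" and i: "i < s"
    and S: "S \<subseteq> U - Z" "card S \<le> k" and \<sigma>: "bij_betw \<sigma> {..<N} (U - Z - S)" and N: "k \<le> N"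
    and sorted: "\<And>i i'. i < i' \<Longrightarrow> i' < N \<Longrightarrow> f (insert (\<sigma> i') S) \<le> f (insert (\<sigma> i) S)"
  shows "real k * avoid_pot i S \<le> (\<Sum>j<k. avoid_pot (Suc i) (insert (\<sigma> j) S))"
proof -
  obtain d where d: "s - i = Suc d" using i by (metis Suc_diff_Suc)
  then have d': "s - Suc i = d" by linarith
  have d5: "5 * d \<le> 2 * k" using d as by linarith
  note nn = coeff_nonneg[OF as(1) d5]
  have k0: "0 < real k" using k by simp
  have SU: "S \<subseteq> U" using S by auto
  have f0: "0 \<le> f S" and h0: "0 \<le> h S" using SU OPT by (auto intro!: nonneg)
  note st = avoiding_step[OF S \<sigma> N sorted]
  have "real k * avoid_pot i S = real k * cA (Suc d) * f S + real k * cB (Suc d) * h S + real k * cC (Suc d)"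
    unfolding avoid_pot_def d by (simp add: algebra_simps)
  also have "\<dots> \<le> real k * (cA d * (1 - (1 + a) / real k)) * f S + real k * (lam * cB d + cA d / real k) * h S
      + real k * (cC d + cB d * (f OPT - \<alpha>) / real k - cA d * \<beta> / real k)"
    using f0 h0 k0 by (intro add_mono mult_left_mono mult_right_mono coeff_step) auto
  also have "\<dots> = cA d * ((real k - 1 - a) * f S + h S - \<beta>) + cB d * ((real k * lam) * h S + (f OPT - \<alpha>)) + real k * cC d"
    using k0 by (simp add: field_simps)
  also have "\<dots> \<le> cA d * (\<Sum>j<k. f (insert (\<sigma> j) S)) + cB d * (\<Sum>j<k. h (insert (\<sigma> j) S)) + real k * cC d"
    unfolding lam_bounds(3) using st nn by (intro add_mono mult_left_mono) auto
  also have "\<dots> = (\<Sum>j<k. avoid_pot (Suc i) (insert (\<sigma> j) S))"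
    unfolding avoid_pot_def d' by (simp add: sum.distrib sum_distrib_left)
  finally show ?thesis .
qed

text \<open>At the switch \<open>g S\<close> is replaced by its guaranteed value
  \<open>f OPT - \<alpha>\<close>; this is the only place where \<open>S\<close> must still avoid
  \<open>Z\<close>.\<close>

lemma avoid_pot_end:
  assumes "S \<subseteq> U - Z"
  shows "avoid_pot s S \<le> free_pot s S"
proof -
  have "f OPT - \<alpha> \<le> g S" using assms by (intro g_ge) auto
  then have "av_w * a * (f OPT - \<alpha>) \<le> av_w * a * g S"
    using av_nonneg a_nonneg by (intro mult_left_mono) auto
  moreover have "cD 0 = 0" "cA 0 = av_y" "cB 0 = av_w * (1 - a)" "cC 0 = av_w * a * (f OPT - \<alpha>)"
    by (simp_all add: cA_def cB_def cC_def cD_def)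
  moreover have "free_pot s S = av_y * f S + av_w * (1 - a) * h S + av_w * a * g S"
    unfolding free_pot_def av_y_def[symmetric] av_w_def[symmetric] by (simp add: algebra_simps)
  ultimately show ?thesis unfolding avoid_pot_def by simp
qed

definition "greedy_pot i S = (if i < s then avoid_pot i S else free_pot i S)"

lemma greedy_pot_step:
  assumes as: "s = 0 \<or> (7 * a \<le> 1 \<and> 5 * s \<le> 2 * k)" and i: "i < k"
    and S: "S \<subseteq> U" "card S \<le> k" "i < s \<Longrightarrow> S \<inter> Z = {}"
    and E: "E = (if i < s then U - Z - S else U - S)" and \<sigma>: "bij_betw \<sigma> {..<N} E" and N: "k \<le> N"
    and sorted: "\<And>i i'. i < i' \<Longrightarrow> i' < N \<Longrightarrow> f (insert (\<sigma> i') S) \<le> f (insert (\<sigma> i) S)"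
  shows "real k * greedy_pot i S \<le> (\<Sum>j<k. greedy_pot (Suc i) (insert (\<sigma> j) S))"
proof (cases "i < s")
  case True
  then have SZ: "S \<subseteq> U - Z" using S by auto
  have \<sigma>': "bij_betw \<sigma> {..<N} (U - Z - S)" using \<sigma> E True by simp
  have "real k * avoid_pot i S \<le> (\<Sum>j<k. avoid_pot (Suc i) (insert (\<sigma> j) S))"
    using as True by (intro avoid_pot_step[OF _ _ True SZ S(2) \<sigma>' N sorted]) auto
  also have "\<dots> \<le> (\<Sum>j<k. greedy_pot (Suc i) (insert (\<sigma> j) S))"
  proof (intro sum_mono)
    fix j assume "j \<in> {..<k}"
    then have "\<sigma> j \<in> U - Z - S" using \<sigma>' N by (auto simp: bij_betw_def)
    then have "insert (\<sigma> j) S \<subseteq> U - Z" using SZ by auto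
    then show "avoid_pot (Suc i) (insert (\<sigma> j) S) \<le> greedy_pot (Suc i) (insert (\<sigma> j) S)"
      using avoid_pot_end True by (cases "Suc i = s") (auto simp: greedy_pot_def)
  qed
  finally show ?thesis using True by (simp add: greedy_pot_def)
next
  case False
  then show ?thesis
    using free_pot_step[OF i S(1,2) _ N sorted] \<sigma> E by (simp add: greedy_pot_def)
qed

end

section \<open>Numerical estimates and starting values of random greedy\<close>

lemma exp_power_lower:
  fixes c :: real assumes "0 \<le> c" "c \<le> 1"
  shows "(1 - c / 64) ^ 64 \<le> exp (- c)"
proof -
  have "1 - c / 64 \<le> exp (- (c / 64))" using exp_ge_add_one_self[of "- (c / 64)"] by simp
  then have "(1 - c / 64) ^ 64 \<le> exp (- (c / 64)) ^ 64" using assms by (intro power_mono) auto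
  also have "exp (- (c / 64)) ^ 64 = exp (- c)" by (simp add: exp_of_nat_mult[symmetric])
  finally show ?thesis .
qed

lemma exp_upper_399: "exp (- (399 / 1000) :: real) \<le> 672 / 1000"
proof -
  have "(1 + (399 / 4000) + (399 / 4000)\<^sup>2 / 2 :: real) \<le> exp (399 / 4000)"
    by (rule exp_lower_Taylor_quadratic) simp
  then have "(1 + (399 / 4000) + (399 / 4000)\<^sup>2 / 2 :: real) ^ 4 \<le> exp (399 / 4000) ^ 4"
    by (intro power_mono) auto
  also have "exp (399 / 4000 :: real) ^ 4 = exp (399 / 1000)" by (simp add: exp_of_nat_mult[symmetric])
  finally have "1000 / 672 \<le> exp (399 / 1000 :: real)"
    by (rule order_trans[rotated]) (simp add: power2_eq_square eval_nat_numeral)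
  then show ?thesis by (simp add: exp_minus field_simps)
qed

context aided_greedy
begin

lemma lam_power_ge:
  assumes "2 \<le> k"
  shows "exp (- (real j / (real k - 1))) \<le> lam ^ j"
proof -
  have k1: "0 < real k - 1" using assms by auto
  have "1 + 1 / (real k - 1) \<le> exp (1 / (real k - 1))" by (rule exp_ge_add_one_self)
  moreover have "1 + 1 / (real k - 1) = real k / (real k - 1)" using k1 by (simp add: field_simps)
  ultimately have "real k / (real k - 1) \<le> exp (1 / (real k - 1))" by simp
  then have "inverse (exp (1 / (real k - 1))) \<le> inverse (real k / (real k - 1))"
    using k1 k by (intro le_imp_inverse_le) auto
  then have "exp (- (1 / (real k - 1))) \<le> lam"
    using k k1 by (simp add: exp_minus lam_def field_simps)
  then have "exp (- (1 / (real k - 1))) ^ j \<le> lam ^ j" by (intro power_mono) auto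
  then show ?thesis by (simp add: exp_of_nat_mult[symmetric])
qed

lemma lam_power_le: "lam ^ j \<le> exp (- (real j / real k))"
proof -
  have "lam \<le> exp (- (1 / real k))" using exp_ge_add_one_self[of "- (1 / real k)"] by (simp add: lam_def)
  then have "lam ^ j \<le> exp (- (1 / real k)) ^ j" using lam_bounds by (intro power_mono) auto
  then show ?thesis by (simp add: exp_of_nat_mult[symmetric])
qed

text \<open>The exponent of \<open>lam\<close> is \<open>k - 1\<close> rather than \<open>k\<close>,
  so \<open>1 / e\<close> is reached for every \<open>k\<close> and only the factor
  \<open>1 - a\<close> is lost.\<close>

lemma greedy_start_plain:
  assumes "s = 0"
  shows "(1 - a) * (exp (- 1) * f OPT) \<le> greedy_pot 0 {}"
proof -
  have "exp (- 1) \<le> lam ^ (k - 1)"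
  proof (cases "k = 1")
    case False
    then have "2 \<le> k" using k by linarith
    then show ?thesis using lam_power_ge[of "k - 1"] by (simp add: of_nat_diff)
  qed auto
  moreover have P: "0 \<le> f OPT" using OPT nonneg by auto
  ultimately have "exp (- 1) * f OPT \<le> lam ^ (k - 1) * f OPT" by (intro mult_right_mono)
  then have "(1 - a) * (exp (- 1) * f OPT) \<le> (1 - a) * (lam ^ (k - 1) * f OPT)"
    using a by (intro mult_left_mono) auto
  also have "\<dots> = lam ^ (k - 1) * ((1 - a) * f OPT)" by simp
  also have "\<dots> \<le> lam ^ k * f {} + lam ^ (k - 1) * ((1 - a) * h {} + a * g {})"
  proof -
    have "0 \<le> g {}" by (rule nonneg_submodular.nonneg[OF g_submodular]) auto
    then have "lam ^ (k - 1) * ((1 - a) * f OPT) \<le> lam ^ (k - 1) * ((1 - a) * h {} + a * g {})"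
      using a_nonneg lam_bounds by (intro mult_left_mono) auto
    moreover have "0 \<le> lam ^ k * f {}" using nonneg[of "{}"] lam_bounds by auto
    ultimately show ?thesis by linarith
  qed
  also have "\<dots> = greedy_pot 0 {}" unfolding greedy_pot_def free_pot_def using assms k by simp
  finally show ?thesis .
qed

text \<open>With 2/5 of the rounds avoiding \<open>Z\<close>, the coefficients of
  \<open>\<alpha>\<close> and \<open>\<beta>\<close> are nearly equal, both below 0.3206, so only
  their sum matters; it is at most \<open>2 * f Z + \<eta>\<close>, hence at most
  \<open>0.7364 * P + \<eta>\<close>. Now \<open>0.9146 - 0.3206 * 0.7364 > 0.678\<close>, and times
  \<open>y \<ge> 0.546\<close> this exceeds 0.3682. The bound \<open>1000 \<le> k\<close> keeps
  rounding in \<open>s / k\<close> and \<open>k - 1\<close> within these margins.\<close>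

lemma greedy_start_aided:
  assumes k1000: "1000 \<le> k" and s_def: "s = 2 * k div 5" and a7: "a = 1 / 7" and \<eta>: "0 \<le> \<eta>"
    and sum: "f (OPT \<union> Z) + f (OPT \<inter> Z) \<le> 2 * f Z + \<eta>" and Zsmall: "f Z \<le> exp (- 1) * f OPT"
  shows "exp (- 1) * f OPT - \<eta> \<le> greedy_pot 0 {}"
proof -
  define P where "P = f OPT"
  define x where "x = lam ^ s"
  define y where "y = av_y"
  define \<tau> where "\<tau> = real s / real k"
  define q where "q = 1 / real k"
  define \<gamma> where "\<gamma> = P - \<alpha>"
  have P0: "0 \<le> P" unfolding P_def using OPT nonneg by auto
  have \<alpha>0: "0 \<le> \<alpha>" unfolding \<alpha>_def using OPT Z by (auto intro!: nonneg)
  have \<beta>0: "0 \<le> \<beta>" by (rule beta_nonneg)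
  have \<gamma>0: "0 \<le> \<gamma>" unfolding \<gamma>_def P_def by (rule alpha_le)
  have k0: "0 < real k" "1000 \<le> real k" using k1000 by auto
  have "5 * s \<le> 2 * k" "2 * k \<le> 5 * s + 4" unfolding s_def by presburger+
  then have sr: "5 * real s \<le> 2 * real k" "2 * real k \<le> 5 * real s + 4" by linarith+
  have \<tau>: "399 / 1000 \<le> \<tau>" "\<tau> \<le> 4 / 10" unfolding \<tau>_def using sr k0 by (auto simp: field_simps)
  have q: "0 \<le> q" "q \<le> 1 / 1000" unfolding q_def using k0 by (auto simp: field_simps)
  have spos: "0 < s" unfolding s_def using k1000 by auto
  have sk: "s < k" unfolding s_def using k1000 by auto
  have k2: "2 \<le> k" using k1000 by auto
  have x_le: "x \<le> 672 / 1000"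
  proof -
    have "x \<le> exp (- \<tau>)" unfolding x_def \<tau>_def by (rule lam_power_le)
    also have "\<dots> \<le> exp (- (399 / 1000))" using \<tau> by simp
    also have "\<dots> \<le> 672 / 1000" by (rule exp_upper_399)
    finally show ?thesis .
  qed
  have x_ge: "669 / 1000 \<le> x"
  proof -
    have "(669 / 1000 :: real) \<le> (1 - (4005 / 10000) / 64) ^ 64" by (simp add: power_divide)
    also have "\<dots> \<le> exp (- (4005 / 10000))" by (rule exp_power_lower) auto
    also have "\<dots> \<le> exp (- (real s / (real k - 1)))" using sr k0 by (simp add: field_simps)
    also have "\<dots> \<le> x" unfolding x_def by (rule lam_power_ge[OF k2])
    finally show ?thesis .
  qed
  have y_ge: "546 / 1000 \<le> y"
  proof -
    have "(546 / 1000 :: real) \<le> (1 - (6015 / 10000) / 64) ^ 64" by (simp add: power_divide)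
    also have "\<dots> \<le> exp (- (6015 / 10000))" by (rule exp_power_lower) auto
    also have "\<dots> \<le> exp (- (real (k - s) / (real k - 1)))" using sr k0 sk by (simp add: field_simps of_nat_diff)
    also have "\<dots> \<le> y" unfolding y_def av_y_def by (rule lam_power_ge[OF k2])
    finally show ?thesis .
  qed
  have y1: "y \<le> 1" unfolding y_def av_y_def using lam_bounds by (simp add: power_le_one)
  have w_ge: "(1 - \<tau>) * y \<le> av_w"
  proof -
    have e: "real (k - s) / real k = 1 - \<tau>" unfolding \<tau>_def using sk by (simp add: of_nat_diff field_simps)
    have "lam ^ (k - s) \<le> lam ^ (k - s - 1)" using lam_bounds by (intro power_decreasing) auto
    then show ?thesis unfolding av_w_def e y_def av_y_def using \<tau> by (intro mult_left_mono) auto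
  qed
  have cBs: "cB s = x * (av_w * (6 / 7)) + y * (\<tau> * x - \<tau>\<^sup>2 / 14)"
    unfolding cB_def x_def y_def \<tau>_def by (simp add: power_divide a7)
  have cDs: "cD s = 1 - x - \<tau> * x - \<tau> * q - \<tau> ^ 3 / 42"
    unfolding cD_def x_def \<tau>_def q_def by (simp add: power_divide power2_eq_square a7)
  have cCs: "cC s = av_w * (1 / 7) * \<gamma> + \<gamma> * (av_w * (6 / 7) * (1 - x) + y * (1 - x - \<tau> * x - \<tau> * q - \<tau> ^ 3 / 42))
     - \<beta> * y * (1 - x - (\<tau>\<^sup>2 - \<tau> * q) / 14)"
  proof -
    have "a * (real s * (real s - 1)) / (2 * (real k)\<^sup>2) = (\<tau>\<^sup>2 - \<tau> * q) / 14"
      unfolding a7 \<tau>_def q_def using k0 by (simp add: field_simps power2_eq_square)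
    then show ?thesis unfolding cC_def cDs \<gamma>_def P_def x_def y_def by (simp add: a7)
  qed
  define v where "v = \<tau> * x"
  define r2 where "r2 = \<tau>\<^sup>2"
  define r3 where "r3 = \<tau> ^ 3"
  define tq where "tq = \<tau> * q"
  have v: "2669 / 10000 \<le> v"
  proof -
    have "(399 / 1000) * (669 / 1000) \<le> v" unfolding v_def using \<tau> x_ge by (intro mult_mono) auto
    then show ?thesis by simp
  qed
  have r2: "1592 / 10000 \<le> r2" "r2 \<le> 16 / 100"
  proof -
    have "(399 / 1000)\<^sup>2 \<le> r2" "r2 \<le> (4 / 10)\<^sup>2" unfolding r2_def using \<tau> by (intro power_mono; simp)+
    then show "1592 / 10000 \<le> r2" "r2 \<le> 16 / 100" by (simp_all add: power2_eq_square)
  qed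
  have r3: "0 \<le> r3" "r3 \<le> 64 / 1000"
  proof -
    have "r3 \<le> (4 / 10) ^ 3" unfolding r3_def using \<tau> by (intro power_mono) auto
    then show "r3 \<le> 64 / 1000" "0 \<le> r3" using \<tau> by (simp_all add: power3_eq_cube r3_def)
  qed
  have tq: "0 \<le> tq" "tq \<le> 4 / 10000"
  proof -
    have "tq \<le> (4 / 10) * (1 / 1000)" unfolding tq_def using \<tau> q by (intro mult_mono) auto
    then show "tq \<le> 4 / 10000" "0 \<le> tq" using \<tau> q by (auto simp: tq_def)
  qed
  \<comment> \<open>The starting value with \<open>y\<close> factored out after \<open>av_w\<close>
    has been bounded by \<open>(1 - \<tau>) * y\<close>: a linear form in \<open>P\<close>,
    \<open>\<alpha>\<close> and \<open>\<beta>\<close>.\<close>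
  define E where "E = (2 - \<tau> - x - r2 / 14 - tq - r3 / 42) * P - (2 - \<tau> - 13 / 7 * x - v / 7 - tq - r3 / 42) * \<alpha>
     - (1 - x - r2 / 14 + tq / 14) * \<beta>"
  have "y * E = (1 - \<tau>) * y * (6 / 7 * x * P + \<gamma> * (1 / 7 + 6 / 7 * (1 - x)))
     + P * (y * (\<tau> * x - \<tau>\<^sup>2 / 14)) + \<gamma> * (y * (1 - x - \<tau> * x - \<tau> * q - \<tau> ^ 3 / 42))
     - \<beta> * y * (1 - x - (\<tau>\<^sup>2 - \<tau> * q) / 14)"
    unfolding E_def v_def r2_def r3_def tq_def \<gamma>_def by (simp add: field_simps)
  also have "\<dots> \<le> av_w * (6 / 7 * x * P + \<gamma> * (1 / 7 + 6 / 7 * (1 - x)))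
     + P * (y * (\<tau> * x - \<tau>\<^sup>2 / 14)) + \<gamma> * (y * (1 - x - \<tau> * x - \<tau> * q - \<tau> ^ 3 / 42))
     - \<beta> * y * (1 - x - (\<tau>\<^sup>2 - \<tau> * q) / 14)"
  proof -
    have "0 \<le> 6 / 7 * x * P + \<gamma> * (1 / 7 + 6 / 7 * (1 - x))"
      using x_ge x_le P0 \<gamma>0 by (intro add_nonneg_nonneg mult_nonneg_nonneg) auto
    from mult_right_mono[OF w_ge this] show ?thesis by simp
  qed
  also have "\<dots> = cB s * P + cC s"
    unfolding cBs cCs by (simp add: algebra_simps)
  finally have yE: "y * E \<le> cB s * P + cC s" .
  have "9146 / 10000 \<le> 2 - \<tau> - x - r2 / 14 - tq - r3 / 42"
    using \<tau> x_le r2 tq r3 by simp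
  from mult_right_mono[OF this P0] have E1: "9146 / 10000 * P \<le> (2 - \<tau> - x - r2 / 14 - tq - r3 / 42) * P" .
  have "2 - \<tau> - 13 / 7 * x - v / 7 - tq - r3 / 42 \<le> 3206 / 10000"
    using \<tau> x_ge v tq r3 by simp
  from mult_right_mono[OF this \<alpha>0] have E2: "(2 - \<tau> - 13 / 7 * x - v / 7 - tq - r3 / 42) * \<alpha> \<le> 3206 / 10000 * \<alpha>" .
  have "1 - x - r2 / 14 + tq / 14 \<le> 3206 / 10000"
    using x_ge r2 tq by simp
  from mult_right_mono[OF this \<beta>0] have E3: "(1 - x - r2 / 14 + tq / 14) * \<beta> \<le> 3206 / 10000 * \<beta>" .
  have ab: "\<alpha> + \<beta> \<le> 7364 / 10000 * P + \<eta>"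
  proof -
    have "exp (- 1) * P \<le> 3682 / 10000 * P" using exp_minus_1_le P0 by (rule mult_right_mono)
    then have "2 * f Z \<le> 7364 / 10000 * P" using Zsmall unfolding P_def by simp
    moreover have "\<alpha> + \<beta> \<le> f (OPT \<union> Z) + f (OPT \<inter> Z)" unfolding \<alpha>_def \<beta>_def by auto
    ultimately show ?thesis using sum by linarith
  qed
  have E4: "678 / 1000 * P - \<eta> \<le> E"
    using E1 E2 E3 ab P0 \<eta> unfolding E_def by simp
  have "exp (- 1) * P - \<eta> \<le> 3682 / 10000 * P - \<eta>"
    using mult_right_mono[OF exp_minus_1_le P0] by simp
  also have "\<dots> \<le> 546 / 1000 * (678 / 1000 * P) - \<eta>" using P0 by simp
  also have "\<dots> \<le> y * (678 / 1000 * P) - y * \<eta>"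
  proof (rule diff_mono)
    show "546 / 1000 * (678 / 1000 * P) \<le> y * (678 / 1000 * P)"
      using y_ge P0 by (intro mult_right_mono) auto
    show "y * \<eta> \<le> \<eta>" using mult_right_mono[OF y1 \<eta>] by simp
  qed
  also have "\<dots> = y * (678 / 1000 * P - \<eta>)" by (simp add: right_diff_distrib)
  also have "\<dots> \<le> y * E" using E4 y_ge by (intro mult_left_mono) auto
  also have "\<dots> \<le> cB s * P + cC s" by (rule yE)
  also have "\<dots> \<le> greedy_pot 0 {}"
  proof -
    have "0 \<le> cA s" using sr by (intro coeff_nonneg) (auto simp: a7)
    then have "0 \<le> cA s * f {}" using nonneg[of "{}"] by auto
    then show ?thesis using spos by (simp add: greedy_pot_def avoid_pot_def P_def)
  qed
  finally show ?thesis unfolding P_def .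
qed

end

section \<open>Execution of programs\<close>

text \<open>
  Random branches may take different numbers of steps, so \<open>D\<close> is the joint distribution of the final
  state and the running time.
\<close>

definition exec :: "nat \<Rightarrow> (nat set \<Rightarrow> real) \<Rightarrow> com \<Rightarrow> state \<Rightarrow> nat \<Rightarrow> (state \<Rightarrow> bool) \<Rightarrow> (state \<Rightarrow> real) \<Rightarrow> real \<Rightarrow> bool" where
  "exec n g c s T Q \<phi> v \<longleftrightarrow> (\<exists>D :: (state \<times> nat) pmf. finite (set_pmf D) \<and>
     (\<forall>x\<in>set_pmf D. snd x \<le> T \<and> Q (fst x)) \<and>
     (\<forall>K t. T \<le> t \<longrightarrow> steps n g t (c # K, s) = bind_pmf D (\<lambda>x. steps n g (t - snd x) (K, fst x))) \<and>
     v \<le> measure_pmf.expectation D (\<lambda>x. \<phi> (fst x)))"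

lemma expectation_ge_const:
  fixes \<phi> :: "'a \<Rightarrow> real"
  assumes "finite (set_pmf D)" "\<And>x. x \<in> set_pmf D \<Longrightarrow> v \<le> \<phi> x"
  shows "v \<le> measure_pmf.expectation D \<phi>"
proof -
  have "v = measure_pmf.expectation D (\<lambda>_. v)" by simp
  also have "\<dots> \<le> measure_pmf.expectation D \<phi>"
    using assms by (intro integral_mono_AE integrable_measure_pmf_finite) (auto simp: AE_measure_pmf_iff)
  finally show ?thesis .
qed

lemma expectation_mono_finite:
  fixes \<phi> \<psi> :: "'a \<Rightarrow> real"
  assumes "finite (set_pmf D)" "\<And>x. x \<in> set_pmf D \<Longrightarrow> \<phi> x \<le> \<psi> x"
  shows "measure_pmf.expectation D \<phi> \<le> measure_pmf.expectation D \<psi>"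
  using assms by (intro integral_mono_AE integrable_measure_pmf_finite) (auto simp: AE_measure_pmf_iff)

lemma expectation_bind_finite:
  fixes \<phi> :: "'b \<Rightarrow> real"
  assumes "finite (set_pmf D)" "\<And>x. x \<in> set_pmf D \<Longrightarrow> finite (set_pmf (F x))"
  shows "measure_pmf.expectation (bind_pmf D F) \<phi> = measure_pmf.expectation D (\<lambda>x. measure_pmf.expectation (F x) \<phi>)"
  using assms by (simp add: pmf_expectation_bind[of "set_pmf D"] integral_measure_pmf[of "set_pmf D"])

lemma exec_mono:
  assumes "exec n g c s T Q \<phi> v" "T \<le> T'" "\<And>s'. Q s' \<Longrightarrow> Q' s'" "\<And>s'. Q s' \<Longrightarrow> \<phi> s' \<le> \<phi>' s'" "v' \<le> v"
  shows "exec n g c s T' Q' \<phi>' v'"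
proof -
  obtain D where D: "finite (set_pmf D)" "\<forall>x\<in>set_pmf D. snd x \<le> T \<and> Q (fst x)"
     "\<forall>K t. T \<le> t \<longrightarrow> steps n g t (c # K, s) = bind_pmf D (\<lambda>x. steps n g (t - snd x) (K, fst x))"
     "v \<le> measure_pmf.expectation D (\<lambda>x. \<phi> (fst x))"
    using assms(1) unfolding exec_def by auto
  have "measure_pmf.expectation D (\<lambda>x. \<phi> (fst x)) \<le> measure_pmf.expectation D (\<lambda>x. \<phi>' (fst x))"
    using D assms by (intro expectation_mono_finite) auto
  then show ?thesis
    unfolding exec_def using D assms by (intro exI[of _ D]) (auto intro: order_trans)
qed

text \<open>Correctness without probabilities. \<open>exec_terminates\<close> later attaches any
  potential that is bounded below by the postcondition.\<close>

definition terminates :: "nat \<Rightarrow> (nat set \<Rightarrow> real) \<Rightarrow> com \<Rightarrow> state \<Rightarrow> nat \<Rightarrow> (state \<Rightarrow> bool) \<Rightarrow> bool" where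
  "terminates n g c s T Q \<longleftrightarrow> exec n g c s T Q (\<lambda>_. 0) 0"

lemma exec_terminates:
  assumes "terminates n g c s T Q" "\<And>s'. Q s' \<Longrightarrow> v \<le> \<phi> s'"
  shows "exec n g c s T Q \<phi> v"
proof -
  obtain D where D: "finite (set_pmf D)" "\<forall>x\<in>set_pmf D. snd x \<le> T \<and> Q (fst x)"
     "\<forall>K t. T \<le> t \<longrightarrow> steps n g t (c # K, s) = bind_pmf D (\<lambda>x. steps n g (t - snd x) (K, fst x))"
    using assms(1) unfolding exec_def terminates_def by auto
  have "v \<le> measure_pmf.expectation D (\<lambda>x. \<phi> (fst x))"
    using D assms by (intro expectation_ge_const) auto
  then show ?thesis using D unfolding exec_def by (intro exI[of _ D]) auto
qed

lemma terminates_mono: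
  assumes "terminates n g c s T Q" "T \<le> T'" "\<And>s'. Q s' \<Longrightarrow> Q' s'"
  shows "terminates n g c s T' Q'"
  using assms unfolding terminates_def by (elim exec_mono) auto

lemma exec_step:
  assumes "\<And>K. step n g (c # K, s) = return_pmf (K, s')" "Q s'" "v \<le> \<phi> s'"
  shows "exec n g c s 1 Q \<phi> v"
  unfolding exec_def
proof (intro exI[of _ "return_pmf (s', 1)"] conjI allI impI)
  fix K t assume "1 \<le> (t :: nat)"
  then obtain t' where "t = Suc t'" by (cases t) auto
  then show "steps n g t (c # K, s) = return_pmf (s', 1) \<bind> (\<lambda>x. steps n g (t - snd x) (K, fst x))"
    by (simp add: assms(1) bind_return_pmf)
qed (use assms in auto)

text \<open>The outcome of the second command depends on the state reached by the first, so a family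
  of distributions is chosen. Running times are added inside the joint distribution, and the extra
  step unfolds the sequence.\<close>

lemma exec_Seq:
  assumes c: "exec n g c s T1 Q1 \<phi>1 v" and d: "\<And>s'. Q1 s' \<Longrightarrow> exec n g d s' T2 Q2 \<phi>2 (\<phi>1 s')"
  shows "exec n g (Seq c d) s (T1 + T2 + 1) Q2 \<phi>2 v"
proof -
  obtain D where D: "finite (set_pmf D)" "\<forall>x\<in>set_pmf D. snd x \<le> T1 \<and> Q1 (fst x)"
     "\<And>K t. T1 \<le> t \<Longrightarrow> steps n g t (c # K, s) = bind_pmf D (\<lambda>x. steps n g (t - snd x) (K, fst x))"
     "v \<le> measure_pmf.expectation D (\<lambda>x. \<phi>1 (fst x))"
    using c unfolding exec_def by auto
  define R where "R s' E \<longleftrightarrow> finite (set_pmf E) \<and>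
     (\<forall>x\<in>set_pmf E. snd x \<le> T2 \<and> Q2 (fst x)) \<and>
     (\<forall>K t. T2 \<le> t \<longrightarrow> steps n g t (d # K, s') = bind_pmf E (\<lambda>x. steps n g (t - snd x) (K, fst x))) \<and>
     \<phi>1 s' \<le> measure_pmf.expectation E (\<lambda>x. \<phi>2 (fst x))" for s' E
  have "\<forall>s'. \<exists>E. Q1 s' \<longrightarrow> R s' E"
    using d unfolding exec_def R_def[symmetric] by blast
  then obtain E where E0: "\<And>s'. Q1 s' \<Longrightarrow> R s' (E s')" using choice by (metis (no_types))
  have E: "finite (set_pmf (E s'))" "\<And>x. x \<in> set_pmf (E s') \<Longrightarrow> snd x \<le> T2 \<and> Q2 (fst x)"
     "\<And>K t. T2 \<le> t \<Longrightarrow> steps n g t (d # K, s') = bind_pmf (E s') (\<lambda>x. steps n g (t - snd x) (K, fst x))"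
     "\<phi>1 s' \<le> measure_pmf.expectation (E s') (\<lambda>x. \<phi>2 (fst x))" if "Q1 s'" for s'
    using E0[OF that] unfolding R_def by simp_all
  define F where "F x = map_pmf (\<lambda>y. (fst y, snd x + snd y + 1)) (E (fst x))" for x :: "state \<times> nat"
  define G where "G = bind_pmf D F"
  have finF: "finite (set_pmf (F x))" if "x \<in> set_pmf D" for x
    unfolding F_def using D E(1) that by auto
  have finG: "finite (set_pmf G)" unfolding G_def using D finF by auto
  have setG: "\<forall>x\<in>set_pmf G. snd x \<le> T1 + T2 + 1 \<and> Q2 (fst x)"
  proof
    fix z assume "z \<in> set_pmf G"
    then obtain x y where xy: "x \<in> set_pmf D" "y \<in> set_pmf (E (fst x))" "z = (fst y, snd x + snd y + 1)"
      unfolding G_def F_def by auto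
    then have "snd x \<le> T1" "Q1 (fst x)" using D(2) by auto
    then show "snd z \<le> T1 + T2 + 1 \<and> Q2 (fst z)" using xy E(2)[of "fst x" y] by simp
  qed
  have stepsG: "steps n g t (Seq c d # K, s) = bind_pmf G (\<lambda>x. steps n g (t - snd x) (K, fst x))"
    if t: "T1 + T2 + 1 \<le> t" for K t
  proof -
    obtain t' where t': "t = Suc t'" using t by (cases t) auto
    have "steps n g t (Seq c d # K, s) = steps n g t' (c # d # K, s)" by (simp add: t' bind_return_pmf)
    also have "\<dots> = bind_pmf D (\<lambda>x. steps n g (t' - snd x) (d # K, fst x))" using t t' by (intro D(3)) auto
    also have "\<dots> = bind_pmf D (\<lambda>x. bind_pmf (E (fst x)) (\<lambda>y. steps n g (t' - snd x - snd y) (K, fst y)))"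
    proof (intro bind_pmf_cong refl)
      fix x assume "x \<in> set_pmf D"
      then have "snd x \<le> T1" "Q1 (fst x)" using D(2) by auto
      then show "steps n g (t' - snd x) (d # K, fst x) = bind_pmf (E (fst x)) (\<lambda>y. steps n g (t' - snd x - snd y) (K, fst y))"
        using t t' by (intro E(3)) auto
    qed
    also have "\<dots> = bind_pmf G (\<lambda>x. steps n g (t - snd x) (K, fst x))"
      unfolding G_def F_def bind_assoc_pmf bind_map_pmf t' by (simp add: diff_diff_left)
    finally show ?thesis .
  qed
  have "v \<le> measure_pmf.expectation G (\<lambda>x. \<phi>2 (fst x))"
  proof -
    have "measure_pmf.expectation D (\<lambda>x. \<phi>1 (fst x)) \<le> measure_pmf.expectation D (\<lambda>x. measure_pmf.expectation (F x) (\<lambda>y. \<phi>2 (fst y)))"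
      using D E(4) by (intro expectation_mono_finite) (auto simp: F_def)
    also have "\<dots> = measure_pmf.expectation G (\<lambda>x. \<phi>2 (fst x))"
      unfolding G_def using D finF by (simp add: expectation_bind_finite)
    finally show ?thesis using D(4) by linarith
  qed
  then show ?thesis unfolding exec_def using finG setG stepsG by (intro exI[of _ G]) auto
qed

lemma exec_jump:
  assumes "\<And>K. step n g (c # K, s) = return_pmf (d # K, s)" "exec n g d s T Q \<phi> v"
  shows "exec n g c s (T + 1) Q \<phi> v"
proof -
  obtain D where D: "finite (set_pmf D)" "\<forall>x\<in>set_pmf D. snd x \<le> T \<and> Q (fst x)"
     "\<And>K t. T \<le> t \<Longrightarrow> steps n g t (d # K, s) = bind_pmf D (\<lambda>x. steps n g (t - snd x) (K, fst x))"
     "v \<le> measure_pmf.expectation D (\<lambda>x. \<phi> (fst x))"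
    using assms(2) unfolding exec_def by auto
  have "steps n g t (c # K, s) = bind_pmf (map_pmf (\<lambda>x. (fst x, snd x + 1)) D) (\<lambda>x. steps n g (t - snd x) (K, fst x))"
    if t: "T + 1 \<le> t" for K t
  proof -
    obtain t' where t': "t = Suc t'" using t by (cases t) auto
    show ?thesis using D(3)[of t' K] t unfolding t' by (simp add: assms(1) bind_return_pmf bind_map_pmf)
  qed
  then show ?thesis
    unfolding exec_def using D by (intro exI[of _ "map_pmf (\<lambda>x. (fst x, snd x + 1)) D"]) auto
qed

lemma exec_If:
  assumes "bval s b \<Longrightarrow> exec n g c s T Q \<phi> v" "\<not> bval s b \<Longrightarrow> exec n g d s T Q \<phi> v"
  shows "exec n g (If b c d) s (T + 1) Q \<phi> v"
proof (cases "bval s b")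
  case True
  show ?thesis by (rule exec_jump[of n g _ s c]) (use True assms in auto)
next
  case False
  show ?thesis by (rule exec_jump[of n g _ s d]) (use False assms in auto)
qed

text \<open>\<open>V\<close> is a submartingale along the iterations: each round preserves its value
  in expectation as a lower bound. The number of iterations is fixed in advance.\<close>

lemma exec_While:
  assumes body: "\<And>i s. i < N \<Longrightarrow> I i s \<Longrightarrow> bval s b \<and> exec n g c s T (I (Suc i)) (V (Suc i)) (V i s)"
    and stop: "\<And>s. I N s \<Longrightarrow> \<not> bval s b"
    and "i \<le> N" "I i s"
  shows "exec n g (While b c) s ((N - i) * (T + 2) + 1) (I N) (V N) (V i s)"
  using assms(3,4)
proof (induction "N - i" arbitrary: i s)
  case 0
  then have "i = N" by simp
  then have "exec n g (While b c) s 1 (I N) (V N) (V i s)"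
    by (intro exec_step[of n g _ s s]) (use 0 stop in auto)
  then show ?case using \<open>i = N\<close> by simp
next
  case (Suc d)
  then have i: "i < N" and d: "d = N - Suc i" by auto
  have b: "bval s b" and c: "exec n g c s T (I (Suc i)) (V (Suc i)) (V i s)" using body[OF i] Suc by auto
  have "exec n g (Seq c (While b c)) s (T + ((N - Suc i) * (T + 2) + 1) + 1) (I N) (V N) (V i s)"
    using i by (intro exec_Seq[OF c] Suc.hyps(1)[OF d]) auto
  then obtain D where D: "finite (set_pmf D)" "\<forall>x\<in>set_pmf D. snd x \<le> T + ((N - Suc i) * (T + 2) + 1) + 1 \<and> I N (fst x)"
     "\<And>K t. T + ((N - Suc i) * (T + 2) + 1) + 1 \<le> t \<Longrightarrow> steps n g t (Seq c (While b c) # K, s) = bind_pmf D (\<lambda>x. steps n g (t - snd x) (K, fst x))"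
     "V i s \<le> measure_pmf.expectation D (\<lambda>x. V N (fst x))"
    unfolding exec_def by auto
  have T: "(N - i) * (T + 2) + 1 = T + ((N - Suc i) * (T + 2) + 1) + 1 + 1"
  proof -
    have "N - i = Suc (N - Suc i)" using i by simp
    then show ?thesis by simp
  qed
  \<comment> \<open>While the guard holds, the loop and the sequence of body and loop make the same
    first step, so the result for sequences applies.\<close>
  have "steps n g t (While b c # K, s) = steps n g t (Seq c (While b c) # K, s)" if "1 \<le> t" for K t
    using b that by (cases t) (auto simp: bind_return_pmf)
  then show ?case
    unfolding exec_def T using D by (intro exI[of _ D]) auto
qed

lemma exec_Rand:
  assumes "\<And>r. r \<le> nval s u \<Longrightarrow> Q (s\<lparr>nvar := (nvar s)(x := r)\<rparr>)"
    "v * real (nval s u + 1) \<le> (\<Sum>r<nval s u + 1. \<phi> (s\<lparr>nvar := (nvar s)(x := r)\<rparr>))"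
  shows "exec n g (Rand x u) s 1 Q \<phi> v"
proof -
  let ?A = "{0..nval s u}" and ?s = "\<lambda>r. s\<lparr>nvar := (nvar s)(x := r)\<rparr>"
  let ?D = "map_pmf (\<lambda>r. (?s r, 1)) (pmf_of_set ?A)"
  have A: "finite ?A" "?A \<noteq> {}" by auto
  have A': "?A = {..<nval s u + 1}" by auto
  have "steps n g t (Rand x u # K, s) = bind_pmf ?D (\<lambda>x. steps n g (t - snd x) (K, fst x))" if "1 \<le> t" for K t
  proof -
    obtain t' where "t = Suc t'" using \<open>1 \<le> t\<close> by (cases t) auto
    then show ?thesis by (simp add: bind_map_pmf)
  qed
  moreover have "v \<le> measure_pmf.expectation ?D (\<lambda>x. \<phi> (fst x))"
  proof -
    have "measure_pmf.expectation ?D (\<lambda>x. \<phi> (fst x)) = (\<Sum>r\<in>?A. \<phi> (?s r)) / real (card ?A)"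
      using integral_pmf_of_set[OF A(2,1), of "\<lambda>r. \<phi> (?s r)"] by simp
    moreover have "v \<le> (\<Sum>r\<in>?A. \<phi> (?s r)) / real (card ?A)"
      using assms(2) unfolding A' by (simp add: pos_le_divide_eq del: sum.lessThan_Suc)
    ultimately show ?thesis by simp
  qed
  ultimately show ?thesis unfolding exec_def using assms(1) A by (intro exI[of _ ?D]) auto
qed

lemma terminates_Seq:
  assumes "terminates n g c s T1 Q1" "\<And>s'. Q1 s' \<Longrightarrow> terminates n g d s' T2 Q2"
  shows "terminates n g (Seq c d) s (T1 + T2 + 1) Q2"
  using assms unfolding terminates_def by (rule exec_Seq)

lemma terminates_If:
  assumes "bval s b \<Longrightarrow> terminates n g c s T Q" "\<not> bval s b \<Longrightarrow> terminates n g d s T Q"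
  shows "terminates n g (If b c d) s (T + 1) Q"
  using assms unfolding terminates_def by (rule exec_If)

lemma terminates_While:
  assumes "\<And>i s. i < N \<Longrightarrow> I i s \<Longrightarrow> bval s b \<and> terminates n g c s T (I (Suc i))"
    and "\<And>s. I N s \<Longrightarrow> \<not> bval s b" and "I 0 s"
  shows "terminates n g (While b c) s (N * (T + 2) + 1) (I N)"
  using exec_While[of N I b n g c T "\<lambda>_ _. 0" 0 s] assms unfolding terminates_def by simp

section \<open>Symbolic execution of straight-line code\<close>

primrec straight :: "com \<Rightarrow> bool" where
  "straight Skip = True"
| "straight (NAssign x u) = True"
| "straight (NStore a i u) = True"
| "straight (RAssign x u) = True"
| "straight (RStore a i u) = True"
| "straight (Query x a) = True"
| "straight (Rand x u) = False"
| "straight (Seq c d) = (straight c \<and> straight d)"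
| "straight (If b c d) = (straight c \<and> straight d)"
| "straight (While b c) = False"

primrec effect :: "nat \<Rightarrow> (nat set \<Rightarrow> real) \<Rightarrow> com \<Rightarrow> state \<Rightarrow> state" where
  "effect n g Skip s = s"
| "effect n g (NAssign x u) s = s\<lparr>nvar := (nvar s)(x := nval s u)\<rparr>"
| "effect n g (NStore a i u) s = s\<lparr>narr := (narr s)(a := (narr s a)(nval s i := nval s u))\<rparr>"
| "effect n g (RAssign x u) s = s\<lparr>rvar := (rvar s)(x := rval s u)\<rparr>"
| "effect n g (RStore a i u) s = s\<lparr>rarr := (rarr s)(a := (rarr s a)(nval s i := rval s u))\<rparr>"
| "effect n g (Query x a) s = s\<lparr>rvar := (rvar s)(x := g (array_set n s a))\<rparr>"
| "effect n g (Rand x u) s = s"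
| "effect n g (Seq c d) s = effect n g d (effect n g c s)"
| "effect n g (If b c d) s = (if bval s b then effect n g c s else effect n g d s)"
| "effect n g (While b c) s = s"

primrec duration :: "com \<Rightarrow> nat" where
  "duration Skip = 1"
| "duration (NAssign x u) = 1"
| "duration (NStore a i u) = 1"
| "duration (RAssign x u) = 1"
| "duration (RStore a i u) = 1"
| "duration (Query x a) = 1"
| "duration (Rand x u) = 1"
| "duration (Seq c d) = duration c + duration d + 1"
| "duration (If b c d) = max (duration c) (duration d) + 1"
| "duration (While b c) = 1"

lemma terminates_straight_eq: "straight c \<Longrightarrow> terminates n g c s (duration c) (\<lambda>s'. s' = effect n g c s)"
proof (induction c arbitrary: s)
  case (Seq c d)
  then show ?case unfolding duration.simps
    by (intro terminates_Seq[where ?Q1.0 = "\<lambda>s'. s' = effect n g c s"]) auto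
next
  case (If b c d)
  show ?case unfolding duration.simps
    by (rule terminates_If; rule terminates_mono) (use If in auto)
qed (auto simp: terminates_def intro!: exec_step[where ?\<phi> = "\<lambda>_. 0", unfolded One_nat_def])

lemma terminates_straight:
  assumes "straight c" "duration c \<le> T" "Q (effect n g c s)"
  shows "terminates n g c s T Q"
  using terminates_mono[OF terminates_straight_eq[OF assms(1)]] assms by auto

lemma steps_halted: "steps n g t ([], s) = return_pmf ([], s)"
  by (induction t) (auto simp: bind_return_pmf)

lemma exec_result:
  assumes "exec n g c s T Q \<phi> v" "T \<le> t"
  shows "\<forall>x\<in>set_pmf (steps n g t ([c], s)). halted x \<and> Q (snd x)"
    "v \<le> measure_pmf.expectation (steps n g t ([c], s)) (\<lambda>x. \<phi> (snd x))"
proof -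
  obtain D where D: "finite (set_pmf D)" "\<forall>x\<in>set_pmf D. snd x \<le> T \<and> Q (fst x)"
     "steps n g t ([c], s) = bind_pmf D (\<lambda>x. steps n g (t - snd x) ([], fst x))"
     "v \<le> measure_pmf.expectation D (\<lambda>x. \<phi> (fst x))"
    using assms unfolding exec_def by auto
  have eq: "steps n g t ([c], s) = map_pmf (\<lambda>x. ([], fst x)) D"
    unfolding D(3) steps_halted map_pmf_def ..
  show "\<forall>x\<in>set_pmf (steps n g t ([c], s)). halted x \<and> Q (snd x)"
    unfolding eq using D by (auto simp: halted_def)
  show "v \<le> measure_pmf.expectation (steps n g t ([c], s)) (\<lambda>x. \<phi> (snd x))"
    unfolding eq using D by simp
qed

section \<open>Selection by rank\<close>

text \<open>Ties are broken by the index, so the ranks form a permutation. The element of a given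
  rank is then found by counting comparisons, without moving array entries.\<close>

definition key_rank :: "(nat \<Rightarrow> real) \<Rightarrow> nat \<Rightarrow> nat \<Rightarrow> nat" where
  "key_rank key N i = card {j. j < N \<and> (key j < key i \<or> key j = key i \<and> j < i)}"

definition order_index :: "(nat \<Rightarrow> real) \<Rightarrow> nat \<Rightarrow> nat \<Rightarrow> nat" where
  "order_index key N = inv_into {..<N} (key_rank key N)"

lemma rank_mono:
  assumes "i < N" "key i < key i' \<or> key i = key i' \<and> i < i'"
  shows "key_rank key N i < key_rank key N i'"
  unfolding key_rank_def
proof (rule psubset_card_mono)
  show "{j. j < N \<and> (key j < key i \<or> key j = key i \<and> j < i)} \<subset> {j. j < N \<and> (key j < key i' \<or> key j = key i' \<and> j < i')}"
    using assms by auto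
qed auto

lemma rank_bij: "bij_betw (key_rank key N) {..<N} {..<N}"
proof -
  have inj: "inj_on (key_rank key N) {..<N}"
  proof (rule inj_onI)
    fix i i' assume i: "i \<in> {..<N}" "i' \<in> {..<N}" "key_rank key N i = key_rank key N i'"
    show "i = i'"
    proof (rule ccontr)
      assume "i \<noteq> i'"
      then have "(key i < key i' \<or> key i = key i' \<and> i < i') \<or> (key i' < key i \<or> key i' = key i \<and> i' < i)"
        by linarith
      then show False using rank_mono[of i N key i'] rank_mono[of i' N key i] i by auto
    qed
  qed
  have "key_rank key N i < N" if "i < N" for i
  proof -
    have "key_rank key N i \<le> card ({..<N} - {i})" unfolding key_rank_def by (intro card_mono) auto
    also have "\<dots> < N" using that by simp
    finally show ?thesis .
  qed
  then have "key_rank key N ` {..<N} \<subseteq> {..<N}" by auto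
  then have "key_rank key N ` {..<N} = {..<N}" using inj by (intro endo_inj_surj) auto
  then show ?thesis using inj by (simp add: bij_betw_def)
qed

lemma order_index_bij: "bij_betw (order_index key N) {..<N} {..<N}"
  unfolding order_index_def by (rule bij_betw_inv_into[OF rank_bij])

lemma order_index_less: "\<rho> < N \<Longrightarrow> order_index key N \<rho> < N"
  using order_index_bij[of key N] by (auto simp: bij_betw_def)

lemma rank_order_index: "\<rho> < N \<Longrightarrow> key_rank key N (order_index key N \<rho>) = \<rho>"
  using rank_bij[of key N] by (auto simp: order_index_def bij_betw_def f_inv_into_f)

lemma order_index_sorted:
  assumes "\<rho> < \<rho>'" "\<rho>' < N"
  shows "key (order_index key N \<rho>) \<le> key (order_index key N \<rho>')"
proof (rule ccontr)
  assume "\<not> ?thesis"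
  then have "key_rank key N (order_index key N \<rho>') < key_rank key N (order_index key N \<rho>)"
    using assms by (intro rank_mono order_index_less) auto
  then show False using assms by (simp add: rank_order_index)
qed

lemma sorted_tokens:
  assumes tok: "bij_betw tok {..<N} E" and key: "\<And>i. i < N \<Longrightarrow> karr i = key (tok i)"
  shows "bij_betw (tok \<circ> order_index karr N) {..<N} E"
    "\<And>i i'. i < i' \<Longrightarrow> i' < N \<Longrightarrow> key ((tok \<circ> order_index karr N) i) \<le> key ((tok \<circ> order_index karr N) i')"
proof -
  show "bij_betw (tok \<circ> order_index karr N) {..<N} E"
    by (rule bij_betw_trans[OF order_index_bij tok])
  fix i i' assume i: "i < i'" "i' < N"
  then have "karr (order_index karr N i) \<le> karr (order_index karr N i')" by (rule order_index_sorted)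
  then show "key ((tok \<circ> order_index karr N) i) \<le> key ((tok \<circ> order_index karr N) i')"
    using key order_index_less i by simp
qed

lemma bij_betw_append:
  assumes "bij_betw tok {..<N} E" "x \<notin> E"
  shows "bij_betw (tok(N := x)) {..<Suc N} (insert x E)"
proof -
  have "bij_betw (tok(N := x)) {..<N} E" using assms(1) by (rule bij_betw_cong[THEN iffD1, rotated]) auto
  then have "bij_betw (tok(N := x)) ({..<N} \<union> {N}) (E \<union> {x})"
    by (intro bij_betw_combine) (use assms in \<open>auto simp: bij_betw_def\<close>)
  then show ?thesis by (simp add: lessThan_Suc)
qed

abbreviation "NEq u v \<equiv> BAnd (BNot (NLess u v)) (BNot (NLess v u))"

lemma bval_NEq [simp]: "bval s (NEq u v) \<longleftrightarrow> nval s u = nval s v" by auto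

text \<open>A frame condition on scalars and natural arrays. Real arrays hold only keys and are
  tracked separately where they must survive.\<close>

definition agree :: "nat set \<Rightarrow> nat set \<Rightarrow> nat set \<Rightarrow> state \<Rightarrow> state \<Rightarrow> bool" where
  "agree V A W s s' \<longleftrightarrow> (\<forall>x. x \<notin> V \<longrightarrow> nvar s' x = nvar s x) \<and> (\<forall>a. a \<notin> A \<longrightarrow> narr s' a = narr s a)
     \<and> (\<forall>x. x \<notin> W \<longrightarrow> rvar s' x = rvar s x)"

lemma agree_trans: "agree V A W s s' \<Longrightarrow> agree V A W s' s'' \<Longrightarrow> agree V A W s s''"
  by (simp add: agree_def)

lemma agree_mono: "agree V A W s s' \<Longrightarrow> V \<subseteq> V' \<Longrightarrow> A \<subseteq> A' \<Longrightarrow> W \<subseteq> W' \<Longrightarrow> agree V' A' W' s s'"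
  unfolding agree_def by blast

lemma agreeD:
  assumes "agree V A W s s'"
  shows "x \<notin> V \<Longrightarrow> nvar s' x = nvar s x" "a \<notin> A \<Longrightarrow> narr s' a = narr s a" "x \<notin> W \<Longrightarrow> rvar s' x = rvar s x"
  using assms by (auto simp: agree_def)

text \<open>
  Registers: \<open>5\<close> holds the number of keys in real array \<open>0\<close>, \<open>10\<close> the requested rank, \<open>9\<close> the resulting
  index; \<open>6\<close>, \<open>7\<close>, \<open>8\<close> are local.
\<close>

definition count_body :: com where
  "count_body = Seq
     (If (RLess (RArr 0 (NVar 7)) (RArr 0 (NVar 6))) (NAssign 8 (NAdd (NVar 8) (NConst 1)))
       (If (BAnd (BNot (RLess (RArr 0 (NVar 6)) (RArr 0 (NVar 7)))) (NLess (NVar 7) (NVar 6)))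
         (NAssign 8 (NAdd (NVar 8) (NConst 1))) Skip))
     (NAssign 7 (NAdd (NVar 7) (NConst 1)))"

definition rank_body :: com where
  "rank_body = Seq (Seq (NAssign 7 (NConst 0)) (NAssign 8 (NConst 0)))
     (Seq (While (NLess (NVar 7) (NVar 5)) count_body)
       (Seq (If (NEq (NVar 8) (NVar 10)) (NAssign 9 (NVar 6)) Skip)
         (NAssign 6 (NAdd (NVar 6) (NConst 1)))))"

definition select :: com where
  "select = Seq (NAssign 6 (NConst 0)) (While (NLess (NVar 6) (NVar 5)) rank_body)"

lemma rank_body_terminates:
  assumes i: "nvar s 6 = i" and N: "nvar s 5 = N"
  shows "terminates n g rank_body s (N * 20 + 20) (\<lambda>s'. agree {6,7,8,9} {} {} s s' \<and> rarr s' = rarr s \<and> nvar s' 6 = Suc i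
    \<and> nvar s' 9 = (if key_rank (rarr s 0) N i = nvar s 10 then i else nvar s 9))"
proof -
  define pre where "pre j = {l. l < j \<and> (rarr s 0 l < rarr s 0 i \<or> rarr s 0 l = rarr s 0 i \<and> l < i)}" for j
  have pre_Suc: "card (pre (Suc j)) = card (pre j) + (if rarr s 0 j < rarr s 0 i \<or> rarr s 0 j = rarr s 0 i \<and> j < i then 1 else 0)" for j
  proof -
    have "pre (Suc j) = (if rarr s 0 j < rarr s 0 i \<or> rarr s 0 j = rarr s 0 i \<and> j < i then insert j (pre j) else pre j)"
      unfolding pre_def by (auto simp: less_Suc_eq)
    moreover have "j \<notin> pre j" "finite (pre j)" unfolding pre_def by auto
    ultimately show ?thesis by simp
  qed
  let ?I = "\<lambda>j s'. agree {7,8} {} {} s s' \<and> rarr s' = rarr s \<and> nvar s' 7 = j \<and> nvar s' 8 = card (pre j)"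
  let ?Q0 = "\<lambda>s'. ?I 0 s'"
  have loop: "terminates n g (While (NLess (NVar 7) (NVar 5)) count_body) s1 (N * (9 + 2) + 1) (?I N)" if "?I 0 s1" for s1
  proof (rule terminates_While[where I = ?I])
    fix j s' assume j: "j < N" and I: "?I j s'"
    have v: "nvar s' 5 = N" "nvar s' 6 = i" using I i N by (auto simp: agree_def)
    have "terminates n g count_body s' 9 (?I (Suc j))"
    proof (rule terminates_straight)
      show "?I (Suc j) (effect n g count_body s')"
        unfolding count_body_def using I v by (auto simp: agree_def pre_Suc)
    qed (auto simp: count_body_def)
    then show "bval s' (NLess (NVar 7) (NVar 5)) \<and> terminates n g count_body s' 9 (?I (Suc j))" using I v j by auto
  next
    show "\<And>s'. ?I N s' \<Longrightarrow> \<not> bval s' (NLess (NVar 7) (NVar 5))" using N by (auto simp: agree_def)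
  qed (rule that)
  have rk: "card (pre N) = key_rank (rarr s 0) N i" unfolding pre_def key_rank_def ..
  show ?thesis
    unfolding rank_body_def
  proof (rule terminates_mono[OF terminates_Seq[where ?Q1.0 = ?Q0]])
    show "terminates n g (Seq (NAssign 7 (NConst 0)) (NAssign 8 (NConst 0))) s 3 ?Q0"
      by (rule terminates_straight) (auto simp: agree_def pre_def)
    fix s1 assume s1: "?Q0 s1"
    show "terminates n g (Seq (While (NLess (NVar 7) (NVar 5)) count_body)
       (Seq (If (NEq (NVar 8) (NVar 10)) (NAssign 9 (NVar 6)) Skip)
         (NAssign 6 (NAdd (NVar 6) (NConst 1))))) s1 ((N * (9 + 2) + 1) + 4 + 1) (\<lambda>s'. agree {6,7,8,9} {} {} s s' \<and> rarr s' = rarr s \<and> nvar s' 6 = Suc i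
    \<and> nvar s' 9 = (if key_rank (rarr s 0) N i = nvar s 10 then i else nvar s 9))"
    proof (rule terminates_Seq[OF loop[OF s1]])
      fix s2 assume s2: "?I N s2"
      have v: "nvar s2 6 = i" "nvar s2 10 = nvar s 10" "nvar s2 9 = nvar s 9" using s2 i by (auto simp: agree_def)
      show "terminates n g (Seq (If (NEq (NVar 8) (NVar 10)) (NAssign 9 (NVar 6)) Skip)
         (NAssign 6 (NAdd (NVar 6) (NConst 1)))) s2 4 (\<lambda>s'. agree {6,7,8,9} {} {} s s' \<and> rarr s' = rarr s \<and> nvar s' 6 = Suc i
    \<and> nvar s' 9 = (if key_rank (rarr s 0) N i = nvar s 10 then i else nvar s 9))"
        by (rule terminates_straight) (use s2 v rk in \<open>auto simp: agree_def\<close>)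
    qed
  qed auto
qed

lemma select_terminates:
  assumes N: "nvar s 5 = N"
  shows "terminates n g select s (N * (N * 20 + 22) + 3) (\<lambda>s'. agree {6,7,8,9} {} {} s s' \<and> rarr s' = rarr s \<and>
    (nvar s 10 < N \<longrightarrow> nvar s' 9 = order_index (rarr s 0) N (nvar s 10)))"
proof -
  let ?\<rho> = "nvar s 10"
  let ?I = "\<lambda>i s'. agree {6,7,8,9} {} {} s s' \<and> rarr s' = rarr s \<and> nvar s' 6 = i
    \<and> (\<forall>l<i. key_rank (rarr s 0) N l = ?\<rho> \<longrightarrow> nvar s' 9 = l)"
  have loop: "terminates n g (While (NLess (NVar 6) (NVar 5)) rank_body) s1 (N * ((N * 20 + 20) + 2) + 1) (?I N)" if "?I 0 s1" for s1
  proof (rule terminates_While[where I = ?I])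
    fix i s' assume i: "i < N" and I: "?I i s'"
    have v: "nvar s' 5 = N" "nvar s' 6 = i" "nvar s' 10 = ?\<rho>" using I N by (auto simp: agree_def)
    have "terminates n g rank_body s' (N * 20 + 20) (?I (Suc i))"
    proof (rule terminates_mono[OF rank_body_terminates[OF v(2,1)]])
      fix s'' assume Q: "agree {6,7,8,9} {} {} s' s'' \<and> rarr s'' = rarr s' \<and> nvar s'' 6 = Suc i
          \<and> nvar s'' 9 = (if key_rank (rarr s' 0) N i = nvar s' 10 then i else nvar s' 9)"
      have "nvar s'' 9 = l" if l: "l < Suc i" "key_rank (rarr s 0) N l = ?\<rho>" for l
      proof (cases "l = i")
        case True
        then show ?thesis using Q I l v by auto
      next
        case False
        then have "l < i" using l by auto
        then have "nvar s' 9 = l" using I l by auto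
        moreover have "key_rank (rarr s 0) N i \<noteq> ?\<rho>"
          using inj_on_eq_iff[OF bij_betw_imp_inj_on[OF rank_bij[of "rarr s 0" N]], of l i] l \<open>l < i\<close> i by auto
        ultimately show ?thesis using Q I v by auto
      qed
      moreover have "agree {6,7,8,9} {} {} s s''" using agree_trans[of "{6,7,8,9}" "{}" "{}" s s' s''] Q I by blast
      ultimately show "?I (Suc i) s''" using Q I by simp
    qed auto
    then show "bval s' (NLess (NVar 6) (NVar 5)) \<and> terminates n g rank_body s' (N * 20 + 20) (?I (Suc i))" using v i by auto
  next
    show "\<And>s'. ?I N s' \<Longrightarrow> \<not> bval s' (NLess (NVar 6) (NVar 5))" using N by (auto simp: agree_def)
  qed (rule that)
  show ?thesis
    unfolding select_def
  proof (rule terminates_mono[OF terminates_Seq[where ?Q1.0 = "?I 0"]])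
    show "terminates n g (NAssign 6 (NConst 0)) s 1 (?I 0)"
      by (rule terminates_straight) (auto simp: agree_def)
    show "\<And>s1. ?I 0 s1 \<Longrightarrow> terminates n g (While (NLess (NVar 6) (NVar 5)) rank_body) s1 (N * ((N * 20 + 20) + 2) + 1) (?I N)"
      by (rule loop)
    fix s' assume I: "?I N s'"
    have "nvar s' 9 = order_index (rarr s 0) N ?\<rho>" if "?\<rho> < N"
      using I order_index_less[OF that, of "rarr s 0"] rank_order_index[OF that, of "rarr s 0"] by blast
    then show "agree {6,7,8,9} {} {} s s' \<and> rarr s' = rarr s \<and> (?\<rho> < N \<longrightarrow> nvar s' 9 = order_index (rarr s 0) N ?\<rho>)"
      using I by blast
  qed auto
qed

section \<open>Random greedy as a program\<close>

text \<open>
  Registers \<open>3\<close> and \<open>4\<close> hold the array entries that stand for membership and non-membership.  Exchanging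
  \<open>1\<close> and \<open>0\<close> makes the same program maximize the complement function under the complementary
  cardinality constraint, and the output array then holds the complement of the set it found.
\<close>

definition flags :: "state \<Rightarrow> bool" where
  "flags s \<longleftrightarrow> (nvar s 3 = 1 \<and> nvar s 4 = 0) \<or> (nvar s 3 = 0 \<and> nvar s 4 = 1)"

definition valid :: "nat \<Rightarrow> state \<Rightarrow> nat \<Rightarrow> bool" where
  "valid n s a \<longleftrightarrow> (\<forall>i<n. narr s a i = nvar s 3 \<or> narr s a i = nvar s 4)"

definition members :: "nat \<Rightarrow> state \<Rightarrow> nat \<Rightarrow> nat set" where
  "members n s a = {i. i < n \<and> narr s a i = nvar s 3}"

definition oracle_of :: "nat \<Rightarrow> (nat set \<Rightarrow> real) \<Rightarrow> nat \<Rightarrow> nat set \<Rightarrow> real" where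
  "oracle_of n g b A = (if b = 1 then g A else g ({..<n} - A))"

lemma flags_neq: "flags s \<Longrightarrow> nvar s 3 \<noteq> nvar s 4" by (auto simp: flags_def)

lemma query_value:
  assumes "flags s" "valid n s a"
  shows "g (array_set n s a) = oracle_of n g (nvar s 3) (members n s a)"
proof (cases "nvar s 3 = 1")
  case True
  then have "nvar s 4 = 0" using assms by (auto simp: flags_def)
  then have "array_set n s a = members n s a"
    using assms True unfolding array_set_def members_def valid_def by fastforce
  then show ?thesis using True by (simp add: oracle_of_def)
next
  case False
  then have f: "nvar s 3 = 0" "nvar s 4 = 1" using assms by (auto simp: flags_def)
  then have "array_set n s a = {..<n} - members n s a"
    using assms unfolding array_set_def members_def valid_def by fastforce
  then show ?thesis using False by (simp add: oracle_of_def)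
qed

lemma query_insert:
  assumes "flags s" "valid n s a" "u < n"
  shows "g (array_set n (s\<lparr>narr := (narr s)(a := (narr s a)(u := nvar s 3))\<rparr>) a)
     = oracle_of n g (nvar s 3) (insert u (members n s a))"
proof -
  let ?s = "s\<lparr>narr := (narr s)(a := (narr s a)(u := nvar s 3))\<rparr>"
  have "flags ?s" "valid n ?s a" using assms by (auto simp: flags_def valid_def)
  moreover have "members n ?s a = insert u (members n s a)" using assms by (auto simp: members_def)
  ultimately show ?thesis using query_value[of ?s n a g] by simp
qed

lemma query_swap:
  assumes "flags s" "valid n s a" "u < n" "v < n" "u \<noteq> v"
  shows "g (array_set n (s\<lparr>narr := (narr s)(a := (narr s a)(u := nvar s 4, v := nvar s 3))\<rparr>) a)
     = oracle_of n g (nvar s 3) (insert v (members n s a - {u}))"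
proof -
  let ?s = "s\<lparr>narr := (narr s)(a := (narr s a)(u := nvar s 4, v := nvar s 3))\<rparr>"
  have "flags ?s" "valid n ?s a" using assms by (auto simp: flags_def valid_def)
  moreover have "members n ?s a = insert v (members n s a - {u})"
    using assms flags_neq[OF assms(1)] by (auto simp: members_def)
  ultimately show ?thesis using query_value[of ?s n a g] by simp
qed

lemma not_member:
  assumes "valid n s a" "flags s" "u < n"
  shows "narr s a u = nvar s 4 \<longleftrightarrow> u \<notin> members n s a"
  using assms flags_neq[OF assms(2)] unfolding members_def valid_def by auto

definition greedy_cond :: bexp where
  "greedy_cond = BAnd (NEq (NArr 0 (NVar 15)) (NVar 4))
     (BNot (BAnd (NLess (NVar 11) (NVar 12)) (NEq (NArr 1 (NVar 15)) (NVar 3))))"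

lemma bval_greedy_cond: "bval s greedy_cond \<longleftrightarrow> narr s 0 (nvar s 15) = nvar s 4 \<and>
    \<not> (nvar s 11 < nvar s 12 \<and> narr s 1 (nvar s 15) = nvar s 3)"
  unfolding greedy_cond_def by auto

text \<open>Keys are stored with reversed sign because \<open>select\<close> ranks upwards while
  greedy wants the best values first. The set is restored after each query.\<close>

definition greedy_fill_body :: com where
  "greedy_fill_body = Seq
    (If greedy_cond
      (Seq (NStore 0 (NVar 15) (NVar 3)) (Seq (Query 0 0) (Seq (NStore 0 (NVar 15) (NVar 4))
        (Seq (RStore 0 (NVar 5) (RSub RZero (RVar 0))) (Seq (NStore 3 (NVar 5) (NVar 15))
          (NAssign 5 (NAdd (NVar 5) (NConst 1)))))))) Skip)
    (NAssign 15 (NAdd (NVar 15) (NConst 1)))"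

definition greedy_fill :: com where
  "greedy_fill = Seq (Seq (NAssign 5 (NConst 0)) (NAssign 15 (NConst 0)))
     (While (NLess (NVar 15) (NVar 0)) greedy_fill_body)"

definition greedy_step :: com where
  "greedy_step = Seq greedy_fill (Seq (Rand 10 (NSub (NVar 2) (NConst 1))) (Seq select
     (Seq (NStore 0 (NArr 3 (NVar 9)) (NVar 3)) (NAssign 11 (NAdd (NVar 11) (NConst 1))))))"

definition greedy_eligible :: "nat \<Rightarrow> state \<Rightarrow> nat set" where
  "greedy_eligible n s = (if nvar s 11 < nvar s 12 then {..<n} - members n s 1 - members n s 0
     else {..<n} - members n s 0)"

lemma greedy_fill_terminates:
  fixes g :: "nat set \<Rightarrow> real"
  assumes n: "nvar s 0 = n" and fl: "flags s" and va: "valid n s 0" "valid n s 1"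
  defines "F \<equiv> oracle_of n g (nvar s 3)" and "S \<equiv> members n s 0"
  shows "terminates n g greedy_fill s (n * 30 + 6) (\<lambda>s'. agree {5,15} {3} {0} s s' \<and>
     bij_betw (narr s' 3) {..<nvar s' 5} (greedy_eligible n s) \<and>
     (\<forall>i<nvar s' 5. rarr s' 0 i = - F (insert (narr s' 3 i) S)))"
proof -
  let ?E = "greedy_eligible n s"
  let ?I = "\<lambda>u s'. agree {5,15} {3} {0} s s' \<and> nvar s' 15 = u \<and>
     bij_betw (narr s' 3) {..<nvar s' 5} (?E \<inter> {..<u}) \<and>
     (\<forall>i<nvar s' 5. rarr s' 0 i = - F (insert (narr s' 3 i) S))"
  have body: "terminates n g greedy_fill_body s' 20 (?I (Suc u))" if u: "u < n" and I: "?I u s'" for u s'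
  proof (rule terminates_straight)
    have v: "nvar s' 0 = n" "nvar s' 3 = nvar s 3" "nvar s' 4 = nvar s 4" "nvar s' 11 = nvar s 11" "nvar s' 12 = nvar s 12"
      "narr s' 0 = narr s 0" "narr s' 1 = narr s 1" "nvar s' 15 = u"
      using I n by (auto simp: agree_def)
    have fl': "flags s'" and va': "valid n s' 0" "valid n s' 1" using fl va v by (auto simp: flags_def valid_def)
    have S': "members n s' 0 = S" "members n s' 1 = members n s 1" unfolding S_def members_def v by auto
    let ?c = "narr s' 0 u = nvar s' 4 \<and> \<not> (nvar s' 11 < nvar s' 12 \<and> narr s' 1 u = nvar s' 3)"
    have elig: "?c \<longleftrightarrow> u \<in> ?E"
      using not_member[OF va'(1) fl' u] u unfolding S' greedy_eligible_def S_def[symmetric] v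
      by (auto simp: members_def)
    show "?I (Suc u) (effect n g greedy_fill_body s')"
    proof (cases ?c)
      case False
      then have "u \<notin> ?E" using elig by blast
      then have "?E \<inter> {..<Suc u} = ?E \<inter> {..<u}" by (auto simp: less_Suc_eq)
      moreover have "effect n g greedy_fill_body s' = s'\<lparr>nvar := (nvar s')(15 := Suc u)\<rparr>"
      proof -
        have "\<not> bval s' greedy_cond" using False v(8) by (simp add: bval_greedy_cond)
        then show ?thesis using v(8) unfolding greedy_fill_body_def by simp
      qed
      ultimately show ?thesis using I by (auto simp: agree_def)
    next
      case True
      then have uE: "u \<in> ?E" using elig by blast
      let ?N = "nvar s' 5"
      have q: "g (array_set n (s'\<lparr>narr := (narr s')(0 := (narr s' 0)(u := nvar s' 3))\<rparr>) 0) = F (insert u S)"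
        using query_insert[OF fl' va'(1) u, of g] unfolding S' F_def v by simp
      have triv: "(narr s' 0)(u := nvar s' 4) = narr s' 0" using True by (simp add: fun_upd_idem)
      have cond: "bval s' greedy_cond" using True v(8) by (simp add: bval_greedy_cond)
      have eff: "nvar (effect n g greedy_fill_body s') = (nvar s')(5 := Suc ?N, 15 := Suc u)"
        "narr (effect n g greedy_fill_body s') = (narr s')(3 := (narr s' 3)(?N := u))"
        "\<And>x. x \<noteq> 0 \<Longrightarrow> rvar (effect n g greedy_fill_body s') x = rvar s' x"
        "rarr (effect n g greedy_fill_body s') 0 = (rarr s' 0)(?N := - F (insert u S))"
        unfolding greedy_fill_body_def by (simp_all add: cond v(8) q triv)
      have Eu: "?E \<inter> {..<Suc u} = insert u (?E \<inter> {..<u})" using uE by (auto simp: less_Suc_eq)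
      have "bij_betw ((narr s' 3)(?N := u)) {..<Suc ?N} (?E \<inter> {..<Suc u})"
        unfolding Eu using I by (intro bij_betw_append) auto
      then show ?thesis using I eff by (auto simp: agree_def less_Suc_eq)
    qed
  qed (auto simp: greedy_fill_body_def)
  show ?thesis
    unfolding greedy_fill_def
  proof (rule terminates_mono[OF terminates_Seq[where ?Q1.0 = "?I 0"]])
    show "terminates n g (Seq (NAssign 5 (NConst 0)) (NAssign 15 (NConst 0))) s 3 (?I 0)"
      by (rule terminates_straight) (auto simp: agree_def bij_betw_def)
    show "terminates n g (While (NLess (NVar 15) (NVar 0)) greedy_fill_body) s1 (n * (20 + 2) + 1) (?I n)" if "?I 0 s1" for s1
    proof (rule terminates_While[where I = ?I])
      fix u s' assume u: "u < n" and I: "?I u s'"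
      have "nvar s' 0 = n" using I n by (auto simp: agree_def)
      then show "bval s' (NLess (NVar 15) (NVar 0)) \<and> terminates n g greedy_fill_body s' 20 (?I (Suc u))"
        using body[OF u I] u I by auto
    next
      show "\<And>s'. ?I n s' \<Longrightarrow> \<not> bval s' (NLess (NVar 15) (NVar 0))" using n by (auto simp: agree_def)
    qed (rule that)
    have "?E \<inter> {..<n} = ?E" by (auto simp: greedy_eligible_def)
    then show "\<And>s'. ?I n s' \<Longrightarrow> agree {5,15} {3} {0} s s' \<and>
     bij_betw (narr s' 3) {..<nvar s' 5} (greedy_eligible n s) \<and>
     (\<forall>i<nvar s' 5. rarr s' 0 i = - F (insert (narr s' 3 i) S))" by auto
  qed auto
qed

definition greedy_inv :: "nat \<Rightarrow> nat \<Rightarrow> nat \<Rightarrow> nat \<Rightarrow> nat set \<Rightarrow> nat \<Rightarrow> state \<Rightarrow> bool" where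
  "greedy_inv n \<kappa> t b Z i s \<longleftrightarrow> nvar s 0 = n \<and> nvar s 2 = \<kappa> \<and> nvar s 12 = t \<and> nvar s 3 = b \<and> flags s \<and>
     valid n s 0 \<and> valid n s 1 \<and> members n s 1 = Z \<and> nvar s 11 = i \<and> card (members n s 0) = i \<and>
     (i \<le> t \<longrightarrow> members n s 0 \<inter> Z = {})"

text \<open>A rank drawn from the first \<open>\<kappa>\<close> is a uniformly random one of the
  \<open>\<kappa>\<close> best candidates. \<open>V\<close> is left abstract, so one program proof
  serves plain and aided greedy and the case of a constant potential.\<close>

lemma greedy_step_exec:
  assumes inv: "greedy_inv n \<kappa> t b Z i s" and i: "i < \<kappa>" and \<kappa>: "4 * \<kappa> \<le> n" "card Z = \<kappa>"
    and step: "\<And>S E \<sigma> N. S \<subseteq> {..<n} \<Longrightarrow> card S = i \<Longrightarrow> (i < t \<Longrightarrow> S \<inter> Z = {}) \<Longrightarrow>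
       E = (if i < t then {..<n} - Z - S else {..<n} - S) \<Longrightarrow> bij_betw \<sigma> {..<N} E \<Longrightarrow> \<kappa> \<le> N \<Longrightarrow>
       (\<And>j j'. j < j' \<Longrightarrow> j' < N \<Longrightarrow> oracle_of n g b (insert (\<sigma> j') S) \<le> oracle_of n g b (insert (\<sigma> j) S)) \<Longrightarrow>
       real \<kappa> * V i S \<le> (\<Sum>j<\<kappa>. V (Suc i) (insert (\<sigma> j) S))"
  shows "exec n g greedy_step s (n * 30 + (n * (n * 20 + 22)) + 30) (greedy_inv n \<kappa> t b Z (Suc i))
     (\<lambda>s'. V (Suc i) (members n s' 0)) (V i (members n s 0))"
proof -
  define S where "S = members n s 0"
  define F where "F = oracle_of n g b"
  have s: "nvar s 0 = n" "nvar s 2 = \<kappa>" "nvar s 12 = t" "nvar s 3 = b" "flags s"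
     "valid n s 0" "valid n s 1" "members n s 1 = Z" "nvar s 11 = i" "card S = i" "i \<le> t \<Longrightarrow> S \<inter> Z = {}"
    using inv unfolding greedy_inv_def S_def by auto
  define E where "E = (if i < t then {..<n} - Z - S else {..<n} - S)"
  have E: "greedy_eligible n s = E" unfolding greedy_eligible_def E_def s S_def ..
  have SU: "S \<subseteq> {..<n}" "Z \<subseteq> {..<n}" using s(8) by (auto simp: S_def members_def)
  have EU: "E \<subseteq> {..<n}" unfolding E_def by auto
  have cE: "\<kappa> \<le> card E"
  proof -
    have "card (Z \<union> S) \<le> \<kappa> + i" using card_Un_le[of Z S] \<kappa> s(10) by simp
    moreover have "card ({..<n} - (Z \<union> S)) = n - card (Z \<union> S)"
      using SU by (subst card_Diff_subset) (auto intro: finite_subset)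
    moreover have "card ({..<n} - (Z \<union> S)) \<le> card E" unfolding E_def by (intro card_mono) auto
    ultimately show ?thesis using i \<kappa> by linarith
  qed
  let ?Q1 = "\<lambda>s'. agree {5,15} {3} {0} s s' \<and> bij_betw (narr s' 3) {..<nvar s' 5} E \<and>
     (\<forall>i<nvar s' 5. rarr s' 0 i = - F (insert (narr s' 3 i) S))"
  let ?post = "\<lambda>s'. V (Suc i) (members n s' 0)"
  have fill: "terminates n g greedy_fill s (n * 30 + 6) ?Q1"
    using greedy_fill_terminates[OF s(1,5,6,7), of g] unfolding E F_def S_def s(4) .
  show ?thesis
    unfolding greedy_step_def S_def[symmetric]
  proof (rule exec_mono[OF exec_Seq[OF exec_terminates[OF fill, of "V i S" "\<lambda>_. V i S"]]])
    fix s1 assume Q1: "?Q1 s1"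
    define N where "N = nvar s1 5"
    have N: "N = card E" using bij_betw_same_card[of "narr s1 3" "{..<N}" E] Q1 unfolding N_def by simp
    have NU: "N \<le> n" unfolding N using card_mono[OF _ EU] by simp
    define \<sigma> where "\<sigma> = narr s1 3 \<circ> order_index (rarr s1 0) N"
    have \<sigma>: "bij_betw \<sigma> {..<N} E" unfolding \<sigma>_def N_def using Q1 by (intro sorted_tokens(1)) auto
    have srt: "F (insert (\<sigma> j') S) \<le> F (insert (\<sigma> j) S)" if "j < j'" "j' < N" for j j'
    proof -
      have "(\<lambda>u. - F (insert u S)) (\<sigma> j) \<le> (\<lambda>u. - F (insert u S)) (\<sigma> j')"
        unfolding \<sigma>_def N_def
        by (rule sorted_tokens(2)[where E = E]) (use Q1 that in \<open>auto simp: N_def\<close>)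
      then show ?thesis by simp
    qed
    have ineq: "real \<kappa> * V i S \<le> (\<Sum>j<\<kappa>. V (Suc i) (insert (\<sigma> j) S))"
    proof (rule step[OF SU(1) s(10) _ E_def \<sigma>])
      show "i < t \<Longrightarrow> S \<inter> Z = {}" using s(11) by simp
      show "\<kappa> \<le> N" using N cE by simp
    qed (use srt in \<open>simp add: F_def\<close>)
    have k2: "nvar s1 2 = \<kappa>" using agreeD(1)[of "{5,15}" "{3}" "{0}" s s1 2] Q1 s(2) by simp
    let ?Q2 = "\<lambda>s2. \<exists>r<\<kappa>. s2 = s1\<lparr>nvar := (nvar s1)(10 := r)\<rparr>"
    show "exec n g (Seq (Rand 10 (NSub (NVar 2) (NConst 1))) (Seq select
     (Seq (NStore 0 (NArr 3 (NVar 9)) (NVar 3)) (NAssign 11 (NAdd (NVar 11) (NConst 1)))))) s1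
       (1 + ((n * (n * 20 + 22) + 3) + 3 + 1) + 1) (greedy_inv n \<kappa> t b Z (Suc i)) ?post (V i S)"
    proof (rule exec_Seq[where ?Q1.0 = ?Q2 and ?\<phi>1.0 = "\<lambda>s2. V (Suc i) (insert (\<sigma> (nvar s2 10)) S)"])
      show "exec n g (Rand 10 (NSub (NVar 2) (NConst 1))) s1 1 ?Q2 (\<lambda>s2. V (Suc i) (insert (\<sigma> (nvar s2 10)) S)) (V i S)"
      proof (rule exec_Rand)
        have e: "nval s1 (NSub (NVar 2) (NConst 1)) + 1 = \<kappa>" using k2 i by simp
        show "V i S * real (nval s1 (NSub (NVar 2) (NConst 1)) + 1) \<le> (\<Sum>r<nval s1 (NSub (NVar 2) (NConst 1)) + 1.
           V (Suc i) (insert (\<sigma> (nvar (s1\<lparr>nvar := (nvar s1)(10 := r)\<rparr>) 10)) S))"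
          unfolding e using ineq by (simp add: mult.commute)
        fix r assume "r \<le> nval s1 (NSub (NVar 2) (NConst 1))"
        then have "r < \<kappa>" using e by linarith
        then show "?Q2 (s1\<lparr>nvar := (nvar s1)(10 := r)\<rparr>)" by blast
      qed
    next
      fix s2 assume "?Q2 s2"
      then obtain r where r: "r < \<kappa>" and s2: "s2 = s1\<lparr>nvar := (nvar s1)(10 := r)\<rparr>" by auto
      have rN: "r < N" using r cE N by simp
      let ?Q3 = "\<lambda>s3. agree {6,7,8,9} {} {} s2 s3 \<and> rarr s3 = rarr s2 \<and> nvar s3 9 = order_index (rarr s1 0) N r"
      have sel: "terminates n g select s2 (n * (n * 20 + 22) + 3) ?Q3"
      proof (rule terminates_mono[OF select_terminates[of s2 N]])
        show "nvar s2 5 = N" unfolding s2 N_def by simp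
        show "N * (N * 20 + 22) + 3 \<le> n * (n * 20 + 22) + 3" using NU by (intro add_mono mult_mono) auto
        fix s3 assume "agree {6,7,8,9} {} {} s2 s3 \<and> rarr s3 = rarr s2 \<and>
           (nvar s2 10 < N \<longrightarrow> nvar s3 9 = order_index (rarr s2 0) N (nvar s2 10))"
        then show "?Q3 s3" using rN unfolding s2 by simp
      qed
      have fin: "terminates n g (Seq (NStore 0 (NArr 3 (NVar 9)) (NVar 3)) (NAssign 11 (NAdd (NVar 11) (NConst 1)))) s3 3
          (\<lambda>s4. greedy_inv n \<kappa> t b Z (Suc i) s4 \<and> members n s4 0 = insert (\<sigma> r) S)" if Q3: "?Q3 s3" for s3
      proof (rule terminates_straight)
        let ?u = "\<sigma> r"
        have ag: "agree {6,7,8,9} {} {} s2 s3" "agree {5,15} {3} {0} s s1" using Q3 Q1 by blast+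
        have nv: "nvar s3 x = nvar s x" if "x \<notin> {5,15,6,7,8,9,10}" for x
        proof -
          have "nvar s3 x = nvar s2 x" using that by (intro agreeD(1)[OF ag(1)]) auto
          also have "\<dots> = nvar s1 x" using that unfolding s2 by simp
          also have "\<dots> = nvar s x" using that by (intro agreeD(1)[OF ag(2)]) auto
          finally show ?thesis .
        qed
        have na3: "narr s3 a = narr s1 a" for a using agreeD(2)[OF ag(1), of a] unfolding s2 by simp
        have na: "narr s3 a = narr s a" if "a \<noteq> 3" for a
          unfolding na3 using that by (intro agreeD(2)[OF ag(2)]) auto
        have nvs: "nvar s3 0 = n" "nvar s3 2 = \<kappa>" "nvar s3 12 = t" "nvar s3 3 = b" "nvar s3 4 = nvar s 4" "nvar s3 11 = i"
          using nv s(1,2,3,4,9) by simp_all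
        have u: "narr s3 3 (nvar s3 9) = ?u" unfolding na3 \<sigma>_def using Q3 by simp
        have uE: "?u \<in> E" using \<sigma> rN by (auto simp: bij_betw_def)
        then have uU: "?u < n" "?u \<notin> S" using EU by (auto simp: E_def split: if_splits)
        have uZ: "i < t \<Longrightarrow> ?u \<notin> Z" using uE by (simp add: E_def)
        define s4 where "s4 = effect n g (Seq (NStore 0 (NArr 3 (NVar 9)) (NVar 3)) (NAssign 11 (NAdd (NVar 11) (NConst 1)))) s3"
        have s4: "nvar s4 = (nvar s3)(11 := Suc i)" "narr s4 = (narr s3)(0 := (narr s3 0)(?u := nvar s3 3))"
          unfolding s4_def using u nvs(6) by simp_all
        have m0: "members n s4 0 = insert ?u S"
          unfolding members_def S_def s4 using uU(1) by (auto simp: nvs na s(4))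
        have m1: "members n s4 1 = Z" using s(8) unfolding members_def s4 by (simp add: nvs na s(4))
        have fl4: "flags s4" using s(5) by (simp add: flags_def s4 nvs s(4))
        have va4: "valid n s4 0" "valid n s4 1" using s(6,7) by (simp_all add: valid_def s4 nvs na s(4))
        have dis: "Suc i \<le> t \<Longrightarrow> insert ?u S \<inter> Z = {}" using s(11) uZ by auto
        have fS: "finite S" using SU finite_subset by blast
        have "greedy_inv n \<kappa> t b Z (Suc i) s4"
          unfolding greedy_inv_def m0 m1 using fl4 va4 dis uU(2) fS s(10) by (simp add: s4 nvs)
        then show "greedy_inv n \<kappa> t b Z (Suc i) (effect n g (Seq (NStore 0 (NArr 3 (NVar 9)) (NVar 3)) (NAssign 11 (NAdd (NVar 11) (NConst 1)))) s3)
            \<and> members n (effect n g (Seq (NStore 0 (NArr 3 (NVar 9)) (NVar 3)) (NAssign 11 (NAdd (NVar 11) (NConst 1)))) s3) 0 = insert ?u S"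
          using m0 unfolding s4_def by blast
      qed auto
      have "exec n g (Seq select (Seq (NStore 0 (NArr 3 (NVar 9)) (NVar 3)) (NAssign 11 (NAdd (NVar 11) (NConst 1))))) s2
         ((n * (n * 20 + 22) + 3) + 3 + 1) (\<lambda>s4. greedy_inv n \<kappa> t b Z (Suc i) s4 \<and> members n s4 0 = insert (\<sigma> r) S)
         ?post (V (Suc i) (insert (\<sigma> r) S))"
        by (rule exec_terminates[OF terminates_Seq[OF sel fin]]) auto
      then show "exec n g (Seq select (Seq (NStore 0 (NArr 3 (NVar 9)) (NVar 3)) (NAssign 11 (NAdd (NVar 11) (NConst 1))))) s2
         ((n * (n * 20 + 22) + 3) + 3 + 1) (greedy_inv n \<kappa> t b Z (Suc i)) ?post (V (Suc i) (insert (\<sigma> (nvar s2 10)) S))"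
        by (rule exec_mono) (auto simp: s2)
    qed
  qed auto
qed

definition greedy_loop :: com where
  "greedy_loop = While (NLess (NVar 11) (NVar 2)) greedy_step"

lemma greedy_loop_exec:
  assumes inv: "greedy_inv n \<kappa> t b Z 0 s" and \<kappa>: "4 * \<kappa> \<le> n" "card Z = \<kappa>"
    and step: "\<And>i S E \<sigma> N. i < \<kappa> \<Longrightarrow> S \<subseteq> {..<n} \<Longrightarrow> card S = i \<Longrightarrow> (i < t \<Longrightarrow> S \<inter> Z = {}) \<Longrightarrow>
       E = (if i < t then {..<n} - Z - S else {..<n} - S) \<Longrightarrow> bij_betw \<sigma> {..<N} E \<Longrightarrow> \<kappa> \<le> N \<Longrightarrow>
       (\<And>j j'. j < j' \<Longrightarrow> j' < N \<Longrightarrow> oracle_of n g b (insert (\<sigma> j') S) \<le> oracle_of n g b (insert (\<sigma> j) S)) \<Longrightarrow>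
       real \<kappa> * V i S \<le> (\<Sum>j<\<kappa>. V (Suc i) (insert (\<sigma> j) S))"
  shows "exec n g greedy_loop s (n * (n * 30 + (n * (n * 20 + 22)) + 32) + 1) (greedy_inv n \<kappa> t b Z \<kappa>)
     (\<lambda>s'. V \<kappa> (members n s' 0)) (V 0 {})"
proof -
  have "exec n g greedy_loop s ((\<kappa> - 0) * ((n * 30 + (n * (n * 20 + 22)) + 30) + 2) + 1) (greedy_inv n \<kappa> t b Z \<kappa>)
     (\<lambda>s'. V \<kappa> (members n s' 0)) (V 0 (members n s 0))"
    unfolding greedy_loop_def
  proof (rule exec_While[where I = "greedy_inv n \<kappa> t b Z" and V = "\<lambda>i s. V i (members n s 0)"])
    fix i s assume i: "i < \<kappa>" and I: "greedy_inv n \<kappa> t b Z i s"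
    show "bval s (NLess (NVar 11) (NVar 2)) \<and> exec n g greedy_step s (n * 30 + (n * (n * 20 + 22)) + 30) (greedy_inv n \<kappa> t b Z (Suc i))
       (\<lambda>s'. V (Suc i) (members n s' 0)) (V i (members n s 0))"
    proof
      show "bval s (NLess (NVar 11) (NVar 2))" using I i by (simp add: greedy_inv_def)
      show "exec n g greedy_step s (n * 30 + (n * (n * 20 + 22)) + 30) (greedy_inv n \<kappa> t b Z (Suc i))
         (\<lambda>s'. V (Suc i) (members n s' 0)) (V i (members n s 0))"
        by (rule greedy_step_exec[OF I i \<kappa>]) (rule step[OF i])
    qed
  next
    show "\<And>s. greedy_inv n \<kappa> t b Z \<kappa> s \<Longrightarrow> \<not> bval s (NLess (NVar 11) (NVar 2))" by (auto simp: greedy_inv_def)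
  qed (use inv in auto)
  moreover have "members n s 0 = {}"
  proof -
    have "finite (members n s 0)" by (simp add: members_def)
    then show ?thesis using inv by (simp add: greedy_inv_def)
  qed
  moreover have "(\<kappa> - 0) * ((n * 30 + (n * (n * 20 + 22)) + 30) + 2) + 1 \<le> n * (n * 30 + (n * (n * 20 + 22)) + 32) + 1"
  proof -
    have "(\<kappa> - 0) * ((n * 30 + (n * (n * 20 + 22)) + 30) + 2) = \<kappa> * (n * 30 + n * (n * 20 + 22) + 32)"
      by (simp only: diff_zero add.assoc) simp
    then show ?thesis using mult_le_mono1[of \<kappa> n "n * 30 + n * (n * 20 + 22) + 32"] \<kappa> by linarith
  qed
  ultimately show ?thesis by (elim exec_mono) auto
qed

section \<open>Local search as a program\<close>

definition copy_array :: "nat \<Rightarrow> nat \<Rightarrow> com" where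
  "copy_array a c = Seq (NAssign 15 (NConst 0)) (While (NLess (NVar 15) (NVar 0))
     (Seq (NStore c (NVar 15) (NArr a (NVar 15))) (NAssign 15 (NAdd (NVar 15) (NConst 1)))))"

lemma copy_array_terminates:
  assumes n: "nvar s 0 = n" and ac: "a \<noteq> c"
  shows "terminates n g (copy_array a c) s (n * 5 + 3) (\<lambda>s'. agree {15} {c} {} s s' \<and> rarr s' = rarr s \<and>
     (\<forall>i<n. narr s' c i = narr s a i))"
proof -
  let ?I = "\<lambda>u s'. agree {15} {c} {} s s' \<and> rarr s' = rarr s \<and> nvar s' 15 = u \<and> (\<forall>i<u. narr s' c i = narr s a i)"
  have body: "terminates n g (Seq (NStore c (NVar 15) (NArr a (NVar 15))) (NAssign 15 (NAdd (NVar 15) (NConst 1)))) s' 3 (?I (Suc u))"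
    if I: "?I u s'" for u s'
  proof (rule terminates_straight)
    have "narr s' a = narr s a" using I ac by (auto simp: agree_def)
    then show "?I (Suc u) (effect n g (Seq (NStore c (NVar 15) (NArr a (NVar 15))) (NAssign 15 (NAdd (NVar 15) (NConst 1)))) s')"
      using I by (auto simp: agree_def less_Suc_eq)
  qed auto
  show ?thesis
    unfolding copy_array_def
  proof (rule terminates_mono[OF terminates_Seq[where ?Q1.0 = "?I 0"]])
    show "terminates n g (NAssign 15 (NConst 0)) s 1 (?I 0)"
      by (rule terminates_straight) (auto simp: agree_def)
    show "terminates n g (While (NLess (NVar 15) (NVar 0)) (Seq (NStore c (NVar 15) (NArr a (NVar 15))) (NAssign 15 (NAdd (NVar 15) (NConst 1)))))
       s1 (n * (3 + 2) + 1) (?I n)" if "?I 0 s1" for s1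
    proof (rule terminates_While[where I = ?I])
      fix u s' assume u: "u < n" and I: "?I u s'"
      have "nvar s' 0 = n" using I n by (auto simp: agree_def)
      then show "bval s' (NLess (NVar 15) (NVar 0)) \<and> terminates n g (Seq (NStore c (NVar 15) (NArr a (NVar 15))) (NAssign 15 (NAdd (NVar 15) (NConst 1)))) s' 3 (?I (Suc u))"
        using body[OF I] u I by simp
    next
      show "\<And>s'. ?I n s' \<Longrightarrow> \<not> bval s' (NLess (NVar 15) (NVar 0))" using n by (auto simp: agree_def)
    qed (rule that)
  qed auto
qed

text \<open>The number \<open>n * n\<close> of swap rounds is accumulated along the way, as the
  machine cannot multiply. The search starts from the first \<open>\<kappa>\<close> indices.\<close>

definition init_sets :: com where
  "init_sets = Seq (NAssign 15 (NConst 0)) (While (NLess (NVar 15) (NVar 0))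
     (Seq (NStore 0 (NVar 15) (NVar 4))
       (Seq (If (NLess (NVar 15) (NVar 2)) (NStore 2 (NVar 15) (NVar 3)) (NStore 2 (NVar 15) (NVar 4)))
         (Seq (NAssign 13 (NAdd (NVar 13) (NVar 0))) (NAssign 15 (NAdd (NVar 15) (NConst 1)))))))"

lemma init_sets_terminates:
  assumes n: "nvar s 0 = n" and z: "nvar s 13 = 0"
  shows "terminates n g init_sets s (n * 10 + 3) (\<lambda>s'. agree {13,15} {0,2} {} s s' \<and> nvar s' 13 = n * n \<and>
     (\<forall>i<n. narr s' 0 i = nvar s 4 \<and> narr s' 2 i = (if i < nvar s 2 then nvar s 3 else nvar s 4)))"
proof -
  let ?I = "\<lambda>u s'. agree {13,15} {0,2} {} s s' \<and> nvar s' 15 = u \<and> nvar s' 13 = u * n \<and>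
     (\<forall>i<u. narr s' 0 i = nvar s 4 \<and> narr s' 2 i = (if i < nvar s 2 then nvar s 3 else nvar s 4))"
  let ?b = "Seq (NStore 0 (NVar 15) (NVar 4))
       (Seq (If (NLess (NVar 15) (NVar 2)) (NStore 2 (NVar 15) (NVar 3)) (NStore 2 (NVar 15) (NVar 4)))
         (Seq (NAssign 13 (NAdd (NVar 13) (NVar 0))) (NAssign 15 (NAdd (NVar 15) (NConst 1)))))"
  have body: "terminates n g ?b s' 8 (?I (Suc u))" if I: "?I u s'" for u s'
  proof (rule terminates_straight)
    have v: "nvar s' 0 = n" "nvar s' 2 = nvar s 2" "nvar s' 3 = nvar s 3" "nvar s' 4 = nvar s 4" using I n by (auto simp: agree_def)
    show "?I (Suc u) (effect n g ?b s')"
      using I v by (auto simp: agree_def less_Suc_eq)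
  qed auto
  show ?thesis
    unfolding init_sets_def
  proof (rule terminates_mono[OF terminates_Seq[where ?Q1.0 = "?I 0"]])
    show "terminates n g (NAssign 15 (NConst 0)) s 1 (?I 0)"
      by (rule terminates_straight) (auto simp: agree_def z)
    show "terminates n g (While (NLess (NVar 15) (NVar 0)) ?b) s1 (n * (8 + 2) + 1) (?I n)" if "?I 0 s1" for s1
    proof (rule terminates_While[where I = ?I])
      fix u s' assume u: "u < n" and I: "?I u s'"
      have "nvar s' 0 = n" using I n by (auto simp: agree_def)
      then show "bval s' (NLess (NVar 15) (NVar 0)) \<and> terminates n g ?b s' 8 (?I (Suc u))"
        using body[OF I] u I by simp
    next
      show "\<And>s'. ?I n s' \<Longrightarrow> \<not> bval s' (NLess (NVar 15) (NVar 0))" using n by (auto simp: agree_def)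
    qed (rule that)
  qed auto
qed

definition swap_cond :: bexp where
  "swap_cond = BAnd (NEq (NArr 2 (NVar 15)) (NVar 3)) (NEq (NArr 2 (NVar 16)) (NVar 4))"

lemma bval_swap_cond: "bval s swap_cond \<longleftrightarrow> narr s 2 (nvar s 15) = nvar s 3 \<and> narr s 2 (nvar s 16) = nvar s 4"
  unfolding swap_cond_def by auto

definition swap_inner :: com where
  "swap_inner = Seq (If swap_cond
      (Seq (NStore 2 (NVar 15) (NVar 4)) (Seq (NStore 2 (NVar 16) (NVar 3)) (Seq (Query 0 2)
        (Seq (NStore 2 (NVar 15) (NVar 3)) (Seq (NStore 2 (NVar 16) (NVar 4))
          (Seq (RStore 0 (NVar 5) (RSub RZero (RVar 0)))
            (Seq (NStore 3 (NVar 5) (NVar 15)) (Seq (NStore 4 (NVar 5) (NVar 16))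
              (NAssign 5 (NAdd (NVar 5) (NConst 1))))))))))) Skip)
    (NAssign 16 (NAdd (NVar 16) (NConst 1)))"

definition swap_outer :: com where
  "swap_outer = Seq (NAssign 16 (NConst 0)) (Seq (While (NLess (NVar 16) (NVar 0)) swap_inner)
     (NAssign 15 (NAdd (NVar 15) (NConst 1))))"

definition swap_fill :: com where
  "swap_fill = Seq (Seq (NAssign 5 (NConst 0)) (NAssign 15 (NConst 0)))
     (While (NLess (NVar 15) (NVar 0)) swap_outer)"

lemma swap_fill_terminates:
  fixes g :: "nat set \<Rightarrow> real"
  assumes n: "nvar s 0 = n" and fl: "flags s" and va: "valid n s 2"
  defines "F \<equiv> oracle_of n g (nvar s 3)" and "Z \<equiv> members n s 2"
  shows "terminates n g swap_fill s (n * (n * 22 + 8) + 6) (\<lambda>s'. agree {5,15,16} {3,4} {0} s s' \<and>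
     bij_betw (\<lambda>i. (narr s' 3 i, narr s' 4 i)) {..<nvar s' 5} (Z \<times> ({..<n} - Z)) \<and>
     (\<forall>i<nvar s' 5. rarr s' 0 i = - F (insert (narr s' 4 i) (Z - {narr s' 3 i}))))"
proof -
  let ?E = "Z \<times> ({..<n} - Z)"
  \<comment> \<open>The pairs that precede \<open>(u, v)\<close> in the lexicographic order of the
    two nested loops.\<close>
  let ?B = "\<lambda>u v. ?E \<inter> {(a, b). a < u \<or> a = u \<and> b < v}"
  let ?J = "\<lambda>u v s'. agree {5,15,16} {3,4} {0} s s' \<and> nvar s' 15 = u \<and> nvar s' 16 = v \<and>
     bij_betw (\<lambda>i. (narr s' 3 i, narr s' 4 i)) {..<nvar s' 5} (?B u v) \<and>
     (\<forall>i<nvar s' 5. rarr s' 0 i = - F (insert (narr s' 4 i) (Z - {narr s' 3 i})))"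
  let ?I = "\<lambda>u s'. agree {5,15,16} {3,4} {0} s s' \<and> nvar s' 15 = u \<and>
     bij_betw (\<lambda>i. (narr s' 3 i, narr s' 4 i)) {..<nvar s' 5} (?B u 0) \<and>
     (\<forall>i<nvar s' 5. rarr s' 0 i = - F (insert (narr s' 4 i) (Z - {narr s' 3 i})))"
  have inner: "terminates n g swap_inner s' 20 (?J u (Suc v))" if u: "u < n" and v: "v < n" and J: "?J u v s'" for u v s'
  proof (rule terminates_straight)
    have w: "nvar s' 0 = n" "nvar s' 3 = nvar s 3" "nvar s' 4 = nvar s 4" "narr s' 2 = narr s 2" "nvar s' 15 = u" "nvar s' 16 = v"
      using J n by (auto simp: agree_def)
    have fl': "flags s'" and va': "valid n s' 2" using fl va w by (auto simp: flags_def valid_def)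
    have Z': "members n s' 2 = Z" unfolding Z_def members_def w by auto
    have elig: "bval s' swap_cond \<longleftrightarrow> (u, v) \<in> ?E"
    proof -
      have "narr s' 2 v = nvar s' 4 \<longleftrightarrow> v \<notin> Z" using not_member[OF va' fl' v] unfolding Z' .
      moreover have "narr s' 2 u = nvar s' 3 \<longleftrightarrow> u \<in> Z" unfolding Z'[symmetric] members_def using u by simp
      ultimately show ?thesis using v unfolding bval_swap_cond w(5,6) by simp
    qed
    show "?J u (Suc v) (effect n g swap_inner s')"
    proof (cases "bval s' swap_cond")
      case False
      then have "(u, v) \<notin> ?E" using elig by blast
      then have "?B u (Suc v) = ?B u v" by (auto simp: less_Suc_eq)
      moreover have "effect n g swap_inner s' = s'\<lparr>nvar := (nvar s')(16 := Suc v)\<rparr>"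
        using False w(6) unfolding swap_inner_def by simp
      ultimately show ?thesis using J by (simp add: agree_def)
    next
      case True
      then have E: "(u, v) \<in> ?E" using elig by blast
      then have uv: "u \<noteq> v" by auto
      let ?N = "nvar s' 5"
      have q: "g (array_set n (s'\<lparr>narr := (narr s')(2 := (narr s' 2)(u := nvar s' 4, v := nvar s' 3))\<rparr>) 2) = F (insert v (Z - {u}))"
        using query_swap[OF fl' va' u v uv, of g] unfolding Z' F_def w by simp
      have triv: "(narr s' 2)(u := nvar s' 3, v := nvar s' 4) = narr s' 2"
        using True uv w(5,6) by (auto simp: bval_swap_cond fun_eq_iff)
      have triv2: "(narr s' 2)(v := nvar s' 3, u := nvar s' 3, v := nvar s' 4) = narr s' 2"
        using True uv w(5,6) by (auto simp: bval_swap_cond fun_eq_iff)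
      have triv3: "(narr s' 2)(u := nvar s' 4, v := nvar s' 3, u := nvar s' 3, v := nvar s' 4) = narr s' 2"
        using True uv w(5,6) by (auto simp: bval_swap_cond fun_eq_iff)
      have tw: "(narr s' 2)(v := nvar s' 3, u := nvar s' 4) = (narr s' 2)(u := nvar s' 4, v := nvar s' 3)"
        using uv by (simp add: fun_upd_twist)
      have eff: "nvar (effect n g swap_inner s') = (nvar s')(5 := Suc ?N, 16 := Suc v)"
        "narr (effect n g swap_inner s') = (narr s')(3 := (narr s' 3)(?N := u), 4 := (narr s' 4)(?N := v))"
        "\<And>x. x \<noteq> 0 \<Longrightarrow> rvar (effect n g swap_inner s') x = rvar s' x"
        "rarr (effect n g swap_inner s') 0 = (rarr s' 0)(?N := - F (insert v (Z - {u})))"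
        unfolding swap_inner_def using uv by (simp_all add: True w(5,6) q triv triv2 triv3 tw)
      have Bv: "?B u (Suc v) = insert (u, v) (?B u v)" using E by (auto simp: less_Suc_eq)
      have "bij_betw ((\<lambda>i. (narr s' 3 i, narr s' 4 i))(?N := (u, v))) {..<Suc ?N} (?B u (Suc v))"
        unfolding Bv using J by (intro bij_betw_append) auto
      moreover have "(\<lambda>i. (narr s' 3 i, narr s' 4 i))(?N := (u, v)) = (\<lambda>i. (((narr s' 3)(?N := u)) i, ((narr s' 4)(?N := v)) i))"
        by auto
      ultimately have bij: "bij_betw (\<lambda>i. (narr (effect n g swap_inner s') 3 i, narr (effect n g swap_inner s') 4 i))
          {..<nvar (effect n g swap_inner s') 5} (?B u (Suc v))"
        unfolding eff by simp
      have ag: "agree {5,15,16} {3,4} {0} s (effect n g swap_inner s')"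
        using J eff(1,2,3) unfolding agree_def by simp
      have "\<forall>i<nvar (effect n g swap_inner s') 5. rarr (effect n g swap_inner s') 0 i
         = - F (insert (narr (effect n g swap_inner s') 4 i) (Z - {narr (effect n g swap_inner s') 3 i}))"
        unfolding eff using J by (simp add: less_Suc_eq)
      then show ?thesis using bij ag w(5) eff(1) by simp
    qed
  qed (auto simp: swap_inner_def)
  have outer: "terminates n g swap_outer s' (n * 22 + 6) (?I (Suc u))" if u: "u < n" and I: "?I u s'" for u s'
    unfolding swap_outer_def
  proof (rule terminates_mono[OF terminates_Seq[where ?Q1.0 = "?J u 0"]])
    show "terminates n g (NAssign 16 (NConst 0)) s' 1 (?J u 0)"
      by (rule terminates_straight) (use I in \<open>simp_all add: agree_def\<close>)
    fix s1 assume J0: "?J u 0 s1"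
    show "terminates n g (Seq (While (NLess (NVar 16) (NVar 0)) swap_inner) (NAssign 15 (NAdd (NVar 15) (NConst 1)))) s1
       ((n * (20 + 2) + 1) + 1 + 1) (?I (Suc u))"
    proof (rule terminates_Seq[where ?Q1.0 = "?J u n"])
      show "terminates n g (While (NLess (NVar 16) (NVar 0)) swap_inner) s1 (n * (20 + 2) + 1) (?J u n)"
      proof (rule terminates_While[where I = "?J u"])
        fix v s' assume v: "v < n" and J: "?J u v s'"
        have "nvar s' 0 = n" using J n by (auto simp: agree_def)
        then show "bval s' (NLess (NVar 16) (NVar 0)) \<and> terminates n g swap_inner s' 20 (?J u (Suc v))"
          using inner[OF u v J] v J by simp
      next
        show "\<And>s'. ?J u n s' \<Longrightarrow> \<not> bval s' (NLess (NVar 16) (NVar 0))" using n by (auto simp: agree_def)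
      qed (rule J0)
      fix s2 assume J: "?J u n s2"
      have B: "?B u n = ?B (Suc u) 0" by (auto simp: less_Suc_eq)
      show "terminates n g (NAssign 15 (NAdd (NVar 15) (NConst 1))) s2 1 (?I (Suc u))"
      proof (rule terminates_straight)
        show "?I (Suc u) (effect n g (NAssign 15 (NAdd (NVar 15) (NConst 1))) s2)"
          using J unfolding B[symmetric] by (simp add: agree_def)
      qed auto
    qed
  qed auto
  show ?thesis
    unfolding swap_fill_def
  proof (rule terminates_mono[OF terminates_Seq[where ?Q1.0 = "?I 0"]])
    show "terminates n g (Seq (NAssign 5 (NConst 0)) (NAssign 15 (NConst 0))) s 3 (?I 0)"
      by (rule terminates_straight) (auto simp: agree_def bij_betw_def)
    show "terminates n g (While (NLess (NVar 15) (NVar 0)) swap_outer) s1 (n * ((n * 22 + 6) + 2) + 1) (?I n)" if "?I 0 s1" for s1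
    proof (rule terminates_While[where I = ?I])
      fix u s' assume u: "u < n" and I: "?I u s'"
      have "nvar s' 0 = n" using I n by (auto simp: agree_def)
      then show "bval s' (NLess (NVar 15) (NVar 0)) \<and> terminates n g swap_outer s' (n * 22 + 6) (?I (Suc u))"
        using outer[OF u I] u I by simp
    next
      show "\<And>s'. ?I n s' \<Longrightarrow> \<not> bval s' (NLess (NVar 15) (NVar 0))" using n by (auto simp: agree_def)
    qed (rule that)
    have "?B n 0 = ?E" by (auto simp: Z_def members_def)
    then show "\<And>s'. ?I n s' \<Longrightarrow> agree {5,15,16} {3,4} {0} s s' \<and>
     bij_betw (\<lambda>i. (narr s' 3 i, narr s' 4 i)) {..<nvar s' 5} (Z \<times> ({..<n} - Z)) \<and>
     (\<forall>i<nvar s' 5. rarr s' 0 i = - F (insert (narr s' 4 i) (Z - {narr s' 3 i})))" by simp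
  qed (auto simp: algebra_simps)
qed

text \<open>In round 0 nothing has been recorded yet; later a set is recorded when its best swap
  gains less than every earlier one.\<close>

definition record_cond :: bexp where
  "record_cond = BNot (BAnd (NLess (NConst 0) (NVar 11)) (BNot (RLess (RVar 3) (RVar 4))))"

lemma bval_record_cond: "bval s record_cond \<longleftrightarrow> nvar s 11 = 0 \<or> rvar s 3 < rvar s 4"
  unfolding record_cond_def by auto

definition evaluate_swap :: com where
  "evaluate_swap = Seq (RAssign 1 (RSub RZero (RArr 0 (NVar 9)))) (Seq (Query 2 2) (RAssign 3 (RSub (RVar 1) (RVar 2))))"

definition record_swap :: com where
  "record_swap = If record_cond (Seq (RAssign 4 (RVar 3)) (copy_array 2 1)) Skip"

definition perform_swap :: com where
  "perform_swap = Seq (If (RLess RZero (RVar 3)) (Seq (NStore 2 (NArr 3 (NVar 9)) (NVar 4)) (NStore 2 (NArr 4 (NVar 9)) (NVar 3))) Skip)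
     (NAssign 11 (NAdd (NVar 11) (NConst 1)))"

definition swap_step :: com where
  "swap_step = Seq swap_fill (Seq (Seq (NAssign 10 (NConst 0)) select) (Seq evaluate_swap (Seq record_swap perform_swap)))"

text \<open>Array 1 keeps the set whose best swap gained least so far, and real register 4 that
  gain. Each of the \<open>i\<close> rounds improved the value by at least this gain, so
  \<open>i\<close> times its positive part is at most the current value. After \<open>n * n\<close>
  rounds it is at most \<open>P / n^2\<close>, which makes the total error of order
  \<open>P / n\<close>.\<close>

definition swap_inv :: "nat \<Rightarrow> (nat set \<Rightarrow> real) \<Rightarrow> nat \<Rightarrow> nat \<Rightarrow> nat \<Rightarrow> state \<Rightarrow> bool" where
  "swap_inv n F \<kappa> b i s \<longleftrightarrow> nvar s 0 = n \<and> nvar s 2 = \<kappa> \<and> nvar s 3 = b \<and> nvar s 13 = n * n \<and> flags s \<and>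
     (\<forall>j<n. narr s 0 j = nvar s 4) \<and> valid n s 2 \<and> card (members n s 2) = \<kappa> \<and> nvar s 11 = i \<and>
     (0 < i \<longrightarrow> valid n s 1 \<and> card (members n s 1) = \<kappa> \<and>
       (\<forall>u\<in>members n s 1. \<forall>v\<in>{..<n} - members n s 1. F (insert v (members n s 1 - {u})) \<le> F (members n s 1) + rvar s 4) \<and>
       real i * max 0 (rvar s 4) \<le> F (members n s 2))"

lemma swap_step_terminates:
  fixes g :: "nat set \<Rightarrow> real"
  assumes inv: "swap_inv n (oracle_of n g b) \<kappa> b i s" and \<kappa>: "1 \<le> \<kappa>" "\<kappa> < n"
    and nn: "\<And>A. A \<subseteq> {..<n} \<Longrightarrow> 0 \<le> oracle_of n g b A"
  shows "terminates n g swap_step s (n * (n * 22 + 8) + n * n * (n * n * 20 + 22) + n * 5 + 40) (swap_inv n (oracle_of n g b) \<kappa> b (Suc i))"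
proof -
  define F where "F = oracle_of n g b"
  define Z where "Z = members n s 2"
  have s: "nvar s 0 = n" "nvar s 2 = \<kappa>" "nvar s 3 = b" "nvar s 13 = n * n" "flags s"
     "\<And>j. j < n \<Longrightarrow> narr s 0 j = nvar s 4" "valid n s 2" "card Z = \<kappa>" "nvar s 11 = i"
    using inv unfolding swap_inv_def Z_def by auto
  have old: "valid n s 1" "card (members n s 1) = \<kappa>"
     "\<And>u v. u \<in> members n s 1 \<Longrightarrow> v \<in> {..<n} - members n s 1 \<Longrightarrow> F (insert v (members n s 1 - {u})) \<le> F (members n s 1) + rvar s 4"
     "real i * max 0 (rvar s 4) \<le> F Z" if "0 < i"
    using inv that unfolding swap_inv_def Z_def F_def by auto
  have ZU: "Z \<subseteq> {..<n}" by (auto simp: Z_def members_def)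
  have fZ: "finite Z" using ZU finite_subset by blast
  define E where "E = Z \<times> ({..<n} - Z)"
  have cE: "card E = \<kappa> * (n - \<kappa>)" unfolding E_def using ZU fZ s(8) by (simp add: card_cartesian_product card_Diff_subset)
  then have E0: "0 < card E" using \<kappa> by simp
  have En: "card E \<le> n * n" unfolding cE using \<kappa> by (intro mult_mono) auto
  let ?Q1 = "\<lambda>s'. agree {5,15,16} {3,4} {0} s s' \<and>
     bij_betw (\<lambda>i. (narr s' 3 i, narr s' 4 i)) {..<nvar s' 5} E \<and>
     (\<forall>i<nvar s' 5. rarr s' 0 i = - F (insert (narr s' 4 i) (Z - {narr s' 3 i})))"
  have fill: "terminates n g swap_fill s (n * (n * 22 + 8) + 6) ?Q1"
    using swap_fill_terminates[OF s(1,5,7), of g] unfolding E_def F_def Z_def s(3) .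
  let ?B = "\<lambda>x y. F (insert y (Z - {x}))"
  let ?Q3 = "\<lambda>s3. agree {5,6,7,8,9,10,15,16} {3,4} {0} s s3 \<and> (narr s3 3 (nvar s3 9), narr s3 4 (nvar s3 9)) \<in> E \<and>
     rarr s3 0 (nvar s3 9) = - ?B (narr s3 3 (nvar s3 9)) (narr s3 4 (nvar s3 9)) \<and>
     (\<forall>u\<in>Z. \<forall>v\<in>{..<n} - Z. ?B u v \<le> ?B (narr s3 3 (nvar s3 9)) (narr s3 4 (nvar s3 9)))"
  have sel: "terminates n g (Seq (NAssign 10 (NConst 0)) select) s1 (1 + (n * n * (n * n * 20 + 22) + 3) + 1) ?Q3" if Q1: "?Q1 s1" for s1
  proof (rule terminates_Seq[where ?Q1.0 = "\<lambda>s2. s2 = s1\<lparr>nvar := (nvar s1)(10 := 0)\<rparr>"])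
    show "terminates n g (NAssign 10 (NConst 0)) s1 1 (\<lambda>s2. s2 = s1\<lparr>nvar := (nvar s1)(10 := 0)\<rparr>)"
      by (rule terminates_straight) auto
    fix s2 assume s2: "s2 = s1\<lparr>nvar := (nvar s1)(10 := 0)\<rparr>"
    define N where "N = nvar s1 5"
    define tok where "tok = (\<lambda>i. (narr s1 3 i, narr s1 4 i))"
    have bij: "bij_betw tok {..<N} E" using Q1 unfolding tok_def N_def by blast
    have N: "N = card E" using bij_betw_same_card[OF bij] by simp
    have key: "rarr s1 0 i = (\<lambda>(u, v). - ?B u v) (tok i)" if "i < N" for i using Q1 that unfolding tok_def N_def by auto
    note st = sorted_tokens[where karr = "rarr s1 0" and key = "\<lambda>(u, v). - ?B u v", OF bij key]
    show "terminates n g select s2 (n * n * (n * n * 20 + 22) + 3) ?Q3"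
    proof (rule terminates_mono[OF select_terminates[of s2 N]])
      show "nvar s2 5 = N" unfolding s2 N_def by simp
      show "N * (N * 20 + 22) + 3 \<le> n * n * (n * n * 20 + 22) + 3" unfolding N using En by (intro add_mono mult_mono) auto
      fix s3 assume "agree {6,7,8,9} {} {} s2 s3 \<and> rarr s3 = rarr s2 \<and>
           (nvar s2 10 < N \<longrightarrow> nvar s3 9 = order_index (rarr s2 0) N (nvar s2 10))"
      then have ag: "agree {6,7,8,9} {} {} s2 s3" "rarr s3 = rarr s1" "nvar s3 9 = order_index (rarr s1 0) N 0"
        using E0 N unfolding s2 by auto
      have a3: "narr s3 a = narr s1 a" for a using agreeD(2)[OF ag(1)] unfolding s2 by simp
      have ag1: "agree {5,15,16} {3,4} {0} s s1" using Q1 by blast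
      have ag': "agree {5,6,7,8,9,10,15,16} {3,4} {0} s s3"
        using ag(1) ag1 unfolding s2 agree_def by simp
      let ?r = "order_index (rarr s1 0) N 0"
      have rN: "?r < N" using E0 N by (intro order_index_less) simp
      have t: "(narr s3 3 (nvar s3 9), narr s3 4 (nvar s3 9)) = tok ?r" unfolding tok_def a3 ag(3) ..
      have tE: "tok ?r \<in> E" using bij rN by (auto simp: bij_betw_def)
      have k1: "rarr s3 0 (nvar s3 9) = - ?B (narr s3 3 (nvar s3 9)) (narr s3 4 (nvar s3 9))"
        unfolding ag(2,3) a3 using key[OF rN] by (simp add: tok_def)
      have "?B u v \<le> ?B (narr s3 3 (nvar s3 9)) (narr s3 4 (nvar s3 9))" if uv: "u \<in> Z" "v \<in> {..<n} - Z" for u v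
      proof -
        have "(u, v) \<in> (tok \<circ> order_index (rarr s1 0) N) ` {..<N}" using st(1) uv unfolding bij_betw_def E_def by auto
        then obtain j where j: "j < N" "(tok \<circ> order_index (rarr s1 0) N) j = (u, v)" by auto
        have "(\<lambda>(u, v). - ?B u v) ((tok \<circ> order_index (rarr s1 0) N) 0) \<le> (\<lambda>(u, v). - ?B u v) ((tok \<circ> order_index (rarr s1 0) N) j)"
        proof (cases "j = 0")
          case False
          then show ?thesis using st(2)[of 0 j] j by auto
        qed simp
        then show ?thesis using j t by (simp add: tok_def a3 ag(3))
      qed
      then show "?Q3 s3" using ag' t tE k1 by simp
    qed
  qed
  let ?Q4 = "\<lambda>s4. ?Q3 s4"
  have rest: "terminates n g (Seq evaluate_swap (Seq record_swap perform_swap)) s3 (n * 5 + 22) (swap_inv n F \<kappa> b (Suc i))" if Q3: "?Q3 s3" for s3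
  proof -
    define x where "x = narr s3 3 (nvar s3 9)"
    define y where "y = narr s3 4 (nvar s3 9)"
    have ag: "agree {5,6,7,8,9,10,15,16} {3,4} {0} s s3" using Q3 by blast
    have xy: "x \<in> Z" "y < n" "y \<notin> Z" using Q3 unfolding x_def y_def E_def by auto
    have best: "\<And>u v. u \<in> Z \<Longrightarrow> v \<in> {..<n} - Z \<Longrightarrow> ?B u v \<le> ?B x y" using Q3 unfolding x_def y_def by blast
    have keyr: "rarr s3 0 (nvar s3 9) = - ?B x y" using Q3 unfolding x_def y_def by blast
    have v3: "nvar s3 0 = n" "nvar s3 2 = \<kappa>" "nvar s3 3 = b" "nvar s3 13 = n * n" "nvar s3 4 = nvar s 4" "nvar s3 11 = i"
       "narr s3 0 = narr s 0" "narr s3 1 = narr s 1" "narr s3 2 = narr s 2" "rvar s3 4 = rvar s 4"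
      using s agreeD[OF ag] by auto
    have fl3: "flags s3" "valid n s3 2" using s(3,5,7) by (simp_all add: flags_def valid_def v3)
    have m3: "members n s3 2 = Z" "members n s3 1 = members n s 1" using s(3) by (simp_all add: members_def Z_def v3 del: One_nat_def)
    define \<gamma> where "\<gamma> = ?B x y - F Z"
    define s4 where "s4 = effect n g evaluate_swap s3"
    have q: "g (array_set n s3 2) = F Z" using query_value[OF fl3, of g] unfolding m3 v3 F_def .
    have as: "array_set n (s3\<lparr>rvar := X\<rparr>) 2 = array_set n s3 2" for X by (simp add: array_set_def)
    have s4: "nvar s4 = nvar s3" "narr s4 = narr s3" "rvar s4 3 = \<gamma>" "rvar s4 4 = rvar s 4"
      unfolding s4_def evaluate_swap_def using keyr q by (simp_all add: as \<gamma>_def v3)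
    define rec where "rec \<longleftrightarrow> i = 0 \<or> \<gamma> < rvar s 4"
    let ?Q5 = "\<lambda>s5. agree {15} {1} {4} s4 s5 \<and> (if rec then rvar s5 4 = \<gamma> \<and> (\<forall>j<n. narr s5 1 j = narr s 2 j)
         else rvar s5 4 = rvar s 4 \<and> narr s5 1 = narr s 1)"
    have t5: "terminates n g record_swap s4 ((1 + (n * 5 + 3) + 1) + 1) ?Q5"
      unfolding record_swap_def
    proof (rule terminates_If)
      assume "bval s4 record_cond"
      then have rc: rec using s4 v3 by (simp add: bval_record_cond rec_def)
      show "terminates n g (Seq (RAssign 4 (RVar 3)) (copy_array 2 1)) s4 (1 + (n * 5 + 3) + 1) ?Q5"
      proof (rule terminates_Seq[where ?Q1.0 = "\<lambda>t. t = s4\<lparr>rvar := (rvar s4)(4 := \<gamma>)\<rparr>"])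
        show "terminates n g (RAssign 4 (RVar 3)) s4 1 (\<lambda>t. t = s4\<lparr>rvar := (rvar s4)(4 := \<gamma>)\<rparr>)"
          by (rule terminates_straight) (auto simp: s4)
        fix t assume t: "t = s4\<lparr>rvar := (rvar s4)(4 := \<gamma>)\<rparr>"
        show "terminates n g (copy_array 2 1) t (n * 5 + 3) ?Q5"
        proof (rule terminates_mono[OF copy_array_terminates])
          show "nvar t 0 = n" unfolding t using s4 v3 by simp
          fix t' assume "agree {15} {1} {} t t' \<and> rarr t' = rarr t \<and> (\<forall>i<n. narr t' 1 i = narr t 2 i)"
          then show "?Q5 t'" using rc s4 v3 unfolding t agree_def by simp
        qed auto
      qed
    next
      assume "\<not> bval s4 record_cond"
      then have rc: "\<not> rec" using s4 v3 by (simp add: bval_record_cond rec_def)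
      show "terminates n g Skip s4 (1 + (n * 5 + 3) + 1) ?Q5"
        by (rule terminates_straight) (use rc s4 v3 in \<open>auto simp: agree_def\<close>)
    qed
    have t6: "terminates n g perform_swap s5 6 (swap_inv n F \<kappa> b (Suc i))" if Q5: "?Q5 s5" for s5
    proof (rule terminates_straight)
      have ag5: "agree {15} {1} {4} s4 s5" using Q5 by blast
      have v5: "nvar s5 0 = n" "nvar s5 2 = \<kappa>" "nvar s5 3 = b" "nvar s5 13 = n * n" "nvar s5 4 = nvar s 4" "nvar s5 11 = i"
         "nvar s5 9 = nvar s3 9" "narr s5 0 = narr s 0" "narr s5 2 = narr s 2" "narr s5 3 = narr s3 3" "narr s5 4 = narr s3 4" "rvar s5 3 = \<gamma>"
        using agreeD[OF ag5] s4 v3 by auto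
      define s6 where "s6 = effect n g perform_swap s5"
      have s6: "nvar s6 = (nvar s5)(11 := Suc i)" "rvar s6 = rvar s5" "narr s6 0 = narr s 0" "narr s6 1 = narr s5 1"
        "narr s6 2 = (if 0 < \<gamma> then (narr s 2)(x := nvar s 4, y := b) else narr s 2)"
        unfolding s6_def perform_swap_def x_def y_def by (simp_all add: v5)
      have xn: "x < n" using xy ZU by auto
      have neq: "nvar s 4 \<noteq> b" using flags_neq[OF s(5)] s(3) by simp
      have Z6: "members n s6 2 = (if 0 < \<gamma> then insert y (Z - {x}) else Z)"
        using xy neq unfolding members_def s6 Z_def by (auto simp: v5 s(3))
      have fl6: "flags s6" using s(3,5) by (simp add: flags_def s6 v5)
      have va6: "valid n s6 2" using s(7) by (auto simp: valid_def s6 v5 s(3))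
      have c6: "card (members n s6 2) = \<kappa>"
        unfolding Z6 using xy fZ s(8) \<kappa> by (auto simp: card_Diff_singleton)
      have F6: "F (members n s6 2) = F Z + max 0 \<gamma>" unfolding Z6 \<gamma>_def by auto
      have rv: "rvar s6 4 = (if rec then \<gamma> else rvar s 4)" using Q5 unfolding s6(2) by simp
      have new: "valid n s6 1 \<and> card (members n s6 1) = \<kappa> \<and>
         (\<forall>u\<in>members n s6 1. \<forall>v\<in>{..<n} - members n s6 1. F (insert v (members n s6 1 - {u})) \<le> F (members n s6 1) + rvar s6 4)"
      proof (cases rec)
        case True
        then have e: "\<And>j. j < n \<Longrightarrow> narr s6 1 j = narr s 2 j" using Q5 unfolding s6(4) by simp
        have m: "members n s6 1 = Z" using e unfolding members_def Z_def s6(1) by (auto simp: v5 s(3))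
        have "valid n s6 1" using s(7) e unfolding valid_def s6(1) by (simp add: v5 s(3))
        then show ?thesis unfolding m rv using True best s(8) by (auto simp: \<gamma>_def)
      next
        case False
        then have i0: "0 < i" unfolding rec_def by simp
        have e: "narr s6 1 = narr s 1" using Q5 False unfolding s6(4) by simp
        have m: "members n s6 1 = members n s 1" unfolding members_def s6(1) e by (simp add: v5 s(3))
        have "valid n s6 1" using old(1)[OF i0] unfolding valid_def s6(1) e by (simp add: v5 s(3))
        then show ?thesis unfolding m rv using False old[OF i0] by auto
      qed
      \<comment> \<open>The new record is at most the old one, which handles the first
        \<open>i\<close> summands, and at most \<open>\<gamma>\<close>, so the swap just made pays
        for the last.\<close>
      have inc: "real (Suc i) * max 0 (rvar s6 4) \<le> F (members n s6 2)"
      proof -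
        have FZ: "0 \<le> F Z" unfolding F_def by (rule nn[OF ZU])
        have a: "real i * max 0 (rvar s6 4) \<le> F Z"
        proof (cases "i = 0")
          case False
          have "rvar s6 4 \<le> rvar s 4" unfolding rv using False by (auto simp: rec_def)
          then have "real i * max 0 (rvar s6 4) \<le> real i * max 0 (rvar s 4)" by (intro mult_left_mono) auto
          then show ?thesis using old(4) False by linarith
        qed (use FZ in simp)
        have "rvar s6 4 \<le> \<gamma>" unfolding rv by (auto simp: rec_def)
        then have "max 0 (rvar s6 4) \<le> max 0 \<gamma>" by auto
        then show ?thesis unfolding F6 using a by (simp add: distrib_right)
      qed
      show "swap_inv n F \<kappa> b (Suc i) (effect n g perform_swap s5)"
        unfolding s6_def[symmetric] swap_inv_def using new inc c6 va6 fl6 s(6) by (simp add: s6 v5)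
    qed (auto simp: perform_swap_def)
    show ?thesis
    proof (rule terminates_mono[OF terminates_Seq[where ?Q1.0 = "\<lambda>t. t = s4"]])
      show "terminates n g evaluate_swap s3 5 (\<lambda>t. t = s4)"
        by (rule terminates_straight) (auto simp: s4_def evaluate_swap_def)
      show "terminates n g (Seq record_swap perform_swap) t (((1 + (n * 5 + 3) + 1) + 1) + 6 + 1) (swap_inv n F \<kappa> b (Suc i))" if "t = s4" for t
        unfolding that by (rule terminates_Seq[OF t5 t6])
    qed auto
  qed
  show ?thesis
    unfolding swap_step_def F_def[symmetric]
  proof (rule terminates_mono[OF terminates_Seq[OF fill]])
    fix s1 assume Q1: "?Q1 s1"
    show "terminates n g (Seq (Seq (NAssign 10 (NConst 0)) select) (Seq evaluate_swap (Seq record_swap perform_swap))) s1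
       ((1 + (n * n * (n * n * 20 + 22) + 3) + 1) + (n * 5 + 22) + 1) (swap_inv n F \<kappa> b (Suc i))"
      by (rule terminates_Seq[OF sel[OF Q1] rest])
  qed auto
qed

definition swap_loop :: com where
  "swap_loop = While (NLess (NVar 11) (NVar 13)) swap_step"

lemma swap_loop_terminates:
  fixes g :: "nat set \<Rightarrow> real"
  assumes inv: "swap_inv n (oracle_of n g b) \<kappa> b 0 s" and \<kappa>: "1 \<le> \<kappa>" "\<kappa> < n"
    and nn: "\<And>A. A \<subseteq> {..<n} \<Longrightarrow> 0 \<le> oracle_of n g b A"
  shows "terminates n g swap_loop s (n * n * (n * (n * 22 + 8) + n * n * (n * n * 20 + 22) + n * 5 + 42) + 1)
     (swap_inv n (oracle_of n g b) \<kappa> b (n * n))"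
proof -
  have "terminates n g swap_loop s (n * n * ((n * (n * 22 + 8) + n * n * (n * n * 20 + 22) + n * 5 + 40) + 2) + 1)
     (swap_inv n (oracle_of n g b) \<kappa> b (n * n))"
    unfolding swap_loop_def
  proof (rule terminates_While[where I = "swap_inv n (oracle_of n g b) \<kappa> b"])
    fix i s assume i: "i < n * n" and I: "swap_inv n (oracle_of n g b) \<kappa> b i s"
    have "bval s (NLess (NVar 11) (NVar 13))" using I i by (simp add: swap_inv_def)
    then show "bval s (NLess (NVar 11) (NVar 13)) \<and> terminates n g swap_step s (n * (n * 22 + 8) + n * n * (n * n * 20 + 22) + n * 5 + 40) (swap_inv n (oracle_of n g b) \<kappa> b (Suc i))"
      using swap_step_terminates[OF I \<kappa> nn] by blast
  next
    show "\<And>s. swap_inv n (oracle_of n g b) \<kappa> b (n * n) s \<Longrightarrow> \<not> bval s (NLess (NVar 11) (NVar 13))" by (simp add: swap_inv_def)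
  qed (rule inv)
  then show ?thesis by (simp add: ac_simps)
qed

section \<open>Length of the avoiding phase; the aided algorithm as a whole\<close>

definition threshold_body :: com where
  "threshold_body = Seq (NAssign 15 (NSub (NVar 15) (NConst 5))) (NAssign 12 (NAdd (NVar 12) (NConst 1)))"

text \<open>Division by 5 is repeated subtraction. Below 1000 the avoiding phase is empty, since a
  bounded \<open>k\<close> loses only order \<open>1 / n\<close> in plain random greedy.\<close>

definition threshold :: com where
  "threshold = Seq (Seq (NAssign 11 (NConst 0)) (NAssign 12 (NConst 0)))
     (If (NLess (NVar 2) (NConst 1000)) Skip
       (Seq (NAssign 15 (NAdd (NVar 2) (NVar 2))) (While (BNot (NLess (NVar 15) (NConst 5))) threshold_body)))"

lemma threshold_terminates:
  shows "terminates n g threshold s (2 * nvar s 2 * 5 + 9) (\<lambda>s'. agree {11,12,15} {} {} s s' \<and> nvar s' 11 = 0 \<and>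
    nvar s' 12 = (if nvar s 2 < 1000 then 0 else 2 * nvar s 2 div 5))"
proof -
  let ?k = "nvar s 2"
  let ?Q = "\<lambda>s'. agree {11,12,15} {} {} s s' \<and> nvar s' 11 = 0 \<and> nvar s' 12 = (if ?k < 1000 then 0 else 2 * ?k div 5)"
  let ?Init = "\<lambda>s'. agree {11,12,15} {} {} s s' \<and> nvar s' 11 = 0 \<and> nvar s' 12 = 0"
  let ?N = "2 * ?k div 5"
  let ?I = "\<lambda>i s'. agree {11,12,15} {} {} s s' \<and> nvar s' 11 = 0 \<and> nvar s' 12 = i \<and> nvar s' 15 = 2 * ?k - 5 * i"
  have loop: "terminates n g (While (BNot (NLess (NVar 15) (NConst 5))) threshold_body) s1 (?N * (3 + 2) + 1) (?I ?N)" if "?I 0 s1" for s1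
  proof (rule terminates_While[where I = ?I])
    fix i s' assume i: "i < ?N" and I: "?I i s'"
    have "5 * Suc i \<le> 2 * ?k" using i by presburger
    moreover have "terminates n g threshold_body s' 3 (?I (Suc i))"
      by (rule terminates_straight) (use I in \<open>auto simp: threshold_body_def agree_def\<close>)
    ultimately show "bval s' (BNot (NLess (NVar 15) (NConst 5))) \<and> terminates n g threshold_body s' 3 (?I (Suc i))"
      using I by simp
  next
    show "\<And>s'. ?I ?N s' \<Longrightarrow> \<not> bval s' (BNot (NLess (NVar 15) (NConst 5)))" by simp
  qed (rule that)
  show ?thesis
    unfolding threshold_def
  proof (rule terminates_mono[OF terminates_Seq[where ?Q1.0 = ?Init]])
    show "terminates n g (Seq (NAssign 11 (NConst 0)) (NAssign 12 (NConst 0))) s 3 ?Init"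
      by (rule terminates_straight) (auto simp: agree_def)
    fix s1 assume Q0: "?Init s1"
    have k1: "nvar s1 2 = ?k" using Q0 by (auto simp: agree_def)
    show "terminates n g (If (NLess (NVar 2) (NConst 1000)) Skip
       (Seq (NAssign 15 (NAdd (NVar 2) (NVar 2))) (While (BNot (NLess (NVar 15) (NConst 5))) threshold_body))) s1
        ((1 + (?N * (3 + 2) + 1) + 1) + 1) ?Q"
    proof (rule terminates_If)
      assume "bval s1 (NLess (NVar 2) (NConst 1000))"
      then have "?k < 1000" using k1 by simp
      then show "terminates n g Skip s1 (1 + (?N * (3 + 2) + 1) + 1) ?Q"
        by (intro terminates_straight) (use Q0 in auto)
    next
      assume "\<not> bval s1 (NLess (NVar 2) (NConst 1000))"
      then have k: "\<not> ?k < 1000" using k1 by simp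
      have "terminates n g (Seq (NAssign 15 (NAdd (NVar 2) (NVar 2))) (While (BNot (NLess (NVar 15) (NConst 5))) threshold_body)) s1
         (1 + (?N * (3 + 2) + 1) + 1) (?I ?N)"
      proof (rule terminates_Seq[where ?Q1.0 = "?I 0"])
        show "terminates n g (NAssign 15 (NAdd (NVar 2) (NVar 2))) s1 1 (?I 0)"
          by (rule terminates_straight) (use Q0 k1 in \<open>auto simp: agree_def\<close>)
      qed (rule loop)
      then show "terminates n g (Seq (NAssign 15 (NAdd (NVar 2) (NVar 2))) (While (BNot (NLess (NVar 15) (NConst 5))) threshold_body)) s1
         (1 + (?N * (3 + 2) + 1) + 1) ?Q"
        by (rule terminates_mono) (simp_all only: if_not_P[OF k] order_refl)
    qed
  qed auto
qed

definition better_set :: com where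
  "better_set = Seq (Seq (Query 1 0) (Query 2 1)) (If (RLess (RVar 1) (RVar 2)) (copy_array 1 0) Skip)"

lemma better_set_terminates:
  fixes g :: "nat set \<Rightarrow> real"
  assumes inv: "greedy_inv n \<kappa> t b Z \<kappa> s" and cZ: "card Z = \<kappa>"
  shows "terminates n g better_set s (n * 5 + 8) (\<lambda>s'. nvar s' 3 = b \<and> flags s' \<and> valid n s' 0 \<and> card (members n s' 0) = \<kappa> \<and>
     max (oracle_of n g b (members n s 0)) (oracle_of n g b Z) \<le> oracle_of n g b (members n s' 0))"
proof -
  define F where "F = oracle_of n g b"
  define S where "S = members n s 0"
  have s: "nvar s 0 = n" "nvar s 3 = b" "flags s" "valid n s 0" "valid n s 1" "members n s 1 = Z" "card S = \<kappa>"
    using inv unfolding greedy_inv_def S_def by auto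
  let ?Q = "\<lambda>s'. nvar s' 3 = b \<and> flags s' \<and> valid n s' 0 \<and> card (members n s' 0) = \<kappa> \<and>
     max (F S) (F Z) \<le> F (members n s' 0)"
  have q: "g (array_set n s 0) = F S" "g (array_set n s 1) = F Z"
    using query_value[OF s(3,4), of g] query_value[OF s(3,5), of g] unfolding s(2,6) F_def S_def by auto
  have as: "array_set n (s\<lparr>rvar := X\<rparr>) a = array_set n s a" for X a by (simp add: array_set_def)
  let ?Q1 = "\<lambda>s' :: state. nvar s' = nvar s \<and> narr s' = narr s \<and> rvar s' 1 = F S \<and> rvar s' 2 = F Z"
  show ?thesis
    unfolding better_set_def F_def[symmetric] S_def[symmetric]
  proof (rule terminates_mono[OF terminates_Seq[where ?Q1.0 = ?Q1]])
    show "terminates n g (Seq (Query 1 0) (Query 2 1)) s 3 ?Q1"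
      by (rule terminates_straight) (use q in \<open>auto simp: as\<close>)
    fix s1 assume Q1: "?Q1 s1"
    show "terminates n g (If (RLess (RVar 1) (RVar 2)) (copy_array 1 0) Skip) s1 ((n * 5 + 3) + 1) ?Q"
    proof (rule terminates_If)
      assume "bval s1 (RLess (RVar 1) (RVar 2))"
      then have lt: "F S < F Z" using Q1 by simp
      show "terminates n g (copy_array 1 0) s1 (n * 5 + 3) ?Q"
      proof (rule terminates_mono[OF copy_array_terminates])
        show "nvar s1 0 = n" using Q1 s by simp
        fix s2 assume A: "agree {15} {0} {} s1 s2 \<and> rarr s2 = rarr s1 \<and> (\<forall>i<n. narr s2 0 i = narr s1 1 i)"
        then have v: "nvar s2 3 = b" "nvar s2 4 = nvar s 4" "\<And>i. i < n \<Longrightarrow> narr s2 0 i = narr s 1 i"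
          using Q1 s by (auto simp: agree_def)
        have m: "members n s2 0 = Z" unfolding s(6)[symmetric] members_def using v s(2) by auto
        have "flags s2" "valid n s2 0" using s(2,3,5) v by (auto simp: flags_def valid_def)
        then show "?Q s2" using m v cZ lt by simp
      qed auto
    next
      assume "\<not> bval s1 (RLess (RVar 1) (RVar 2))"
      then have ge: "F Z \<le> F S" using Q1 by simp
      have m: "members n s1 0 = S" unfolding S_def members_def using Q1 by simp
      have "flags s1" "valid n s1 0" using s(3,4) Q1 by (auto simp: flags_def valid_def)
      then show "terminates n g Skip s1 (n * 5 + 3) ?Q"
        by (intro terminates_straight) (use m Q1 s ge in auto)
    qed
  qed auto
qed

definition aided_prefix :: com where
  "aided_prefix = Seq init_sets (Seq swap_loop threshold)"

definition aided :: com where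
  "aided = Seq aided_prefix (Seq greedy_loop better_set)"

lemma aided_prefix_terminates:
  fixes g :: "nat set \<Rightarrow> real"
  assumes s: "nvar s 0 = n" "nvar s 2 = \<kappa>" "nvar s 3 = b" "flags s" "nvar s 13 = 0" "nvar s 11 = 0"
    and \<kappa>: "1 \<le> \<kappa>" "\<kappa> < n"
    and nn: "\<And>A. A \<subseteq> {..<n} \<Longrightarrow> 0 \<le> oracle_of n g b A"
    and P: "\<And>A. A \<subseteq> {..<n} \<Longrightarrow> card A = \<kappa> \<Longrightarrow> oracle_of n g b A \<le> P"
  shows "terminates n g aided_prefix s (n * 10 + n * n * (n * (n * 22 + 8) + n * n * (n * n * 20 + 22) + n * 5 + 42) + n * 10 + 20)
    (\<lambda>s'. \<exists>Z \<delta>. greedy_inv n \<kappa> (if \<kappa> < 1000 then 0 else 2 * \<kappa> div 5) b Z 0 s' \<and> Z \<subseteq> {..<n} \<and> card Z = \<kappa> \<and> 0 \<le> \<delta> \<and>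
       real (n * n) * \<delta> \<le> P \<and>
       (\<forall>u\<in>Z. \<forall>v\<in>{..<n} - Z. oracle_of n g b (insert v (Z - {u})) \<le> oracle_of n g b Z + \<delta>))"
proof -
  define F where "F = oracle_of n g b"
  let ?t = "if \<kappa> < 1000 then 0 else 2 * \<kappa> div 5"
  let ?Q = "\<lambda>s'. \<exists>Z \<delta>. greedy_inv n \<kappa> ?t b Z 0 s' \<and> Z \<subseteq> {..<n} \<and> card Z = \<kappa> \<and> 0 \<le> \<delta> \<and>
       real (n * n) * \<delta> \<le> P \<and> (\<forall>u\<in>Z. \<forall>v\<in>{..<n} - Z. F (insert v (Z - {u})) \<le> F Z + \<delta>)"
  have neq: "nvar s 3 \<noteq> nvar s 4" using flags_neq[OF s(4)] .
  have init: "terminates n g init_sets s (n * 10 + 3) (swap_inv n F \<kappa> b 0)"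
  proof (rule terminates_mono[OF init_sets_terminates[OF s(1,5)]])
    fix s' assume A: "agree {13,15} {0,2} {} s s' \<and> nvar s' 13 = n * n \<and>
     (\<forall>i<n. narr s' 0 i = nvar s 4 \<and> narr s' 2 i = (if i < nvar s 2 then nvar s 3 else nvar s 4))"
    then have v: "nvar s' 0 = n" "nvar s' 2 = \<kappa>" "nvar s' 3 = b" "nvar s' 4 = nvar s 4" "nvar s' 11 = 0"
      using s by (auto simp: agree_def)
    have m: "members n s' 2 = {..<\<kappa>}" unfolding members_def using A v s neq \<kappa> by (auto split: if_splits)
    have "flags s'" "valid n s' 2" using s A v by (auto simp: flags_def valid_def)
    then show "swap_inv n F \<kappa> b 0 s'" unfolding swap_inv_def m using A v by simp
  qed auto
  have ls: "terminates n g swap_loop s1 (n * n * (n * (n * 22 + 8) + n * n * (n * n * 20 + 22) + n * 5 + 42) + 1) (swap_inv n F \<kappa> b (n * n))"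
    if "swap_inv n F \<kappa> b 0 s1" for s1
    using swap_loop_terminates[of n g b \<kappa> s1] that \<kappa> nn unfolding F_def by blast
  have th: "terminates n g threshold s2 (n * 10 + 9) ?Q" if inv: "swap_inv n F \<kappa> b (n * n) s2" for s2
  proof (rule terminates_mono[OF threshold_terminates])
    have n0: "0 < n * n" using \<kappa> by simp
    define Z where "Z = members n s2 1"
    have i: "nvar s2 0 = n" "nvar s2 2 = \<kappa>" "nvar s2 3 = b" "flags s2" "\<And>j. j < n \<Longrightarrow> narr s2 0 j = nvar s2 4"
      "valid n s2 1" "card Z = \<kappa>" "\<forall>u\<in>Z. \<forall>v\<in>{..<n} - Z. F (insert v (Z - {u})) \<le> F Z + rvar s2 4"
      "real (n * n) * max 0 (rvar s2 4) \<le> F (members n s2 2)" "card (members n s2 2) = \<kappa>"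
      using inv n0 unfolding swap_inv_def Z_def by auto
    show "2 * nvar s2 2 * 5 + 9 \<le> n * 10 + 9" using i(2) \<kappa> by simp
    fix s3 assume A: "agree {11,12,15} {} {} s2 s3 \<and> nvar s3 11 = 0 \<and> nvar s3 12 = (if nvar s2 2 < 1000 then 0 else 2 * nvar s2 2 div 5)"
    then have v: "nvar s3 0 = n" "nvar s3 2 = \<kappa>" "nvar s3 3 = b" "nvar s3 4 = nvar s2 4" "nvar s3 11 = 0" "nvar s3 12 = ?t"
       "\<And>a. narr s3 a = narr s2 a" using i by (auto simp: agree_def)
    have neq2: "nvar s2 4 \<noteq> b" using flags_neq[OF i(4)] i(3) by simp
    have m: "members n s3 1 = Z" unfolding Z_def members_def v by (simp add: i)
    have m0: "members n s3 0 = {}" unfolding members_def v using i(5) neq2 by auto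
    have "flags s3" "valid n s3 0" "valid n s3 1" using i(3,4,5,6) by (auto simp: flags_def valid_def v)
    then have "greedy_inv n \<kappa> ?t b Z 0 s3" unfolding greedy_inv_def m m0 using v by simp
    moreover have "F (members n s2 2) \<le> P" unfolding F_def by (rule P) (use i(10) in \<open>auto simp: members_def\<close>)
    then have "real (n * n) * max 0 (rvar s2 4) \<le> P" using i(9) by linarith
    moreover have "\<forall>u\<in>Z. \<forall>v\<in>{..<n} - Z. F (insert v (Z - {u})) \<le> F Z + max 0 (rvar s2 4)"
      using i(8) by (auto intro: order_trans[OF _ add_left_mono[OF max.cobounded2]])
    moreover have "Z \<subseteq> {..<n}" by (auto simp: Z_def members_def)
    ultimately show "?Q s3" using i(7) max.cobounded1 by blast
  qed
  show ?thesis
    unfolding aided_prefix_def F_def[symmetric]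
    by (rule terminates_mono[OF terminates_Seq[OF init terminates_Seq[OF ls th]]]) auto
qed

text \<open>The final comparison with \<open>Z\<close> lets three cases share one loop: if
  \<open>Z\<close> already reaches \<open>P / e\<close>, a constant potential works; for
  \<open>\<kappa> < 1000\<close> plain greedy loses \<open>a / e\<close> with
  \<open>a \<le> 10000 / (7 * n)\<close>; otherwise the aided bound applies with
  \<open>a = 1 / 7\<close>, at the cost of \<open>\<kappa> * \<delta> \<le> P / n\<close>. The
  constant 1000 covers both losses.\<close>

lemma aided_exec:
  fixes g :: "nat set \<Rightarrow> real"
  assumes s: "nvar s 0 = n" "nvar s 2 = \<kappa>" "nvar s 3 = b" "flags s" "nvar s 13 = 0" "nvar s 11 = 0"
    and \<kappa>: "1 \<le> \<kappa>" "10 * \<kappa> \<le> n"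
    and sub: "nonneg_submodular {..<n} (oracle_of n g b)"
    and P: "\<And>A. A \<subseteq> {..<n} \<Longrightarrow> card A = \<kappa> \<Longrightarrow> oracle_of n g b A \<le> P"
    and OPT: "OPT \<subseteq> {..<n}" "card OPT = \<kappa>" "oracle_of n g b OPT = P"
  shows "exec n g aided s (n * 10 + n * n * (n * (n * 22 + 8) + n * n * (n * n * 20 + 22) + n * 5 + 42) + n * 10 +
      n * (n * 30 + (n * (n * 20 + 22)) + 32) + n * 5 + 40)
    (\<lambda>s'. nvar s' 3 = b \<and> flags s' \<and> valid n s' 0 \<and> card (members n s' 0) = \<kappa>)
    (\<lambda>s'. oracle_of n g b (members n s' 0)) ((exp (- 1) - 1000 / real n) * P)"
proof -
  define F where "F = oracle_of n g b"
  interpret nonneg_submodular "{..<n}" F using sub unfolding F_def .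
  have P0: "0 \<le> P" unfolding OPT(3)[symmetric] F_def[symmetric] using OPT(1) by (rule nonneg)
  have n0: "0 < n" "10 \<le> n" using \<kappa> by auto
  let ?t = "if \<kappa> < 1000 then 0 else 2 * \<kappa> div 5"
  define v where "v = (exp (- 1) - 1000 / real n) * P"
  let ?Q = "\<lambda>s'. nvar s' 3 = b \<and> flags s' \<and> valid n s' 0 \<and> card (members n s' 0) = \<kappa>"
  let ?R = "\<lambda>s'. \<exists>Z \<delta>. greedy_inv n \<kappa> ?t b Z 0 s' \<and> Z \<subseteq> {..<n} \<and> card Z = \<kappa> \<and> 0 \<le> \<delta> \<and>
       real (n * n) * \<delta> \<le> P \<and> (\<forall>u\<in>Z. \<forall>v\<in>{..<n} - Z. F (insert v (Z - {u})) \<le> F Z + \<delta>)"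
  have pre: "terminates n g aided_prefix s (n * 10 + n * n * (n * (n * 22 + 8) + n * n * (n * n * 20 + 22) + n * 5 + 42) + n * 10 + 20) ?R"
    unfolding F_def using s \<kappa> P nonneg by (intro aided_prefix_terminates) (auto simp: F_def)
  have main: "exec n g (Seq greedy_loop better_set) s1 ((n * (n * 30 + (n * (n * 20 + 22)) + 32) + 1) + (n * 5 + 8) + 1) ?Q
      (\<lambda>s'. F (members n s' 0)) v" if R: "?R s1" for s1
  proof -
    obtain Z \<delta> where Z: "greedy_inv n \<kappa> ?t b Z 0 s1" "Z \<subseteq> {..<n}" "card Z = \<kappa>" "0 \<le> \<delta>" "real (n * n) * \<delta> \<le> P"
      "\<And>u v. u \<in> Z \<Longrightarrow> v \<in> {..<n} - Z \<Longrightarrow> F (insert v (Z - {u})) \<le> F Z + \<delta>" using R by blast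
    have tail: "exec n g better_set s2 (n * 5 + 8) ?Q (\<lambda>s'. F (members n s' 0)) (max (F (members n s2 0)) (F Z))"
      if "greedy_inv n \<kappa> ?t b Z \<kappa> s2" for s2
      by (rule exec_mono[OF exec_terminates[where v = "max (F (members n s2 0)) (F Z)" and \<phi> = "\<lambda>s'. F (members n s' 0)",
            OF better_set_terminates[OF that Z(3), of g, folded F_def]]]) auto
    have \<kappa>4: "4 * \<kappa> \<le> n" using \<kappa> by simp
    have "\<exists>V. (\<forall>i S E \<sigma> N. i < \<kappa> \<longrightarrow> S \<subseteq> {..<n} \<longrightarrow> card S = i \<longrightarrow> (i < ?t \<longrightarrow> S \<inter> Z = {}) \<longrightarrow>
       E = (if i < ?t then {..<n} - Z - S else {..<n} - S) \<longrightarrow> bij_betw \<sigma> {..<N} E \<longrightarrow> \<kappa> \<le> N \<longrightarrow>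
       (\<forall>j j'. j < j' \<longrightarrow> j' < N \<longrightarrow> F (insert (\<sigma> j') S) \<le> F (insert (\<sigma> j) S)) \<longrightarrow>
       real \<kappa> * V i S \<le> (\<Sum>j<\<kappa>. V (Suc i) (insert (\<sigma> j) S))) \<and> v \<le> V 0 {} \<and> (\<forall>S. V \<kappa> S \<le> max (F S) (F Z))"
    proof (cases "exp (- 1) * P \<le> F Z")
      case True
      have "v \<le> exp (- 1) * P" unfolding v_def using P0 by (intro mult_right_mono) auto
      then have "v \<le> F Z" using True by linarith
      then show ?thesis by (intro exI[of _ "\<lambda>_ _. v"]) auto
    next
      case False
      define a where "a = (if \<kappa> < 1000 then real \<kappa> / real (n - 3 * \<kappa>) else 1 / 7)"
      have nk: "7 * real \<kappa> \<le> real (n - 3 * \<kappa>)" using \<kappa> by (simp add: of_nat_diff)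
      have a7: "real \<kappa> / real (n - 3 * \<kappa>) \<le> 1 / 7" using nk \<kappa> by (simp add: field_simps)
      have a: "real \<kappa> / real (n - 3 * \<kappa>) \<le> a" "a \<le> 1 / 7" using a7 by (auto simp: a_def)
      have "a \<le> 1" using a(2) by (rule order_trans) simp
      interpret ag: aided_greedy "{..<n}" F OPT Z \<kappa> ?t a
        by unfold_locales (use OPT Z \<kappa> a \<open>a \<le> 1\<close> \<kappa>4 in auto)
      have as: "?t = 0 \<or> (7 * a \<le> 1 \<and> 5 * ?t \<le> 2 * \<kappa>)" using a(2) by auto
      have fin: "ag.greedy_pot \<kappa> S \<le> max (F S) (F Z)" for S
      proof -
        have "\<not> \<kappa> < ?t" by auto
        then have "ag.greedy_pot \<kappa> S = F S" unfolding ag.greedy_pot_def ag.free_pot_def by simp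
        then show ?thesis by simp
      qed
      have start: "v \<le> ag.greedy_pot 0 {}"
      proof (cases "\<kappa> < 1000")
        case True
        have st: "(1 - a) * (exp (- 1) * F OPT) \<le> ag.greedy_pot 0 {}" by (rule ag.greedy_start_plain) (use True in simp)
        have "7 * real n \<le> 10 * real (n - 3 * \<kappa>)" using \<kappa> by (simp add: of_nat_diff)
        then have "a \<le> 10 * real \<kappa> / (7 * real n)" unfolding a_def using True \<kappa> n0 by (simp add: field_simps)
        also have "\<dots> \<le> 10000 / (7 * real n)" using True n0 by (intro divide_right_mono) auto
        finally have a': "a \<le> 10000 / (7 * real n)" .
        have "a * exp (- 1) \<le> 10000 / (7 * real n) * (3682 / 10000)"
          using a' exp_minus_1_le ag.a_nonneg by (intro mult_mono) auto
        also have "\<dots> \<le> 1000 / real n" using n0 by (simp add: field_simps)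
        finally have "exp (- 1) - 1000 / real n \<le> (1 - a) * exp (- 1)" by (simp add: algebra_simps)
        then have "v \<le> (1 - a) * exp (- 1) * P" unfolding v_def using P0 by (intro mult_right_mono)
        then show ?thesis using st OPT(3) unfolding F_def[symmetric] by (simp add: mult.assoc)
      next
        case large: False
        have swap: "F (OPT \<union> Z) + F (OPT \<inter> Z) \<le> 2 * F Z + real \<kappa> * \<delta>"
          by (rule swap_local_optimum) (use Z OPT in auto)
        have st: "exp (- 1) * F OPT - real \<kappa> * \<delta> \<le> ag.greedy_pot 0 {}"
        proof (rule ag.greedy_start_aided)
          show "1000 \<le> \<kappa>" "?t = 2 * \<kappa> div 5" "a = 1 / 7" using large by (auto simp: a_def)
          show "F Z \<le> exp (- 1) * F OPT" using False OPT(3) unfolding F_def by simp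
        qed (use Z swap in auto)
        have "real \<kappa> * \<delta> \<le> real n * \<delta>" using \<kappa> Z(4) by (intro mult_right_mono) auto
        also have "\<dots> \<le> P / real n" using Z(5) n0 by (simp add: field_simps)
        also have "\<dots> \<le> 1000 / real n * P" using P0 n0 by (simp add: field_simps)
        finally have "v \<le> exp (- 1) * P - real \<kappa> * \<delta>" unfolding v_def by (simp add: algebra_simps)
        then show ?thesis using st OPT(3) unfolding F_def[symmetric] by simp
      qed
      show ?thesis
        by (intro exI[of _ ag.greedy_pot] conjI allI impI start fin)
          (rule ag.greedy_pot_step[OF as], auto)
    qed
    then obtain V where V1: "\<forall>i S E \<sigma> N. i < \<kappa> \<longrightarrow> S \<subseteq> {..<n} \<longrightarrow> card S = i \<longrightarrow> (i < ?t \<longrightarrow> S \<inter> Z = {}) \<longrightarrow>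
       E = (if i < ?t then {..<n} - Z - S else {..<n} - S) \<longrightarrow> bij_betw \<sigma> {..<N} E \<longrightarrow> \<kappa> \<le> N \<longrightarrow>
       (\<forall>j j'. j < j' \<longrightarrow> j' < N \<longrightarrow> F (insert (\<sigma> j') S) \<le> F (insert (\<sigma> j) S)) \<longrightarrow>
       real \<kappa> * V i S \<le> (\<Sum>j<\<kappa>. V (Suc i) (insert (\<sigma> j) S))"
      and V2: "v \<le> V 0 {}" and V3: "\<forall>S. V \<kappa> S \<le> max (F S) (F Z)"
      by (elim exE conjE)
    have "exec n g greedy_loop s1 (n * (n * 30 + (n * (n * 20 + 22)) + 32) + 1) (greedy_inv n \<kappa> ?t b Z \<kappa>)
     (\<lambda>s'. V \<kappa> (members n s' 0)) (V 0 {})"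
      by (rule greedy_loop_exec[OF Z(1) \<kappa>4 Z(3)]) (rule V1[unfolded F_def, rule_format])
    then have "exec n g greedy_loop s1 (n * (n * 30 + (n * (n * 20 + 22)) + 32) + 1) (greedy_inv n \<kappa> ?t b Z \<kappa>)
     (\<lambda>s'. max (F (members n s' 0)) (F Z)) v"
      by (rule exec_mono) (use V2 V3 in auto)
    then show ?thesis by (rule exec_Seq) (rule tail)
  qed
  show ?thesis
    unfolding aided_def F_def[symmetric] v_def[symmetric]
  proof (rule exec_mono[OF exec_Seq[OF exec_terminates[OF pre]]])
    show "\<And>s'. ?R s' \<Longrightarrow> v \<le> v" by simp
    show "\<And>s'. ?R s' \<Longrightarrow> exec n g (Seq greedy_loop better_set) s' ((n * (n * 30 + (n * (n * 20 + 22)) + 32) + 1) + (n * 5 + 8) + 1) ?Q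
      (\<lambda>s'. F (members n s' 0)) v" by (rule main)
  qed auto
qed

section \<open>Double greedy as a program\<close>

text \<open>Multiplication by a fixed power of two as an expression of fixed size, because the
  machine can only add.\<close>

definition ndouble :: "nat \<Rightarrow> nexp \<Rightarrow> nexp" where "ndouble m = (\<lambda>u. NAdd u u) ^^ m"

definition rdouble :: "nat \<Rightarrow> rexp \<Rightarrow> rexp" where "rdouble m = (\<lambda>u. RAdd u u) ^^ m"

lemma nval_ndouble [simp]: "nval s (ndouble m u) = 2 ^ m * nval s u"
  by (induction m) (auto simp: ndouble_def)

lemma rval_rdouble [simp]: "rval s (rdouble m u) = 2 ^ m * rval s u"
  by (induction m) (auto simp: rdouble_def)

definition dg_cond :: bexp where
  "dg_cond = BAnd (NEq (NArr 0 (NVar 15)) (NConst 0)) (NLess (NConst 0) (NArr 1 (NVar 15)))"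

text \<open>Real register 7 is set to the key of token 0, \<open>s - 8192 * a\<close>; every further
  token of the element adds \<open>2 * s\<close>, kept half in register 6.\<close>

definition dg_prep :: com where
  "dg_prep = Seq (NStore 0 (NVar 15) (NConst 1)) (Seq (Query 3 0) (Seq (NStore 0 (NVar 15) (NConst 0))
     (Seq (NAssign 17 (NArr 1 (NVar 15))) (Seq (NStore 1 (NVar 15) (NConst 0)) (Seq (Query 4 1)
     (Seq (NStore 1 (NVar 15) (NVar 17)) (Seq (RAssign 5 (RSub (RVar 3) (RVar 1)))
     (Seq (RAssign 6 (RAdd (RVar 5) (RSub (RVar 4) (RVar 2))))
     (Seq (RAssign 7 (RSub (RVar 6) (rdouble 13 (RVar 5)))) (NAssign 16 (NConst 0)))))))))))"

definition dg_token :: com where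
  "dg_token = Seq (RStore 0 (NVar 5) (RVar 7)) (Seq (NStore 3 (NVar 5) (NVar 15)) (Seq (NStore 4 (NVar 5) (NVar 16))
     (Seq (NAssign 5 (NAdd (NVar 5) (NConst 1))) (Seq (RAssign 7 (RAdd (RVar 7) (RAdd (RVar 6) (RVar 6))))
       (NAssign 16 (NAdd (NVar 16) (NConst 1)))))))"

definition dg_element :: com where
  "dg_element = Seq (If dg_cond (Seq dg_prep (While (NLess (NVar 16) (NConst 4096)) dg_token)) Skip)
     (NAssign 15 (NAdd (NVar 15) (NConst 1)))"

definition dg_fill :: com where
  "dg_fill = Seq (Seq (NAssign 5 (NConst 0)) (NAssign 15 (NConst 0)))
     (While (NLess (NVar 15) (NVar 0)) dg_element)"

text \<open>The key of \<open>token_threshold\<close> for 4096 tokens, that is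
  \<open>2 * 4096\<close> times \<open>(2 * j + 1) / (2 * 4096) * s - a\<close>, scaled to avoid
  division.\<close>

definition dg_key :: "(nat set \<Rightarrow> real) \<Rightarrow> nat set \<Rightarrow> nat set \<Rightarrow> nat \<times> nat \<Rightarrow> real" where
  "dg_key g X Y = (\<lambda>(u, j). (2 * real j + 1) * (g (insert u X) - g X + (g (Y - {u}) - g Y))
     - 2 * real 4096 * (g (insert u X) - g X))"

lemma dg_fill_terminates:
  fixes g :: "nat set \<Rightarrow> real"
  assumes n: "nvar s 0 = n" and XY: "X = array_set n s 0" "Y = array_set n s 1" and r: "rvar s 1 = g X" "rvar s 2 = g Y"
  shows "terminates n g dg_fill s (n * 60000 + 6) (\<lambda>s'. agree {5,15,16,17} {3,4} {3,4,5,6,7} s s' \<and>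
     bij_betw (\<lambda>i. (narr s' 3 i, narr s' 4 i)) {..<nvar s' 5} ((Y - X) \<times> {..<4096}) \<and>
     (\<forall>i<nvar s' 5. rarr s' 0 i = dg_key g X Y (narr s' 3 i, narr s' 4 i)))"
proof -
  let ?E = "(Y - X) \<times> {..<4096 :: nat}"
  let ?B = "\<lambda>u v. ?E \<inter> {(a, b). a < u \<or> a = u \<and> b < v}"
  let ?I = "\<lambda>u s'. agree {5,15,16,17} {3,4} {3,4,5,6,7} s s' \<and> nvar s' 15 = u \<and>
     bij_betw (\<lambda>i. (narr s' 3 i, narr s' 4 i)) {..<nvar s' 5} (?B u 0) \<and>
     (\<forall>i<nvar s' 5. rarr s' 0 i = dg_key g X Y (narr s' 3 i, narr s' 4 i))"
  let ?J = "\<lambda>u v s'. agree {5,15,16,17} {3,4} {3,4,5,6,7} s s' \<and> nvar s' 15 = u \<and> nvar s' 16 = v \<and>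
     rvar s' 6 = g (insert u X) - g X + (g (Y - {u}) - g Y) \<and> rvar s' 7 = dg_key g X Y (u, v) \<and>
     bij_betw (\<lambda>i. (narr s' 3 i, narr s' 4 i)) {..<nvar s' 5} (?B u v) \<and>
     (\<forall>i<nvar s' 5. rarr s' 0 i = dg_key g X Y (narr s' 3 i, narr s' 4 i))"
  have tok: "terminates n g dg_token s' 11 (?J u (Suc v))" if u: "u \<in> Y - X" and v: "v < 4096" and J: "?J u v s'" for u v s'
  proof (rule terminates_straight)
    let ?N = "nvar s' 5"
    define s2 where "s2 = effect n g dg_token s'"
    have eff: "nvar s2 = (nvar s')(5 := Suc ?N, 16 := Suc v)"
      "narr s2 = (narr s')(3 := (narr s' 3)(?N := u), 4 := (narr s' 4)(?N := v))"
      "rvar s2 = (rvar s')(7 := rvar s' 7 + (rvar s' 6 + rvar s' 6))"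
      "rarr s2 0 = (rarr s' 0)(?N := rvar s' 7)"
      unfolding s2_def dg_token_def using J by simp_all
    have Bv: "?B u (Suc v) = insert (u, v) (?B u v)" using u v by (auto simp: less_Suc_eq)
    have "bij_betw ((\<lambda>i. (narr s' 3 i, narr s' 4 i))(?N := (u, v))) {..<Suc ?N} (?B u (Suc v))"
      unfolding Bv using J by (intro bij_betw_append) auto
    moreover have "(\<lambda>i. (narr s' 3 i, narr s' 4 i))(?N := (u, v)) = (\<lambda>i. (((narr s' 3)(?N := u)) i, ((narr s' 4)(?N := v)) i))"
      by auto
    ultimately have bij: "bij_betw (\<lambda>i. (narr s2 3 i, narr s2 4 i)) {..<nvar s2 5} (?B u (Suc v))"
      unfolding eff by simp
    have ag: "agree {5,15,16,17} {3,4} {3,4,5,6,7} s s2" using J eff(1,2,3) unfolding agree_def by simp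
    have key: "rvar s2 7 = dg_key g X Y (u, Suc v)" unfolding eff using J by (simp add: dg_key_def algebra_simps)
    have "\<forall>i<nvar s2 5. rarr s2 0 i = dg_key g X Y (narr s2 3 i, narr s2 4 i)"
      unfolding eff using J by (simp add: less_Suc_eq)
    then show "?J u (Suc v) (effect n g dg_token s')"
      unfolding s2_def[symmetric] using bij ag key J eff(1,3) by simp
  qed (auto simp: dg_token_def)
  have prep: "terminates n g dg_prep s' 30 (?J u 0)" if u: "u < n" "u \<in> Y - X" and I: "?I u s'" for u s'
  proof (rule terminates_straight)
    have w: "nvar s' 15 = u" "narr s' 0 = narr s 0" "narr s' 1 = narr s 1" "rvar s' 1 = g X" "rvar s' 2 = g Y"
      using I r by (auto simp: agree_def)
    have x0: "narr s 0 u = 0" using u XY by (simp add: array_set_def)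
    have q: "\<And>t. narr t 0 = (narr s 0)(u := 1) \<Longrightarrow> array_set n t 0 = insert u X"
      "\<And>t. narr t 1 = (narr s 1)(u := 0) \<Longrightarrow> array_set n t 1 = Y - {u}"
      unfolding XY array_set_def using u by auto
    have tr: "(narr s 0)(u := 0) = narr s 0" using x0 by auto
    define s2 where "s2 = effect n g dg_prep s'"
    have eff: "nvar s2 = (nvar s')(17 := narr s 1 u, 16 := 0)" "\<And>a. narr s2 a = narr s' a"
      "rvar s2 6 = g (insert u X) - g X + (g (Y - {u}) - g Y)"
      "rvar s2 7 = g (insert u X) - g X + (g (Y - {u}) - g Y) - 8192 * (g (insert u X) - g X)"
      "\<And>x. x \<notin> {3,4,5,6,7} \<Longrightarrow> rvar s2 x = rvar s' x" "rarr s2 = rarr s'"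
      unfolding s2_def dg_prep_def using q by (simp_all add: w tr fun_upd_idem del: One_nat_def)
    show "?J u 0 (effect n g dg_prep s')"
      unfolding s2_def[symmetric] using I eff by (simp add: agree_def dg_key_def)
  qed (auto simp: dg_prep_def)
  have elem: "terminates n g dg_element s' 59998 (?I (Suc u))" if u: "u < n" and I: "?I u s'" for u s'
    unfolding dg_element_def
  proof (rule terminates_mono[OF terminates_Seq[OF terminates_If]])
    let ?R = "\<lambda>s'. agree {5,15,16,17} {3,4} {3,4,5,6,7} s s' \<and> nvar s' 15 = u \<and>
     bij_betw (\<lambda>i. (narr s' 3 i, narr s' 4 i)) {..<nvar s' 5} (?B (Suc u) 0) \<and>
     (\<forall>i<nvar s' 5. rarr s' 0 i = dg_key g X Y (narr s' 3 i, narr s' 4 i))"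
    have w: "nvar s' 15 = u" "narr s' 0 = narr s 0" "narr s' 1 = narr s 1" using I by (auto simp: agree_def)
    have c: "bval s' dg_cond \<longleftrightarrow> u \<in> Y - X" unfolding dg_cond_def XY array_set_def using u w by auto
    show "terminates n g (Seq dg_prep (While (NLess (NVar 16) (NConst 4096)) dg_token)) s' (30 + (4096 * (11 + 2) + 1) + 1) ?R"
      if b: "bval s' dg_cond"
    proof (rule terminates_Seq[OF prep])
      have uE: "u \<in> Y - X" using b c by blast
      then show "u \<in> Y - X" .
      fix s1 assume J: "?J u 0 s1"
      show "terminates n g (While (NLess (NVar 16) (NConst 4096)) dg_token) s1 (4096 * (11 + 2) + 1) ?R"
      proof (rule terminates_mono[OF terminates_While[where I = "?J u"]])
        show "bval s2 (NLess (NVar 16) (NConst 4096)) \<and> terminates n g dg_token s2 11 (?J u (Suc v))"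
          if "v < 4096" "?J u v s2" for v s2 using tok[OF uE that] that by simp
        have "?B u 4096 = ?B (Suc u) 0" by (auto simp: less_Suc_eq)
        then show "\<And>s'. ?J u 4096 s' \<Longrightarrow> ?R s'" by simp
        show "?J u 0 s1" by (rule J)
      qed auto
    qed (use u I in blast)+
    show "terminates n g Skip s' (30 + (4096 * (11 + 2) + 1) + 1) ?R" if b: "\<not> bval s' dg_cond"
    proof (rule terminates_straight)
      have "u \<notin> Y - X" using b c by blast
      then have "?B (Suc u) 0 = ?B u 0" by (auto simp: less_Suc_eq)
      then show "?R (effect n g Skip s')" using I by simp
    qed auto
    show "terminates n g (NAssign 15 (NAdd (NVar 15) (NConst 1))) s2 1 (?I (Suc u))" if "?R s2" for s2
      by (rule terminates_straight) (use that in \<open>simp_all add: agree_def\<close>)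
  qed auto
  show ?thesis
    unfolding dg_fill_def
  proof (rule terminates_mono[OF terminates_Seq[where ?Q1.0 = "?I 0"]])
    show "terminates n g (Seq (NAssign 5 (NConst 0)) (NAssign 15 (NConst 0))) s 3 (?I 0)"
      by (rule terminates_straight) (auto simp: agree_def bij_betw_def)
    show "terminates n g (While (NLess (NVar 15) (NVar 0)) dg_element) s1 (n * (59998 + 2) + 1) (?I n)" if "?I 0 s1" for s1
    proof (rule terminates_While[where I = ?I])
      fix u s' assume u: "u < n" and I: "?I u s'"
      have "nvar s' 0 = n" using I n by (auto simp: agree_def)
      then show "bval s' (NLess (NVar 15) (NVar 0)) \<and> terminates n g dg_element s' 59998 (?I (Suc u))"
        using elem[OF u I] u I by simp
    next
      show "\<And>s'. ?I n s' \<Longrightarrow> \<not> bval s' (NLess (NVar 15) (NVar 0))" using n by (auto simp: agree_def)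
    qed (rule that)
    have "?B n 0 = ?E" by (auto simp: XY array_set_def)
    then show "\<And>s'. ?I n s' \<Longrightarrow> agree {5,15,16,17} {3,4} {3,4,5,6,7} s s' \<and>
     bij_betw (\<lambda>i. (narr s' 3 i, narr s' 4 i)) {..<nvar s' 5} ((Y - X) \<times> {..<4096}) \<and>
     (\<forall>i<nvar s' 5. rarr s' 0 i = dg_key g X Y (narr s' 3 i, narr s' 4 i))" by simp
  qed auto
qed

text \<open>Register 12 holds the number of picks left, so ranks below 4096 times its content are
  the selected tokens, whose elements are accepted.\<close>

definition dg_move :: com where
  "dg_move = Seq (If (NLess (NVar 10) (ndouble 12 (NVar 12)))
       (Seq (NStore 0 (NArr 3 (NVar 9)) (NConst 1)) (NAssign 12 (NSub (NVar 12) (NConst 1))))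
       (NStore 1 (NArr 3 (NVar 9)) (NConst 0)))
     (NAssign 11 (NAdd (NVar 11) (NConst 1)))"

definition dg_step :: com where
  "dg_step = Seq (Seq (Query 1 0) (Query 2 1)) (Seq dg_fill
     (Seq (Rand 10 (NSub (NVar 5) (NConst 1))) (Seq select dg_move)))"

definition dg_inv :: "nat \<Rightarrow> nat \<Rightarrow> nat \<Rightarrow> state \<Rightarrow> bool" where
  "dg_inv n k i s \<longleftrightarrow> nvar s 0 = n \<and> nvar s 11 = i \<and> array_set n s 0 \<subseteq> array_set n s 1 \<and>
     card (array_set n s 1 - array_set n s 0) = n - i \<and> card (array_set n s 0) \<le> k \<and> k \<le> card (array_set n s 1) \<and>
     nvar s 12 = k - card (array_set n s 0)"

lemma dg_move_terminates:
  assumes inv: "dg_inv n k i s" and i: "i < n" and u: "narr s 3 (nvar s 9) = u" "u \<in> Y - X"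
    and XY: "X = array_set n s 0" "Y = array_set n s 1" and \<rho>: "nvar s 10 < card (Y - X) * 4096"
  shows "terminates n g dg_move s 6 (\<lambda>s'. dg_inv n k (Suc i) s' \<and>
     (if nvar s 10 < 4096 * (k - card X) then array_set n s' 0 = insert u X \<and> array_set n s' 1 = Y
      else array_set n s' 0 = X \<and> array_set n s' 1 = Y - {u}))"
proof (rule terminates_straight)
  have un: "u < n" "u \<in> Y" "u \<notin> X" using u XY by (auto simp: array_set_def)
  have fin: "finite X" "finite Y" using XY by (auto simp: array_set_def)
  have s: "nvar s 0 = n" "nvar s 11 = i" "X \<subseteq> Y" "card (Y - X) = n - i" "card X \<le> k" "k \<le> card Y" "nvar s 12 = k - card X"
    using inv unfolding dg_inv_def XY by auto
  have cD: "card (Y - X) = card Y - card X" using s fin by (simp add: card_Diff_subset)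
  have cYX: "Suc (card X) \<le> card Y"
    using card_mono[of Y "insert u X"] fin un s(3) by simp
  define s2 where "s2 = effect n g dg_move s"
  have "dg_inv n k (Suc i) s2 \<and> (if nvar s 10 < 4096 * (k - card X) then array_set n s2 0 = insert u X \<and> array_set n s2 1 = Y
      else array_set n s2 0 = X \<and> array_set n s2 1 = Y - {u})"
  proof (cases "nvar s 10 < 4096 * (k - card X)")
    case True
    have eff: "nvar s2 0 = n" "nvar s2 11 = Suc i" "nvar s2 12 = k - card X - 1" "narr s2 0 = (narr s 0)(u := 1)" "narr s2 1 = narr s 1"
      unfolding s2_def dg_move_def using True s u by simp_all
    have XY2: "array_set n s2 0 = insert u X" "array_set n s2 1 = Y"
      unfolding XY array_set_def eff using un(1) by auto
    have "Y - insert u X = (Y - X) - {u}" by auto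
    then have "card (Y - insert u X) = n - Suc i" using u(2) s(4) fin by simp
    then show ?thesis using True s un fin eff unfolding dg_inv_def XY2 by auto
  next
    case False
    have eff: "nvar s2 0 = n" "nvar s2 11 = Suc i" "nvar s2 12 = k - card X" "narr s2 1 = (narr s 1)(u := 0)" "narr s2 0 = narr s 0"
      unfolding s2_def dg_move_def using False s u by simp_all
    have XY2: "array_set n s2 1 = Y - {u}" "array_set n s2 0 = X"
      unfolding XY array_set_def eff using un(1) by auto
    have "Y - {u} - X = (Y - X) - {u}" by auto
    then have c: "card (Y - {u} - X) = n - Suc i" using u(2) s(4) fin by simp
    \<comment> \<open>A rejection presupposes an unselected token, so there are more undecided
      elements than picks left, and \<open>Y\<close> can spare one.\<close>
    have "k - card X < card Y - card X" using False \<rho> cD by linarith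
    then have "k \<le> card (Y - {u})" using un(2) fin by simp
    then show ?thesis using False c s un fin eff unfolding dg_inv_def XY2 by auto
  qed
  then show "dg_inv n k (Suc i) (effect n g dg_move s) \<and>
     (if nvar s 10 < 4096 * (k - card X) then array_set n (effect n g dg_move s) 0 = insert u X \<and> array_set n (effect n g dg_move s) 1 = Y
      else array_set n (effect n g dg_move s) 0 = X \<and> array_set n (effect n g dg_move s) 1 = Y - {u})"
    unfolding s2_def .
qed (auto simp: dg_move_def)


text \<open>All that the program proof asks of a potential. It ranges over every sorted enumeration,
  so the order among equal keys may be left to the selection routine.\<close>

definition dg_ineq :: "nat \<Rightarrow> nat \<Rightarrow> (nat set \<Rightarrow> real) \<Rightarrow> (nat set \<Rightarrow> nat set \<Rightarrow> real) \<Rightarrow> bool" where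
  "dg_ineq n k g V \<longleftrightarrow> (\<forall>X Y \<sigma>. X \<subseteq> Y \<longrightarrow> Y \<subseteq> {..<n} \<longrightarrow> card X \<le> k \<longrightarrow> k \<le> card Y \<longrightarrow> X \<noteq> Y \<longrightarrow>
     bij_betw \<sigma> {..<card (Y - X) * 4096} ((Y - X) \<times> {..<4096}) \<longrightarrow>
     (\<forall>j j'. j < j' \<longrightarrow> j' < card (Y - X) * 4096 \<longrightarrow> dg_key g X Y (\<sigma> j) \<le> dg_key g X Y (\<sigma> j')) \<longrightarrow>
     real (card (Y - X) * 4096) * V X Y \<le> (\<Sum>j<card (Y - X) * 4096.
       if j < 4096 * (k - card X) then V (insert (fst (\<sigma> j)) X) Y else V X (Y - {fst (\<sigma> j)})))"

lemma dg_step_exec: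
  assumes inv: "dg_inv n k i s" and i: "i < n" and V: "dg_ineq n k g V"
  shows "exec n g dg_step s (n * 60000 + n * 4096 * (n * 4096 * 20 + 22) + 30) (dg_inv n k (Suc i))
     (\<lambda>s'. V (array_set n s' 0) (array_set n s' 1)) (V (array_set n s 0) (array_set n s 1))"
proof -
  define X Y where "X = array_set n s 0" and "Y = array_set n s 1"
  have s: "nvar s 0 = n" "nvar s 11 = i" "X \<subseteq> Y" "card (Y - X) = n - i" "card X \<le> k" "k \<le> card Y" "nvar s 12 = k - card X"
    using inv unfolding dg_inv_def X_def Y_def by auto
  have YU: "Y \<subseteq> {..<n}" by (auto simp: Y_def array_set_def)
  define N where "N = card (Y - X) * 4096"
  have Nn: "N \<le> n * 4096" unfolding N_def s by simp
  have N0: "0 < N" unfolding N_def s using i by simp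
  have neq: "X \<noteq> Y" using s(4) i by auto
  let ?Q1 = "\<lambda>s'. agree {} {} {1,2} s s' \<and> rvar s' 1 = g X \<and> rvar s' 2 = g Y"
  let ?Q2 = "\<lambda>s'. agree {5,15,16,17} {3,4} {1,2,3,4,5,6,7} s s' \<and>
     bij_betw (\<lambda>i. (narr s' 3 i, narr s' 4 i)) {..<nvar s' 5} ((Y - X) \<times> {..<4096}) \<and>
     (\<forall>i<nvar s' 5. rarr s' 0 i = dg_key g X Y (narr s' 3 i, narr s' 4 i))"
  let ?post = "\<lambda>s'. V (array_set n s' 0) (array_set n s' 1)"
  have q: "terminates n g (Seq (Query 1 0) (Query 2 1)) s 3 ?Q1"
  proof (rule terminates_straight)
    show "?Q1 (effect n g (Seq (Query 1 0) (Query 2 1)) s)"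
      by (simp add: agree_def X_def Y_def array_set_def)
  qed auto
  have fill: "terminates n g dg_fill s1 (n * 60000 + 6) ?Q2" if Q: "?Q1 s1" for s1
  proof (rule terminates_mono[OF dg_fill_terminates[of s1 n X Y g]])
    have a: "agree {} {} {1,2} s s1" using Q by blast
    show "nvar s1 0 = n" using agreeD(1)[OF a] s(1) by simp
    show "X = array_set n s1 0" "Y = array_set n s1 1" using agreeD(2)[OF a] by (simp_all add: X_def Y_def array_set_def)
    show "rvar s1 1 = g X" "rvar s1 2 = g Y" using Q by auto
    fix s2 assume Q2: "agree {5,15,16,17} {3,4} {3,4,5,6,7} s1 s2 \<and>
     bij_betw (\<lambda>i. (narr s2 3 i, narr s2 4 i)) {..<nvar s2 5} ((Y - X) \<times> {..<4096}) \<and>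
     (\<forall>i<nvar s2 5. rarr s2 0 i = dg_key g X Y (narr s2 3 i, narr s2 4 i))"
    have "agree {5,15,16,17} {3,4} {1,2,3,4,5,6,7} s s2"
      by (rule agree_trans[of _ _ _ s s1]) (rule agree_mono[OF a], auto intro: agree_mono[OF conjunct1[OF Q2]])
    then show "?Q2 s2" using Q2 by blast
  qed auto
  have rest: "exec n g (Seq (Rand 10 (NSub (NVar 5) (NConst 1))) (Seq select dg_move)) s1
       (1 + ((n * 4096 * (n * 4096 * 20 + 22) + 3) + 6 + 1) + 1) (dg_inv n k (Suc i)) ?post (V X Y)" if Q2: "?Q2 s1" for s1
  proof -
    have a: "agree {5,15,16,17} {3,4} {1,2,3,4,5,6,7} s s1" using Q2 by blast
    have bij: "bij_betw (\<lambda>i. (narr s1 3 i, narr s1 4 i)) {..<nvar s1 5} ((Y - X) \<times> {..<4096})" using Q2 by blast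
    have N: "nvar s1 5 = N" using bij_betw_same_card[OF bij] unfolding N_def by (simp add: card_cartesian_product)
    define \<sigma> where "\<sigma> = (\<lambda>i. (narr s1 3 i, narr s1 4 i)) \<circ> order_index (rarr s1 0) N"
    have \<sigma>: "bij_betw \<sigma> {..<N} ((Y - X) \<times> {..<4096})"
      unfolding \<sigma>_def by (rule sorted_tokens(1)[OF bij[unfolded N], where key = "dg_key g X Y"]) (use Q2 N in blast)
    have srt: "dg_key g X Y (\<sigma> j) \<le> dg_key g X Y (\<sigma> j')" if "j < j'" "j' < N" for j j'
      unfolding \<sigma>_def by (rule sorted_tokens(2)[OF bij[unfolded N]]) (use Q2 N that in \<open>blast+\<close>)
    define W where "W j = (if j < 4096 * (k - card X) then V (insert (fst (\<sigma> j)) X) Y else V X (Y - {fst (\<sigma> j)}))" for j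
    have ineq: "real N * V X Y \<le> (\<Sum>j<N. W j)"
      unfolding W_def N_def
      by (rule V[unfolded dg_ineq_def, rule_format, OF s(3) YU s(5,6) neq \<sigma>[unfolded N_def]]) (use srt in \<open>simp add: N_def\<close>)
    let ?Q3 = "\<lambda>s2. \<exists>r<N. s2 = s1\<lparr>nvar := (nvar s1)(10 := r)\<rparr>"
    show ?thesis
    proof (rule exec_Seq[where ?Q1.0 = ?Q3 and ?\<phi>1.0 = "\<lambda>s2. W (nvar s2 10)"])
      show "exec n g (Rand 10 (NSub (NVar 5) (NConst 1))) s1 1 ?Q3 (\<lambda>s2. W (nvar s2 10)) (V X Y)"
      proof (rule exec_Rand)
        have e: "nval s1 (NSub (NVar 5) (NConst 1)) + 1 = N" using N N0 by simp
        show "V X Y * real (nval s1 (NSub (NVar 5) (NConst 1)) + 1) \<le> (\<Sum>r<nval s1 (NSub (NVar 5) (NConst 1)) + 1.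
           W (nvar (s1\<lparr>nvar := (nvar s1)(10 := r)\<rparr>) 10))"
          unfolding e using ineq by (simp add: mult.commute)
        fix r assume "r \<le> nval s1 (NSub (NVar 5) (NConst 1))"
        then have "r < N" using e by linarith
        then show "?Q3 (s1\<lparr>nvar := (nvar s1)(10 := r)\<rparr>)" by blast
      qed
    next
      fix s2 assume "?Q3 s2"
      then obtain r where r: "r < N" and s2: "s2 = s1\<lparr>nvar := (nvar s1)(10 := r)\<rparr>" by auto
      let ?Q4 = "\<lambda>s3. agree {6,7,8,9} {} {} s2 s3 \<and> nvar s3 9 = order_index (rarr s1 0) N r"
      have sel: "terminates n g select s2 (n * 4096 * (n * 4096 * 20 + 22) + 3) ?Q4"
      proof (rule terminates_mono[OF select_terminates[of s2 N]])
        show "nvar s2 5 = N" unfolding s2 using N by simp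
        show "N * (N * 20 + 22) + 3 \<le> n * 4096 * (n * 4096 * 20 + 22) + 3" using Nn by (intro add_mono mult_mono) auto
        fix s3 assume "agree {6,7,8,9} {} {} s2 s3 \<and> rarr s3 = rarr s2 \<and>
           (nvar s2 10 < N \<longrightarrow> nvar s3 9 = order_index (rarr s2 0) N (nvar s2 10))"
        then show "?Q4 s3" using r unfolding s2 by simp
      qed
      have mv: "terminates n g dg_move s3 6 (\<lambda>s'. dg_inv n k (Suc i) s' \<and> ?post s' = W r)" if Q4: "?Q4 s3" for s3
      proof -
        have ag: "agree {6,7,8,9} {} {} s2 s3" using Q4 by blast
        have nv: "nvar s3 x = nvar s x" if "x \<notin> {5,6,7,8,9,10,15,16,17}" for x
        proof -
          have "nvar s3 x = nvar s2 x" using that by (intro agreeD(1)[OF ag]) auto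
          also have "\<dots> = nvar s1 x" using that unfolding s2 by simp
          also have "\<dots> = nvar s x" using that by (intro agreeD(1)[OF a]) auto
          finally show ?thesis .
        qed
        have na3: "narr s3 a = narr s1 a" for a using agreeD(2)[OF ag, of a] unfolding s2 by simp
        have na: "narr s3 0 = narr s 0" "narr s3 1 = narr s 1"
          unfolding na3 using agreeD(2)[OF a, of 0] agreeD(2)[OF a, of 1] by simp_all
        have XY3: "X = array_set n s3 0" "Y = array_set n s3 1" unfolding X_def Y_def array_set_def na by auto
        have inv3: "dg_inv n k i s3" unfolding dg_inv_def XY3[symmetric] using s nv by simp
        have r3: "nvar s3 10 = r" using agreeD(1)[OF ag, of 10] unfolding s2 by simp
        have u: "narr s3 3 (nvar s3 9) = fst (\<sigma> r)" unfolding na3 \<sigma>_def using Q4 by simp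
        have "\<sigma> r \<in> (Y - X) \<times> {..<4096}" using \<sigma> r by (auto simp: bij_betw_def)
        then have uD: "fst (\<sigma> r) \<in> Y - X" by auto
        have \<rho>: "nvar s3 10 < card (Y - X) * 4096" using r r3 unfolding N_def by simp
        show ?thesis
          by (rule terminates_mono[OF dg_move_terminates[OF inv3 i u uD XY3 \<rho>]])
            (auto simp: r3 W_def split: if_splits)
      qed
      have "exec n g (Seq select dg_move) s2 ((n * 4096 * (n * 4096 * 20 + 22) + 3) + 6 + 1)
         (\<lambda>s'. dg_inv n k (Suc i) s' \<and> ?post s' = W r) ?post (W r)"
        by (rule exec_terminates[OF terminates_Seq[OF sel mv]]) auto
      then show "exec n g (Seq select dg_move) s2 ((n * 4096 * (n * 4096 * 20 + 22) + 3) + 6 + 1)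
         (dg_inv n k (Suc i)) ?post (W (nvar s2 10))"
        by (rule exec_mono) (auto simp: s2)
    qed
  qed
  have r2: "exec n g (Seq dg_fill (Seq (Rand 10 (NSub (NVar 5) (NConst 1))) (Seq select dg_move))) s1
      ((n * 60000 + 6) + (1 + ((n * 4096 * (n * 4096 * 20 + 22) + 3) + 6 + 1) + 1) + 1) (dg_inv n k (Suc i)) ?post (V X Y)"
    if "?Q1 s1" for s1
    by (rule exec_Seq[OF exec_terminates[OF fill[OF that], of "V X Y" "\<lambda>_. V X Y"]]) (simp, rule rest)
  show ?thesis
    unfolding dg_step_def X_def[symmetric] Y_def[symmetric]
  proof (rule exec_mono[OF exec_Seq[OF exec_terminates[OF q, of "V X Y" "\<lambda>_. V X Y"]]])
    show "\<And>s'. ?Q1 s' \<Longrightarrow> exec n g (Seq dg_fill (Seq (Rand 10 (NSub (NVar 5) (NConst 1))) (Seq select dg_move))) s'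
      ((n * 60000 + 6) + (1 + ((n * 4096 * (n * 4096 * 20 + 22) + 3) + 6 + 1) + 1) + 1) (dg_inv n k (Suc i)) ?post (V X Y)"
      by (rule r2)
  qed auto
qed

definition double_greedy_prog :: com where
  "double_greedy_prog = Seq (Seq (NAssign 12 (NVar 1)) (NAssign 15 (NConst 0)))
     (Seq (While (NLess (NVar 15) (NVar 0)) (Seq (NStore 1 (NVar 15) (NConst 1)) (NAssign 15 (NAdd (NVar 15) (NConst 1)))))
       (While (NLess (NVar 11) (NVar 0)) dg_step))"

lemma double_greedy_exec_ineq:
  assumes s: "nvar s 0 = n" "nvar s 1 = k" "nvar s 11 = 0" "\<And>i. narr s 0 i = 0" and k: "k \<le> n" and V: "dg_ineq n k g V"
  shows "exec n g double_greedy_prog s (n * 5 + n * (n * 60000 + n * 4096 * (n * 4096 * 20 + 22) + 32) + 7)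
     (\<lambda>s'. card (array_set n s' 0) = k \<and> array_set n s' 1 = array_set n s' 0)
     (\<lambda>s'. V (array_set n s' 0) (array_set n s' 1)) (V {} {..<n})"
proof -
  let ?I = "\<lambda>u s'. agree {12,15} {1} {} s s' \<and> nvar s' 12 = k \<and> nvar s' 15 = u \<and> (\<forall>i<u. narr s' 1 i = 1)"
  let ?body = "Seq (NStore 1 (NVar 15) (NConst 1)) (NAssign 15 (NAdd (NVar 15) (NConst 1)))"
  let ?V = "\<lambda>s'. V (array_set n s' 0) (array_set n s' 1)"
  let ?R = "\<lambda>s'. dg_inv n k 0 s' \<and> array_set n s' 0 = {} \<and> array_set n s' 1 = {..<n}"
  have a: "terminates n g (Seq (NAssign 12 (NVar 1)) (NAssign 15 (NConst 0))) s 3 (?I 0)"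
    by (rule terminates_straight) (use s in \<open>auto simp: agree_def\<close>)
  have b: "terminates n g (While (NLess (NVar 15) (NVar 0)) ?body) s1 (n * (3 + 2) + 1) ?R" if "?I 0 s1" for s1
  proof (rule terminates_mono[OF terminates_While[where I = ?I]])
    fix u s' assume u: "u < n" and I: "?I u s'"
    have "nvar s' 0 = n" using I s by (auto simp: agree_def)
    moreover have "terminates n g ?body s' 3 (?I (Suc u))"
      by (rule terminates_straight) (use I in \<open>auto simp: agree_def less_Suc_eq\<close>)
    ultimately show "bval s' (NLess (NVar 15) (NVar 0)) \<and> terminates n g ?body s' 3 (?I (Suc u))" using u I by simp
  next
    show "\<And>s'. ?I n s' \<Longrightarrow> \<not> bval s' (NLess (NVar 15) (NVar 0))" using s by (auto simp: agree_def)
    fix s' assume I: "?I n s'"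
    have v: "nvar s' 0 = n" "nvar s' 11 = 0" "narr s' 0 = narr s 0" "nvar s' 12 = k" using I s by (auto simp: agree_def)
    have XY: "array_set n s' 0 = {}" "array_set n s' 1 = {..<n}" unfolding array_set_def v using I s(4) by auto
    show "?R s'" unfolding dg_inv_def XY using v k by simp
  qed (rule that, simp)
  have c: "exec n g (While (NLess (NVar 11) (NVar 0)) dg_step) s1
     ((n - 0) * ((n * 60000 + n * 4096 * (n * 4096 * 20 + 22) + 30) + 2) + 1) (dg_inv n k n) ?V (V {} {..<n})"
    if R: "?R s1" for s1
  proof -
    have "exec n g (While (NLess (NVar 11) (NVar 0)) dg_step) s1
     ((n - 0) * ((n * 60000 + n * 4096 * (n * 4096 * 20 + 22) + 30) + 2) + 1) (dg_inv n k n) ?V (?V s1)"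
    proof (rule exec_While[where I = "dg_inv n k" and V = "\<lambda>_. ?V"])
      fix i s' assume i: "i < n" and I: "dg_inv n k i s'"
      have "bval s' (NLess (NVar 11) (NVar 0))" using I i by (simp add: dg_inv_def)
      then show "bval s' (NLess (NVar 11) (NVar 0)) \<and> exec n g dg_step s' (n * 60000 + n * 4096 * (n * 4096 * 20 + 22) + 30)
         (dg_inv n k (Suc i)) ?V (?V s')" using dg_step_exec[OF I i V] by blast
    next
      show "\<And>s. dg_inv n k n s \<Longrightarrow> \<not> bval s (NLess (NVar 11) (NVar 0))" by (auto simp: dg_inv_def)
    qed (use R in auto)
    then show ?thesis using R by simp
  qed
  have fin: "card (array_set n s' 0) = k \<and> array_set n s' 1 = array_set n s' 0" if I: "dg_inv n k n s'" for s'
  proof -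
    have "finite (array_set n s' 1 - array_set n s' 0)" by (simp add: array_set_def)
    then have "array_set n s' 1 = array_set n s' 0" using I unfolding dg_inv_def by auto
    then show ?thesis using I unfolding dg_inv_def by auto
  qed
  have bc: "exec n g (Seq (While (NLess (NVar 15) (NVar 0)) ?body) (While (NLess (NVar 11) (NVar 0)) dg_step)) s1
     ((n * (3 + 2) + 1) + ((n - 0) * ((n * 60000 + n * 4096 * (n * 4096 * 20 + 22) + 30) + 2) + 1) + 1)
     (dg_inv n k n) ?V (V {} {..<n})" if "?I 0 s1" for s1
    by (rule exec_Seq[OF exec_terminates[OF b[OF that], of "V {} {..<n}" "\<lambda>_. V {} {..<n}"]]) (simp, rule c)
  show ?thesis
    unfolding double_greedy_prog_def
  proof (rule exec_mono[OF exec_Seq[OF exec_terminates[OF a, of "V {} {..<n}" "\<lambda>_. V {} {..<n}"]]])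
    show "\<And>s'. ?I 0 s' \<Longrightarrow> exec n g (Seq (While (NLess (NVar 15) (NVar 0)) ?body) (While (NLess (NVar 11) (NVar 0)) dg_step)) s'
     ((n * (3 + 2) + 1) + ((n - 0) * ((n * 60000 + n * 4096 * (n * 4096 * 20 + 22) + 30) + 2) + 1) + 1)
     (dg_inv n k n) ?V (V {} {..<n})" by (rule bc)
  qed (use fin in auto)
qed

text \<open>The case \<open>k = n\<close> belongs here too, as the complement would then ask for an
  empty set; a constant potential handles it, only one set being feasible. Otherwise
  \<open>\<epsilon> = 1 / 10^8\<close> and \<open>M\<close> near \<open>n / 500\<close> are small
  enough for the margin between \<open>1 / 2.7\<close> and \<open>1 / e\<close>.\<close>

lemma double_greedy_exec:
  assumes s: "nvar s 0 = n" "nvar s 1 = k" "nvar s 11 = 0" "\<And>i. narr s 0 i = 0"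
    and k: "1 \<le> k" "k \<le> n" "k < n \<Longrightarrow> n \<le> 10 * k \<and> n \<le> 10 * (n - k)"
    and sub: "nonneg_submodular {..<n} g"
    and P: "\<And>A. A \<subseteq> {..<n} \<Longrightarrow> card A = k \<Longrightarrow> g A \<le> P"
    and OPT: "OPT \<subseteq> {..<n}" "card OPT = k" "g OPT = P"
  shows "exec n g double_greedy_prog s (n * 5 + n * (n * 60000 + n * 4096 * (n * 4096 * 20 + 22) + 32) + 7)
     (\<lambda>s'. card (array_set n s' 0) = k) (\<lambda>s'. g (array_set n s' 0)) ((exp (- 1) - 10 ^ 24 / real n) * P)"
proof -
  interpret nonneg_submodular "{..<n}" g by (rule sub)
  have P0: "0 \<le> P" using OPT nonneg by auto
  define v where "v = (exp (- 1) - 10 ^ 24 / real n) * P"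
  have "\<exists>V. dg_ineq n k g V \<and> v \<le> V {} {..<n} \<and> (\<forall>A. A \<subseteq> {..<n} \<longrightarrow> card A = k \<longrightarrow> V A A \<le> g A)"
  proof (cases "k = n")
    case True
    have "exp (- 1) \<le> (1 :: real)" by simp
    moreover have "0 \<le> 10 ^ 24 / real n" by simp
    ultimately have "exp (- 1) - 10 ^ 24 / real n \<le> 1" by linarith
    then have "v \<le> 1 * P" unfolding v_def using P0 by (rule mult_right_mono)
    moreover have "A = OPT" if "A \<subseteq> {..<n}" "card A = k" for A
      using that OPT True card_subset_eq[of "{..<n}" A] card_subset_eq[of "{..<n}" OPT] by simp
    ultimately show ?thesis using OPT(3)
      by (intro exI[of _ "\<lambda>_ _. v"]) (auto simp: dg_ineq_def)
  next
    case False
    then have kn: "k < n" "n \<le> 10 * k" "n \<le> 10 * (n - k)" using k by auto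
    define r where "r = real k / real n"
    define M where "M = n div 500 + 1"
    define B where "B = 27 / 10 * (10 * P) / (1 / 10 ^ 8)\<^sup>2"
    define e where "e = 11 * (10 * P) * (1 / 10 ^ 8) / real M + 5 * B / (real M)\<^sup>2"
    have G: "g A \<le> 10 * P" if "A \<subseteq> {..<n}" for A
      by (rule bounded_by_opt[of k]) (use kn P that in auto)
    have "real n \<le> 10 * real k" "10 * real k \<le> 9 * real n" using kn by linarith+
    then have r: "1 / 10 \<le> r" "r \<le> 9 / 10" unfolding r_def using kn by (simp_all add: field_simps)
    \<comment> \<open>Once \<open>X = Y\<close> the potential is \<open>27 / 10 * f X\<close>;
      dividing by \<open>27 / 10\<close> makes the final value \<open>f X\<close> itself.\<close>
    let ?V = "\<lambda>X Y. dg_pot OPT k r M e B X Y / (27 / 10)"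
    have "dg_ineq n k g ?V"
      unfolding dg_ineq_def
    proof (intro allI impI)
      fix X Y \<sigma> assume XY: "X \<subseteq> Y" "Y \<subseteq> {..<n}" "card X \<le> k" "k \<le> card Y" "X \<noteq> Y"
        and \<sigma>: "bij_betw \<sigma> {..<card (Y - X) * 4096} ((Y - X) \<times> {..<4096 :: nat})"
        and srt: "\<forall>j j'. j < j' \<longrightarrow> j' < card (Y - X) * 4096 \<longrightarrow> dg_key g X Y (\<sigma> j) \<le> dg_key g X Y (\<sigma> j')"
      let ?N = "card (Y - X) * 4096"
      have "real ?N * dg_pot OPT k r M e B X Y \<le> (\<Sum>j<?N. if j < 4096 * (k - card X)
         then dg_pot OPT k r M e B (insert (fst (\<sigma> j)) X) Y else dg_pot OPT k r M e B X (Y - {fst (\<sigma> j)}))"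
        by (rule dg_token_step[where L = 4096 and G = "10 * P" and \<epsilon> = "1 / 10 ^ 8" and key = "dg_key g X Y"])
          (use XY r G \<sigma> srt in \<open>auto simp: M_def B_def e_def dg_key_def\<close>)
      then have "real ?N * dg_pot OPT k r M e B X Y / (27 / 10) \<le> (\<Sum>j<?N. if j < 4096 * (k - card X)
         then dg_pot OPT k r M e B (insert (fst (\<sigma> j)) X) Y else dg_pot OPT k r M e B X (Y - {fst (\<sigma> j)})) / (27 / 10)"
        by (rule divide_right_mono) simp
      then show "real ?N * ?V X Y \<le> (\<Sum>j<?N. if j < 4096 * (k - card X)
         then ?V (insert (fst (\<sigma> j)) X) Y else ?V X (Y - {fst (\<sigma> j)}))"
        unfolding sum_divide_distrib if_distrib[of "\<lambda>z. z / (27 / 10)"] by (simp only: times_divide_eq_right)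
    qed
    moreover have "27 / 10 * v \<le> dg_pot OPT k r M e B {} {..<n}"
      unfolding v_def
      by (rule dg_pot_start) (use OPT kn in \<open>auto simp: r_def M_def B_def e_def\<close>)
    moreover have "?V A A \<le> g A" if "A \<subseteq> {..<n}" for A
      using nonneg[OF that] by (simp add: dg_pot_def mix_def)
    ultimately show ?thesis by (intro exI[of _ ?V]) auto
  qed
  then obtain V where V: "dg_ineq n k g V" "v \<le> V {} {..<n}" "\<And>A. A \<subseteq> {..<n} \<Longrightarrow> card A = k \<Longrightarrow> V A A \<le> g A"
    by blast
  have "array_set n s' 0 \<subseteq> {..<n}" for s' by (auto simp: array_set_def)
  then show ?thesis
    unfolding v_def[symmetric]
    by (intro exec_mono[OF double_greedy_exec_ineq[OF s k(2) V(1)]]) (use V in auto)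
qed

section \<open>The algorithm\<close>

abbreviation "tenfold u \<equiv> NAdd (ndouble 3 u) (ndouble 1 u)"

definition main_prog :: com where
  "main_prog = If (NLess (NVar 0) (tenfold (NVar 1)))
     (If (BAnd (NLess (NVar 1) (NVar 0)) (BNot (NLess (NVar 0) (tenfold (NSub (NVar 0) (NVar 1))))))
       (Seq (Seq (NAssign 2 (NSub (NVar 0) (NVar 1))) (Seq (NAssign 3 (NConst 0)) (NAssign 4 (NConst 1)))) aided)
       double_greedy_prog)
     (Seq (Seq (NAssign 2 (NVar 1)) (Seq (NAssign 3 (NConst 1)) (NAssign 4 (NConst 0)))) aided)"

text \<open>The running times of the branches are added instead of maximised, which leaves a
  polynomial with natural coefficients.\<close>

definition main_time :: "nat \<Rightarrow> nat" where
  "main_time n = (n * 10 + n * n * (n * (n * 22 + 8) + n * n * (n * n * 20 + 22) + n * 5 + 42) + n * 10 +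
      n * (n * 30 + (n * (n * 20 + 22)) + 32) + n * 5 + 40) +
      (n * 5 + n * (n * 60000 + n * 4096 * (n * 4096 * 20 + 22) + 32) + 7) + 10"

lemma main_time_poly: "\<exists>p :: nat poly. \<forall>n. poly p n = main_time n"
proof -
  define poly_fun :: "(nat \<Rightarrow> nat) \<Rightarrow> bool" where "poly_fun h \<longleftrightarrow> (\<exists>p :: nat poly. \<forall>n. poly p n = h n)" for h
  have const: "poly_fun (\<lambda>n. c)" for c unfolding poly_fun_def by (intro exI[of _ "[:c:]"]) simp
  have id: "poly_fun (\<lambda>n. n)" unfolding poly_fun_def by (intro exI[of _ "[:0, 1:]"]) simp
  have add: "poly_fun (\<lambda>n. h n + h' n)" if "poly_fun h" "poly_fun h'" for h h'
    using that unfolding poly_fun_def by (metis poly_add)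
  have mult: "poly_fun (\<lambda>n. h n * h' n)" if "poly_fun h" "poly_fun h'" for h h'
    using that unfolding poly_fun_def by (metis poly_mult)
  have "poly_fun main_time" unfolding main_time_def by (intro const id add mult)
  then show ?thesis unfolding poly_fun_def .
qed

lemma main_exec:
  assumes k: "1 \<le> k" "k \<le> n" and sub: "nonneg_submodular {..<n} g"
    and P: "\<And>A. A \<subseteq> {..<n} \<Longrightarrow> card A = k \<Longrightarrow> g A \<le> P"
    and OPT: "OPT \<subseteq> {..<n}" "card OPT = k" "g OPT = P"
  shows "exec n g main_prog (init_state n k) (main_time n)
     (\<lambda>s'. card (array_set n s' 0) = k) (\<lambda>s'. g (array_set n s' 0)) ((exp (- 1) - 10 ^ 24 / real n) * P)"
proof -
  interpret nonneg_submodular "{..<n}" g by (rule sub)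
  define A where "A = n * 10 + n * n * (n * (n * 22 + 8) + n * n * (n * n * 20 + 22) + n * 5 + 42) + n * 10 +
      n * (n * 30 + (n * (n * 20 + 22)) + 32) + n * 5 + 40"
  define B where "B = n * 5 + n * (n * 60000 + n * 4096 * (n * 4096 * 20 + 22) + 32) + 7"
  define v where "v = (exp (- 1) - 10 ^ 24 / real n) * P"
  let ?s = "init_state n k"
  let ?Q = "\<lambda>s'. card (array_set n s' 0) = k" and ?\<phi> = "\<lambda>s'. g (array_set n s' 0)"
  have P0: "0 \<le> P" using OPT nonneg by auto
  have v: "v \<le> (exp (- 1) - 1000 / real n) * P"
    unfolding v_def using P0 by (intro mult_right_mono diff_left_mono divide_right_mono) auto
  have small: "exec n g (Seq (Seq (NAssign 2 (NVar 1)) (Seq (NAssign 3 (NConst 1)) (NAssign 4 (NConst 0)))) aided)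
     ?s (A + B + 8) ?Q ?\<phi> v" if b: "10 * k \<le> n"
  proof -
    let ?R = "\<lambda>s'. nvar s' 0 = n \<and> nvar s' 2 = k \<and> nvar s' 3 = 1 \<and> flags s' \<and> nvar s' 13 = 0 \<and> nvar s' 11 = 0"
    have "terminates n g (Seq (NAssign 2 (NVar 1)) (Seq (NAssign 3 (NConst 1)) (NAssign 4 (NConst 0)))) ?s 5 ?R"
      by (rule terminates_straight) (auto simp: init_state_def flags_def)
    note pre = exec_terminates[OF this, of v "\<lambda>_. v", OF order_refl]
    have o: "oracle_of n g 1 = g" by (auto simp: oracle_of_def)
    have aid: "exec n g aided s1 A (\<lambda>s'. nvar s' 3 = 1 \<and> flags s' \<and> valid n s' 0 \<and> card (members n s' 0) = k)
        (\<lambda>s'. oracle_of n g 1 (members n s' 0)) ((exp (- 1) - 1000 / real n) * P)" if "?R s1" for s1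
      unfolding A_def by (rule aided_exec) (use that k b sub P OPT in \<open>auto simp: o simp del: One_nat_def\<close>)
    have "exec n g aided s1 A ?Q ?\<phi> v" if "?R s1" for s1
    proof (rule exec_mono[OF aid[OF that]])
      fix s' assume Q: "nvar s' 3 = 1 \<and> flags s' \<and> valid n s' 0 \<and> card (members n s' 0) = k"
      then have "nvar s' 4 = 0" by (auto simp: flags_def)
      then have "array_set n s' 0 = members n s' 0" using Q by (auto simp: array_set_def members_def valid_def)
      then show "?Q s'" "oracle_of n g 1 (members n s' 0) \<le> ?\<phi> s'" using Q by (simp_all add: o del: One_nat_def)
    qed (use v in auto)
    from exec_Seq[OF pre this] show ?thesis by (rule exec_mono) auto
  qed
  have large: "exec n g (Seq (Seq (NAssign 2 (NSub (NVar 0) (NVar 1))) (Seq (NAssign 3 (NConst 0)) (NAssign 4 (NConst 1)))) aided)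
     ?s (A + B + 8) ?Q ?\<phi> v" if b: "k < n" "10 * (n - k) \<le> n"
  proof -
    let ?R = "\<lambda>s'. nvar s' 0 = n \<and> nvar s' 2 = n - k \<and> nvar s' 3 = 0 \<and> flags s' \<and> nvar s' 13 = 0 \<and> nvar s' 11 = 0"
    have "terminates n g (Seq (NAssign 2 (NSub (NVar 0) (NVar 1))) (Seq (NAssign 3 (NConst 0)) (NAssign 4 (NConst 1)))) ?s 5 ?R"
      by (rule terminates_straight) (auto simp: init_state_def flags_def)
    note pre = exec_terminates[OF this, of v "\<lambda>_. v", OF order_refl]
    have o: "oracle_of n g 0 = (\<lambda>S. g ({..<n} - S))" by (auto simp: oracle_of_def)
    have cc: "card ({..<n} - S) = n - card S" if "S \<subseteq> {..<n}" for S
      using that by (simp add: card_Diff_subset finite_subset)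
    have dd: "{..<n} - ({..<n} - S) = S" if "S \<subseteq> {..<n}" for S using that by auto
    have aid: "exec n g aided s1 A (\<lambda>s'. nvar s' 3 = 0 \<and> flags s' \<and> valid n s' 0 \<and> card (members n s' 0) = n - k)
        (\<lambda>s'. oracle_of n g 0 (members n s' 0)) ((exp (- 1) - 1000 / real n) * P)" if "?R s1" for s1
      unfolding A_def
    proof (rule aided_exec[where OPT = "{..<n} - OPT"])
      show "nonneg_submodular {..<n} (oracle_of n g 0)" unfolding o by (rule complement)
      show "\<And>S. S \<subseteq> {..<n} \<Longrightarrow> card S = n - k \<Longrightarrow> oracle_of n g 0 S \<le> P"
        unfolding o by (rule P) (use k in \<open>auto simp: cc\<close>)
    qed (use that k b OPT in \<open>auto simp: o cc dd\<close>)
    have "exec n g aided s1 A ?Q ?\<phi> v" if "?R s1" for s1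
    proof (rule exec_mono[OF aid[OF that]])
      fix s' assume Q: "nvar s' 3 = 0 \<and> flags s' \<and> valid n s' 0 \<and> card (members n s' 0) = n - k"
      then have "nvar s' 4 = 1" by (auto simp: flags_def)
      then have e: "array_set n s' 0 = {..<n} - members n s' 0" using Q by (auto simp: array_set_def members_def valid_def)
      have "members n s' 0 \<subseteq> {..<n}" by (auto simp: members_def)
      then show "?Q s'" "oracle_of n g 0 (members n s' 0) \<le> ?\<phi> s'" using Q k unfolding e o by (simp_all add: cc)
    qed (use v in auto)
    from exec_Seq[OF pre this] show ?thesis by (rule exec_mono) auto
  qed
  have medium: "exec n g double_greedy_prog ?s (A + B + 8) ?Q ?\<phi> v" if "n < 10 * k" "k < n \<Longrightarrow> n < 10 * (n - k)"
    unfolding v_def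
    by (rule exec_mono[OF double_greedy_exec[where k = k and P = P and OPT = OPT]])
      (use that k sub P OPT in \<open>auto simp: init_state_def B_def\<close>)
  have "exec n g main_prog ?s (A + B + 8 + 1 + 1) ?Q ?\<phi> v"
    unfolding main_prog_def
  proof (rule exec_If)
    assume "bval ?s (NLess (NVar 0) (tenfold (NVar 1)))"
    then have b: "n < 10 * k" by (simp add: init_state_def)
    show "exec n g (If (BAnd (NLess (NVar 1) (NVar 0)) (BNot (NLess (NVar 0) (tenfold (NSub (NVar 0) (NVar 1))))))
       (Seq (Seq (NAssign 2 (NSub (NVar 0) (NVar 1))) (Seq (NAssign 3 (NConst 0)) (NAssign 4 (NConst 1)))) aided)
       double_greedy_prog) ?s (A + B + 8 + 1) ?Q ?\<phi> v"
      by (rule exec_If; (rule large | rule medium)) (use b in \<open>auto simp: init_state_def\<close>)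
  next
    assume "\<not> bval ?s (NLess (NVar 0) (tenfold (NVar 1)))"
    then have "10 * k \<le> n" by (simp add: init_state_def)
    from small[OF this] show "exec n g (Seq (Seq (NAssign 2 (NVar 1)) (Seq (NAssign 3 (NConst 1)) (NAssign 4 (NConst 0)))) aided)
      ?s (A + B + 8 + 1) ?Q ?\<phi> v" by (rule exec_mono) auto
  qed
  then show ?thesis unfolding v_def by (rule exec_mono) (auto simp: main_time_def A_def B_def)
qed

theorem theorem1p3:
  "\<exists>(P :: com) (p :: nat poly) (\<epsilon> :: nat \<Rightarrow> real).
     \<epsilon> \<longlonglongrightarrow> 0 \<and>
     (\<forall>(N :: 'a set) (e :: nat \<Rightarrow> 'a) (f :: 'a set \<Rightarrow> real) (k :: nat).
        finite N \<longrightarrow> bij_betw e {..<card N} N \<longrightarrow>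
        submodular_on N f \<longrightarrow> nonneg_on N f \<longrightarrow> 1 \<le> k \<longrightarrow> k \<le> card N \<longrightarrow>
        (let D = run P N e f k (poly p (card N)) in
           (\<forall>c \<in> set_pmf D. halted c \<and> output_set N e c \<in> feasible N k) \<and>
           measure_pmf.expectation D (\<lambda>c. f (output_set N e c))
             \<ge> (exp (- 1) - \<epsilon> (card N)) * opt_value N f k))"
proof -
  obtain p :: "nat poly" where p: "\<And>n. poly p n = main_time n" using main_time_poly by blast
  have lim: "(\<lambda>n. 10 ^ 24 / real n) \<longlonglongrightarrow> 0" by (rule lim_const_over_n)
  show ?thesis
  proof (intro exI[of _ main_prog] exI[of _ p] exI[of _ "\<lambda>n. 10 ^ 24 / real n"] conjI lim allI impI)
    fix N :: "'a set" and e :: "nat \<Rightarrow> 'a" and f :: "'a set \<Rightarrow> real" and k :: nat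
    assume N: "finite N" and e: "bij_betw e {..<card N} N" and f: "submodular_on N f" "nonneg_on N f"
      and k: "1 \<le> k" "k \<le> card N"
    define n where "n = card N"
    define g where "g I = f (e ` I)" for I
    have inj: "inj_on e {..<n}" and img: "e ` {..<n} = N" using e unfolding n_def bij_betw_def by auto
    have sub: "e ` I \<subseteq> N" if "I \<subseteq> {..<n}" for I using that img by auto
    have card: "card (e ` I) = card I" if "I \<subseteq> {..<n}" for I
      using that inj by (intro card_image) (rule inj_on_subset)
    have g: "nonneg_submodular {..<n} g"
    proof
      show "submodular_on {..<n} g"
        unfolding submodular_on_def
      proof (intro allI impI)
        fix A B assume AB: "A \<subseteq> {..<n}" "B \<subseteq> {..<n}"
        show "g A + g B \<ge> g (A \<union> B) + g (A \<inter> B)"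
          using f(1) sub[OF AB(1)] sub[OF AB(2)] inj_on_image_Int[OF inj AB]
          unfolding g_def submodular_on_def by (simp add: image_Un)
      qed
      show "nonneg_on {..<n} g" using f(2) sub unfolding g_def nonneg_on_def by auto
    qed auto
    have fin: "finite (feasible N k)" using N unfolding feasible_def by auto
    obtain S0 where "S0 \<subseteq> N" "card S0 = k" using k(2) by (rule obtain_subset_with_card_n)
    then have "f ` feasible N k \<noteq> {}" unfolding feasible_def by auto
    then have "opt_value N f k \<in> f ` feasible N k" unfolding opt_value_def using fin by (intro Max_in) auto
    then obtain S where S: "S \<subseteq> N" "card S = k" "f S = opt_value N f k" unfolding feasible_def by auto
    obtain OPT where OPT: "OPT \<subseteq> {..<n}" "S = e ` OPT" using S(1) img by (metis subset_imageE)
    have "exec n g main_prog (init_state n k) (main_time n) (\<lambda>s'. card (array_set n s' 0) = k)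
       (\<lambda>s'. g (array_set n s' 0)) ((exp (- 1) - 10 ^ 24 / real n) * opt_value N f k)"
    proof (rule main_exec)
      show "1 \<le> k" "k \<le> n" using k by (simp_all add: n_def)
      show "OPT \<subseteq> {..<n}" "card OPT = k" "g OPT = opt_value N f k"
        using OPT S card by (auto simp: g_def)
      fix A assume A: "A \<subseteq> {..<n}" "card A = k"
      then have "f (e ` A) \<in> f ` feasible N k" using sub card unfolding feasible_def by auto
      then show "g A \<le> opt_value N f k" unfolding g_def opt_value_def using fin by (intro Max_ge) auto
    qed (rule g)
    note res = exec_result[OF this order_refl]
    have run: "run main_prog N e f k (poly p n) = steps n g (main_time n) ([main_prog], init_state n k)"
      unfolding run_def p n_def[symmetric] g_def ..
    have out: "output_set N e c = e ` array_set n (snd c) 0" for c unfolding output_set_def n_def ..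
    have arr: "array_set n s a \<subseteq> {..<n}" for s a by (auto simp: array_set_def)
    show "let D = run main_prog N e f k (poly p (card N)) in
           (\<forall>c \<in> set_pmf D. halted c \<and> output_set N e c \<in> feasible N k) \<and>
           measure_pmf.expectation D (\<lambda>c. f (output_set N e c))
             \<ge> (exp (- 1) - 10 ^ 24 / real (card N)) * opt_value N f k"
      unfolding Let_def n_def[symmetric] run out
    proof
      show "\<forall>c\<in>set_pmf (steps n g (main_time n) ([main_prog], init_state n k)).
         halted c \<and> e ` array_set n (snd c) 0 \<in> feasible N k"
        using res(1) sub[OF arr] card[OF arr] unfolding feasible_def by auto
      show "(exp (- 1) - 10 ^ 24 / real n) * opt_value N f k \<le>
         measure_pmf.expectation (steps n g (main_time n) ([main_prog], init_state n k)) (\<lambda>c. f (e ` array_set n (snd c) 0))"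
        using res(2) unfolding g_def .
    qed
  qed
qed

end
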